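(* (i) Let $\xi$ and $\xi^*$ be symmetric integrable random vectors in $\mathbb{R}^d$ (or symmetric stochastic processes with integrable values on a common index set $T$), and let $X=\sum_{k=1}^\infty\Gamma_k^{-1}\xi^{(k)}$ and $X^*=\sum_{k=1}^\infty\Gamma_k^{-1}\xi^{*(k)}$ be the corresponding LePage series. Then $X$ and $X^*$ coincide in distribution if and only if $\xi$ and $\xi^*$ are zonoid equivalent. (ii) Let $\xi$ and $\xi^*$ be integrable random vectors in $\mathbb{R}^d$ with positive coordinates (or positive stochastic processes with integrable values on a common index set $T$), and let $Y=\max_{k\ge1}\Gamma_k^{-1}\xi^{(k)}$ and $Y^*=\max_{k\ge1}\Gamma_k^{-1}\xi^{*(k)}$ (coordinatewise maxima). Then $Y$ and $Y^*$ coincide in distribution if and only if $\xi$ and $\xi^*$ are zonoid equivalent.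
   Context: $\Gamma_k=\zeta_1+\cdots+\zeta_k$, $k\ge1$, are successive sums of i.i.d. standard exponential random variables; $\xi^{(1)},\xi^{(2)},\ldots$ are i.i.d. copies of $\xi$ and $\xi^{*(1)},\xi^{*(2)},\ldots$ are i.i.d. copies of $\xi^*$, in each case independent of $\{\Gamma_k\}$. Symmetric means that $\xi$ and $-\xi$ have the same distribution (finite-dimensional distributions, for processes). For processes, equality in distribution means equality of all finite-dimensional distributions. Two integrable random vectors $\xi,\xi^*$ in $\mathbb{R}^d$ are zonoid equivalent if $\mathbf{E}|\langle u,\xi\rangle|=\mathbf{E}|\langle u,\xi^*\rangle|$ for all $u\in\mathbb{R}^d$; two families of integrable random variables $\{\xi_t,t\in T\}$ and $\{\xi^*_t,t\in T\}$ are zonoid equivalent if $(\xi_{t_1},\ldots,\xi_{t_n})$ and $(\xi^*_{t_1},\ldots,\xi^*_{t_n})$ are zonoid equivalent for all $n\ge1$, $t_1,\ldots,t_n\in T$. *)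

theory Defs
  imports "HOL-Probability.Probability"
begin

text \<open>Sequences are indexed from \<open>0\<close>: index \<open>k\<close> here is index \<open>k + 1\<close> in the usual notation
  \<open>\<Gamma>\<^sub>k = \<zeta>\<^sub>1 + \<dots> + \<zeta>\<^sub>k\<close>, \<open>k \<ge> 1\<close>.\<close>

definition iid_std_exponential :: "'w measure \<Rightarrow> (nat \<Rightarrow> 'w \<Rightarrow> real) \<Rightarrow> bool" where
  "iid_std_exponential M \<zeta> \<longleftrightarrow>
     prob_space.indep_vars M (\<lambda>_. borel) \<zeta> UNIV \<and>
     (\<forall>k. distributed M lborel (\<zeta> k) (exponential_density 1))"

definition arrival :: "(nat \<Rightarrow> 'w \<Rightarrow> real) \<Rightarrow> nat \<Rightarrow> 'w \<Rightarrow> real" where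
  "arrival \<zeta> k \<omega> = (\<Sum>i\<le>k. \<zeta> i \<omega>)"

text \<open>The library's \<^const>\<open>prob_space.indep_var\<close> forces both random elements to have the same
  value type; this is its unfolding with two different value types.\<close>

definition indep_elements ::
    "'w measure \<Rightarrow> 'a measure \<Rightarrow> ('w \<Rightarrow> 'a) \<Rightarrow> 'b measure \<Rightarrow> ('w \<Rightarrow> 'b) \<Rightarrow> bool" where
  "indep_elements M S X S' X' \<longleftrightarrow>
     X \<in> measurable M S \<and> X' \<in> measurable M S' \<and>
     prob_space.indep_set M {X -` A \<inter> space M | A. A \<in> sets S}
                            {X' -` B \<inter> space M | B. B \<in> sets S'}"

definition iid_copies_vec ::
    "'w measure \<Rightarrow> (nat \<Rightarrow> 'w \<Rightarrow> real ^ 'd) \<Rightarrow> 'p measure \<Rightarrow> ('p \<Rightarrow> real ^ 'd) \<Rightarrow> bool" where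
  "iid_copies_vec M \<xi>s P \<xi> \<longleftrightarrow>
     prob_space.indep_vars M (\<lambda>_. borel) \<xi>s UNIV \<and>
     (\<forall>k. distr M borel (\<xi>s k) = distr P borel \<xi>)"

definition lepage_input_vec ::
    "'w measure \<Rightarrow> (nat \<Rightarrow> 'w \<Rightarrow> real) \<Rightarrow> (nat \<Rightarrow> 'w \<Rightarrow> real ^ 'd) \<Rightarrow>
     'p measure \<Rightarrow> ('p \<Rightarrow> real ^ 'd) \<Rightarrow> bool" where
  "lepage_input_vec M \<zeta> \<xi>s P \<xi> \<longleftrightarrow>
     iid_std_exponential M \<zeta> \<and> iid_copies_vec M \<xi>s P \<xi> \<and>
     indep_elements M (\<Pi>\<^sub>M k\<in>UNIV. borel) (\<lambda>\<omega> k. \<xi>s k \<omega>)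
                      (\<Pi>\<^sub>M k\<in>UNIV. borel) (\<lambda>\<omega> k. arrival \<zeta> k \<omega>)"

definition symmetric_vec :: "'p measure \<Rightarrow> ('p \<Rightarrow> real ^ 'd) \<Rightarrow> bool" where
  "symmetric_vec P \<xi> \<longleftrightarrow> distr P borel \<xi> = distr P borel (\<lambda>\<omega>. - \<xi> \<omega>)"

definition positive_vec :: "'p measure \<Rightarrow> ('p \<Rightarrow> real ^ 'd) \<Rightarrow> bool" where
  "positive_vec P \<xi> \<longleftrightarrow> (AE \<omega> in P. \<forall>i. 0 < \<xi> \<omega> $ i)"

definition zonoid_equivalent_vec ::
    "'p measure \<Rightarrow> ('p \<Rightarrow> real ^ 'd) \<Rightarrow> 'q measure \<Rightarrow> ('q \<Rightarrow> real ^ 'd) \<Rightarrow> bool" where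
  "zonoid_equivalent_vec P \<xi> Q \<eta> \<longleftrightarrow>
     (\<forall>u. (\<integral>\<omega>. \<bar>u \<bullet> \<xi> \<omega>\<bar> \<partial>P) = (\<integral>\<omega>. \<bar>u \<bullet> \<eta> \<omega>\<bar> \<partial>Q))"

definition lepage_sum_vec ::
    "(nat \<Rightarrow> 'w \<Rightarrow> real) \<Rightarrow> (nat \<Rightarrow> 'w \<Rightarrow> real ^ 'd) \<Rightarrow> 'w \<Rightarrow> real ^ 'd" where
  "lepage_sum_vec \<zeta> \<xi>s \<omega> = (\<Sum>k. inverse (arrival \<zeta> k \<omega>) *\<^sub>R \<xi>s k \<omega>)"

text \<open>The maximum over infinitely many \<open>k\<close> is a supremum. For integrable \<open>\<xi>\<close> the terms tend to
  \<open>0\<close> almost surely, so that it is almost surely finite, and attained for positive \<open>\<xi>\<close>.\<close>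

definition lepage_max_vec ::
    "(nat \<Rightarrow> 'w \<Rightarrow> real) \<Rightarrow> (nat \<Rightarrow> 'w \<Rightarrow> real ^ 'd) \<Rightarrow> 'w \<Rightarrow> real ^ 'd" where
  "lepage_max_vec \<zeta> \<xi>s \<omega> = (\<chi> i. SUP k. inverse (arrival \<zeta> k \<omega>) * \<xi>s k \<omega> $ i)"

text \<open>A process on \<open>T\<close> is a function of the index and the sample point; its values at indices
  outside \<open>T\<close> are irrelevant.\<close>

definition eq_fidi ::
    "'t set \<Rightarrow> 'w measure \<Rightarrow> ('t \<Rightarrow> 'w \<Rightarrow> real) \<Rightarrow> 'v measure \<Rightarrow> ('t \<Rightarrow> 'v \<Rightarrow> real) \<Rightarrow> bool" where
  "eq_fidi T M X N Y \<longleftrightarrow>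
     (\<forall>n\<ge>1. \<forall>t :: nat \<Rightarrow> 't. (\<forall>i<n. t i \<in> T) \<longrightarrow>
        distr M (\<Pi>\<^sub>M i\<in>{..<n}. borel) (\<lambda>\<omega>. \<lambda>i\<in>{..<n}. X (t i) \<omega>) =
        distr N (\<Pi>\<^sub>M i\<in>{..<n}. borel) (\<lambda>\<omega>. \<lambda>i\<in>{..<n}. Y (t i) \<omega>))"

definition iid_copies_proc ::
    "'t set \<Rightarrow> 'w measure \<Rightarrow> (nat \<Rightarrow> 't \<Rightarrow> 'w \<Rightarrow> real) \<Rightarrow>
     'p measure \<Rightarrow> ('t \<Rightarrow> 'p \<Rightarrow> real) \<Rightarrow> bool" where
  "iid_copies_proc T M \<xi>s P \<xi> \<longleftrightarrow>
     prob_space.indep_vars M (\<lambda>_. \<Pi>\<^sub>M t\<in>T. borel) (\<lambda>k \<omega>. \<lambda>t\<in>T. \<xi>s k t \<omega>) UNIV \<and>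
     (\<forall>k. eq_fidi T M (\<xi>s k) P \<xi>)"

definition lepage_input_proc ::
    "'t set \<Rightarrow> 'w measure \<Rightarrow> (nat \<Rightarrow> 'w \<Rightarrow> real) \<Rightarrow> (nat \<Rightarrow> 't \<Rightarrow> 'w \<Rightarrow> real) \<Rightarrow>
     'p measure \<Rightarrow> ('t \<Rightarrow> 'p \<Rightarrow> real) \<Rightarrow> bool" where
  "lepage_input_proc T M \<zeta> \<xi>s P \<xi> \<longleftrightarrow>
     iid_std_exponential M \<zeta> \<and> iid_copies_proc T M \<xi>s P \<xi> \<and>
     indep_elements M (\<Pi>\<^sub>M k\<in>UNIV. \<Pi>\<^sub>M t\<in>T. borel) (\<lambda>\<omega> k. \<lambda>t\<in>T. \<xi>s k t \<omega>)
                      (\<Pi>\<^sub>M k\<in>UNIV. borel) (\<lambda>\<omega> k. arrival \<zeta> k \<omega>)"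

definition integrable_proc :: "'t set \<Rightarrow> 'p measure \<Rightarrow> ('t \<Rightarrow> 'p \<Rightarrow> real) \<Rightarrow> bool" where
  "integrable_proc T P \<xi> \<longleftrightarrow> (\<forall>t\<in>T. integrable P (\<xi> t))"

definition symmetric_proc :: "'t set \<Rightarrow> 'p measure \<Rightarrow> ('t \<Rightarrow> 'p \<Rightarrow> real) \<Rightarrow> bool" where
  "symmetric_proc T P \<xi> \<longleftrightarrow> eq_fidi T P \<xi> P (\<lambda>t \<omega>. - \<xi> t \<omega>)"

definition positive_proc :: "'t set \<Rightarrow> 'p measure \<Rightarrow> ('t \<Rightarrow> 'p \<Rightarrow> real) \<Rightarrow> bool" where
  "positive_proc T P \<xi> \<longleftrightarrow> (\<forall>t\<in>T. AE \<omega> in P. 0 < \<xi> t \<omega>)"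

text \<open>The dimension \<open>n\<close> varies here, so an \<open>n\<close>-dimensional vector \<open>u\<close> is given by its
  coordinates \<open>u i\<close>, \<open>i < n\<close>, and the inner product is written out.\<close>

definition zonoid_equivalent_proc ::
    "'t set \<Rightarrow> 'p measure \<Rightarrow> ('t \<Rightarrow> 'p \<Rightarrow> real) \<Rightarrow> 'q measure \<Rightarrow> ('t \<Rightarrow> 'q \<Rightarrow> real) \<Rightarrow> bool" where
  "zonoid_equivalent_proc T P \<xi> Q \<eta> \<longleftrightarrow>
     (\<forall>n\<ge>1. \<forall>t :: nat \<Rightarrow> 't. (\<forall>i<n. t i \<in> T) \<longrightarrow>
        (\<forall>u :: nat \<Rightarrow> real.
           (\<integral>\<omega>. \<bar>\<Sum>i<n. u i * \<xi> (t i) \<omega>\<bar> \<partial>P) = (\<integral>\<omega>. \<bar>\<Sum>i<n. u i * \<eta> (t i) \<omega>\<bar> \<partial>Q)))"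

definition lepage_sum_proc ::
    "(nat \<Rightarrow> 'w \<Rightarrow> real) \<Rightarrow> (nat \<Rightarrow> 't \<Rightarrow> 'w \<Rightarrow> real) \<Rightarrow> 't \<Rightarrow> 'w \<Rightarrow> real" where
  "lepage_sum_proc \<zeta> \<xi>s t \<omega> = (\<Sum>k. inverse (arrival \<zeta> k \<omega>) * \<xi>s k t \<omega>)"

definition lepage_max_proc ::
    "(nat \<Rightarrow> 'w \<Rightarrow> real) \<Rightarrow> (nat \<Rightarrow> 't \<Rightarrow> 'w \<Rightarrow> real) \<Rightarrow> 't \<Rightarrow> 'w \<Rightarrow> real" where
  "lepage_max_proc \<zeta> \<xi>s t \<omega> = (SUP k. inverse (arrival \<zeta> k \<omega>) * \<xi>s k t \<omega>)"

end

theory Submission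
  imports Defs
begin

text \<open>Every functional of interest is a product \<open>\<Prod>\<^sub>k f (\<psi>\<^sub>k, \<Gamma>\<^sub>k)\<close> with i.i.d. real marks \<open>\<psi>\<^sub>k\<close>. Averaging the
  marks out gives \<open>E \<Prod>\<^sub>k h (\<Gamma>\<^sub>k)\<close>, and the renewal equation of the arrivals identifies it as
  \<open>exp (- \<integral>\<^sub>0\<^sup>\<infinity> (1 - h s) ds)\<close>. For the series, \<open>h s = E cos (\<langle>u, \<xi>\<rangle> / s)\<close>, so that the characteristic function of \<open>X\<close>
  is \<open>exp (- c E \<bar>\<langle>u, \<xi>\<rangle>\<bar>)\<close>; for the maximum, \<open>h s = P (max\<^sub>i u\<^sub>i \<xi>\<^sub>i \<le> s)\<close>, so that
  \<open>P (\<forall>i. Y\<^sub>i \<le> 1 / u\<^sub>i) = exp (- E max\<^sub>i u\<^sub>i \<xi>\<^sub>i)\<close>. Part (i) follows by the Cramer-Wold device. For part (ii),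
  let \<open>\<mu>\<close> have density \<open>\<xi>\<^sub>0\<close> with respect to \<open>P\<close>. Both the family \<open>E \<bar>\<langle>u, \<xi>\<rangle>\<bar>\<close> and the family
  \<open>E max\<^sub>i u\<^sub>i \<xi>\<^sub>i\<close> determine, and are determined by, the law of the ratios \<open>(\<xi>\<^sub>i / \<xi>\<^sub>0)\<^sub>i\<close> under \<open>\<mu>\<close>: differentiating
  \<open>\<integral> \<bar>W - t\<bar> d\<mu>\<close> and \<open>\<integral> max t V d\<mu>\<close> in \<open>t\<close> yields distribution functions.\<close>

section \<open>The renewal equation of a thinning function\<close>

text \<open>The renewal equation expresses conditioning on the next waiting time. Iterated, it gives
  the expectation of \<open>h (\<Gamma>_0) ... h (\<Gamma>_n) H (\<Gamma>_n)\<close> the value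
  \<open>H 0\<close> for every \<open>n\<close>, and \<open>H (\<Gamma>_n)\<close> tends to 1; this
  takes the place of the Laplace functional of a Poisson process. For the series, symmetry is what
  makes \<open>h\<close> real.

  The obstacle in part (i) is that the series need not converge absolutely: arrivals grow like
  \<open>k\<close>, so it behaves like a harmonic series with random signs. A divergent infinite sum
  only has a default value, so almost sure convergence must precede any computation of laws. It is
  obtained for fixed arrivals by truncation and Kolmogorov's inequality, and carried over to random
  arrivals by Fubini.

  In part (ii) both functionals are homogeneous of degree one. Dividing by a positive coordinate
  turns the coefficient of that coordinate into a free parameter \<open>t\<close>, and the
  derivatives in \<open>t\<close> are taken from the right because the integrands have
  kinks.\<close>

lemma exp_neg_quadratic_bound:
  fixes d :: real
  assumes "\<bar>d\<bar> \<le> 1"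
  shows "\<bar>exp (- d) - 1 + d\<bar> \<le> d\<^sup>2"
proof (cases "d \<le> 0")
  case True
  then show ?thesis
    using exp_bound[of "- d"] exp_ge_add_one_self[of "- d"] assms by auto
next
  case False
  have "exp (- d) \<le> 1 - d + d\<^sup>2 / 2"
  proof -
    have "exp (- d) = inverse (exp d)" by (simp add: exp_minus)
    also have "\<dots> \<le> inverse (1 + d + d\<^sup>2 / 2)"
      using False exp_lower_Taylor_quadratic[of d] by (intro le_imp_inverse_le) (auto intro: add_pos_nonneg)
    also have "\<dots> \<le> 1 - d + d\<^sup>2 / 2"
    proof -
      have "1 \<le> (1 - d + d\<^sup>2 / 2) * (1 + d + d\<^sup>2 / 2)"
        using mult_nonneg_nonneg[of "d\<^sup>2" "d\<^sup>2"] by (simp add: algebra_simps power2_eq_square)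
      moreover have "0 < 1 + d + d\<^sup>2 / 2" using False by (auto intro: add_pos_nonneg)
      ultimately show ?thesis by (simp add: field_simps)
    qed
    finally show ?thesis .
  qed
  then show ?thesis
    using exp_ge_add_one_self[of "- d"] by auto
qed

lemma int_const_Ioc:
  fixes x y c :: real
  shows "integrable lborel (\<lambda>s. indicator {x<..y} s * c)"
    and "x \<le> y \<Longrightarrow> (\<integral>s. indicator {x<..y} s * c \<partial>lborel) = c * (y - x)"
proof -
  show "integrable lborel (\<lambda>s. indicator {x<..y} s * c :: real)"
    by (cases "x \<le> y") (auto intro!: integrable_mult_left integrable_real_indicator)
  show "x \<le> y \<Longrightarrow> (\<integral>s. indicator {x<..y} s * c \<partial>lborel) = c * (y - x)"
    by (simp add: mult.commute)
qed

lemma exp_tail_int: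
  fixes x :: real
  shows "integrable lborel (\<lambda>s. indicator {x<..} s * exp (- s))"
proof -
  have "integrable lborel (exponential_density 1)"
    using nn_integral_erlang_ith_moment[of 1 0 0]
    by (intro integrableI_nonneg) (auto simp: exponential_density_nonneg)
  then have "integrable lborel (\<lambda>s. exp (- x) * exponential_density 1 (- x + 1 * s))"
    by (intro integrable_mult_right lborel_integrable_real_affine) auto
  then have "integrable lborel (\<lambda>s. indicator {x..} s * exp (- s) :: real)"
    by (rule Bochner_Integration.integrable_cong[THEN iffD1, rotated 2])
       (auto simp: exponential_density_def mult_exp_exp split: split_indicator)
  then show ?thesis
    by (rule Bochner_Integration.integrable_bound) (auto split: split_indicator)
qed

text \<open>The renewal equation \<open>H x = \<integral> e\<^sup>-\<^sup>s h (x + s) H (x + s) ds\<close> of \<open>H x = exp (- \<integral>\<^sub>x\<^sup>\<infinity> (1 - h))\<close>.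
  As \<open>h\<close> is only measurable, the fundamental theorem of calculus is replaced by a bound
  \<open>O(\<bar>y - x\<bar>\<^sup>2)\<close> on the increments of the difference of the two sides.\<close>

locale thinning =
  fixes h :: "real \<Rightarrow> real"
  assumes h_meas [measurable]: "h \<in> borel_measurable borel"
    and h_le: "\<And>s. \<bar>h s\<bar> \<le> 1"
    and h_int: "integrable lborel (\<lambda>s. 1 - h s)"
begin

definition tail :: "real \<Rightarrow> real" where
  "tail x = (\<integral>s. indicator {x<..} s * (1 - h s) \<partial>lborel)"

definition H :: "real \<Rightarrow> real" where
  "H x = exp (- tail x)"

text \<open>Substituting \<open>x + s\<close> for the variable turns \<open>exp x * G x\<close> into
  the right-hand side of the renewal equation. In this form \<open>x\<close> enters only through the
  domain, so that increments of \<open>G\<close> are integrals over short intervals.\<close>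

definition G :: "real \<Rightarrow> real" where
  "G x = (\<integral>s. indicator {x<..} s * (exp (- s) * h s * H s) \<partial>lborel)"

lemma one_minus_h: "0 \<le> 1 - h s" "1 - h s \<le> 2" "h s \<le> 1" "- 1 \<le> h s"
  using h_le[of s] by auto

lemma tail_int [simp]: "integrable lborel (\<lambda>s. indicator {x<..} s * (1 - h s))"
  by (rule Bochner_Integration.integrable_bound[OF h_int]) (auto split: split_indicator)

lemma tail_nonneg: "0 \<le> tail x"
  unfolding tail_def using one_minus_h by (intro integral_nonneg_AE) (auto split: split_indicator)

lemma tail_diff:
  assumes "x \<le> y"
  shows "tail x - tail y = (\<integral>s. indicator {x<..y} s * (1 - h s) \<partial>lborel)"
proof -
  have "tail x - tail y = (\<integral>s. indicator {x<..} s * (1 - h s) - indicator {y<..} s * (1 - h s) \<partial>lborel)"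
    unfolding tail_def by simp
  also have "\<dots> = (\<integral>s. indicator {x<..y} s * (1 - h s) \<partial>lborel)"
    using assms by (intro Bochner_Integration.integral_cong) (auto split: split_indicator)
  finally show ?thesis .
qed

lemma h_int_Ioc: "integrable lborel (\<lambda>s. indicator {x<..y} s * h s)"
  by (rule Bochner_Integration.integrable_bound[OF int_const_Ioc(1)[of x y 1]])
     (use h_le in \<open>auto split: split_indicator\<close>)

text \<open>The exponent \<open>s + tail s\<close> of \<open>exp (- s) * H s\<close> has formal
  derivative \<open>h\<close>: the slope 1 of the identity minus the slope \<open>1 - h\<close> at
  which \<open>tail\<close> decreases.\<close>

lemma B_diff:
  assumes "x \<le> y"
  shows "(y + tail y) - (x + tail x) = (\<integral>s. indicator {x<..y} s * h s \<partial>lborel)"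
proof -
  have "(\<integral>s. indicator {x<..y} s * h s \<partial>lborel)
    = (\<integral>s. indicator {x<..y} s * 1 - indicator {x<..y} s * (1 - h s) \<partial>lborel)"
    by (intro Bochner_Integration.integral_cong) (auto split: split_indicator)
  also have "\<dots> = (\<integral>s. indicator {x<..y} s * 1 \<partial>lborel) - (\<integral>s. indicator {x<..y} s * (1 - h s) \<partial>lborel)"
    using int_const_Ioc(1)[of x y 1] h_int_Ioc[of x y]
    by (intro Bochner_Integration.integral_diff) (auto simp: algebra_simps)
  also have "\<dots> = (y - x) - (tail x - tail y)"
    using int_const_Ioc(2)[of x y 1] assms by (simp add: tail_diff)
  finally show ?thesis by simp
qed

lemma B_lipschitz: "\<bar>(y + tail y) - (x + tail x)\<bar> \<le> \<bar>y - x\<bar>"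
proof (induction x y rule: linorder_wlog)
  case (le x y)
  have "\<bar>\<integral>s. indicator {x<..y} s * h s \<partial>lborel\<bar> \<le> (\<integral>s. \<bar>indicator {x<..y} s * h s\<bar> \<partial>lborel)"
    by (rule integral_abs_bound)
  also have "\<dots> \<le> (\<integral>s. indicator {x<..y} s * 1 \<partial>lborel)"
    using h_int_Ioc[of x y] int_const_Ioc(1)[of x y 1] h_le
    by (intro integral_mono) (auto split: split_indicator)
  finally show ?case using le B_diff[OF le] int_const_Ioc(2)[of x y 1] by simp
qed (simp add: abs_minus_commute)

text \<open>\<open>tail\<close> decreases because \<open>1 - h\<close> is nonnegative, and monotone
  functions are Borel.\<close>

lemma tail_meas [measurable]: "tail \<in> borel_measurable borel"
proof -
  have "mono (\<lambda>x. - tail x)"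
  proof (intro monoI)
    fix x y :: real assume "x \<le> y"
    have "0 \<le> (\<integral>s. indicator {x<..y} s * (1 - h s) \<partial>lborel)"
      using one_minus_h by (intro integral_nonneg_AE) (auto split: split_indicator)
    then show "- tail x \<le> - tail y" using tail_diff[OF \<open>x \<le> y\<close>] by simp
  qed
  from borel_measurable_uminus[OF borel_measurable_mono[OF this]] show ?thesis by simp
qed

lemma H_meas [measurable]: "H \<in> borel_measurable borel"
  unfolding H_def[abs_def] by measurable

lemma H_bounds: "0 \<le> H x" "H x \<le> 1"
  unfolding H_def using tail_nonneg[of x] by auto

lemma hH_le: "\<bar>h s * H s\<bar> \<le> 1"
  using h_le[of s] H_bounds[of s] by (simp add: abs_mult mult_le_one)

lemma G_int: "integrable lborel (\<lambda>s. indicator {x<..} s * (exp (- s) * h s * H s))"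
  by (rule Bochner_Integration.integrable_bound[OF exp_tail_int[of x]])
     (use hH_le in \<open>auto split: split_indicator simp: abs_mult mult.assoc\<close>)

lemma G_diff:
  assumes "x \<le> y"
  shows "G x - G y = (\<integral>s. indicator {x<..y} s * (exp (- s) * h s * H s) \<partial>lborel)"
proof -
  have "G x - G y = (\<integral>s. indicator {x<..} s * (exp (- s) * h s * H s) - indicator {y<..} s * (exp (- s) * h s * H s) \<partial>lborel)"
    unfolding G_def using G_int by simp
  also have "\<dots> = (\<integral>s. indicator {x<..y} s * (exp (- s) * h s * H s) \<partial>lborel)"
    using assms by (intro Bochner_Integration.integral_cong) (auto split: split_indicator)
  finally show ?thesis .
qed

lemma expB: "exp (- s) * H s = exp (- (s + tail s))"
  unfolding H_def by (simp add: mult_exp_exp)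

text \<open>The two values differ by the factor \<open>exp (- d)\<close>, where \<open>d\<close> is
  the increment of the 1-Lipschitz exponent. The second-order error \<open>d^2\<close> is at most
  \<open>\<bar>d\<bar>\<close> for \<open>\<bar>d\<bar> \<le> 1\<close>, whence the factor
  2.\<close>

lemma expB_near:
  assumes "\<bar>s - z\<bar> \<le> 1"
  shows "\<bar>exp (- s) * H s - exp (- z) * H z\<bar> \<le> 2 * (exp (- z) * H z) * \<bar>s - z\<bar>"
proof -
  define d where "d = (s + tail s) - (z + tail z)"
  have d: "\<bar>d\<bar> \<le> \<bar>s - z\<bar>" unfolding d_def by (rule B_lipschitz)
  have "exp (- s) * H s = exp (- z) * H z * exp (- d)"
    unfolding expB d_def by (simp add: mult_exp_exp)
  moreover have "\<bar>exp (- d) - 1\<bar> \<le> 2 * \<bar>d\<bar>"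
  proof -
    have "\<bar>exp (- d) - 1 + d\<bar> \<le> d\<^sup>2" using exp_neg_quadratic_bound d assms by auto
    moreover have "d\<^sup>2 \<le> \<bar>d\<bar>" using d assms mult_left_le[of "\<bar>d\<bar>" "\<bar>d\<bar>"] by (simp add: power2_eq_square)
    ultimately show ?thesis by linarith
  qed
  moreover have "0 \<le> exp (- z) * H z" using H_bounds by simp
  ultimately have "\<bar>exp (- s) * H s - exp (- z) * H z\<bar> \<le> (exp (- z) * H z) * (2 * \<bar>d\<bar>)"
    by (metis abs_mult abs_of_nonneg mult_left_mono mult.right_neutral right_diff_distrib)
  also have "\<dots> \<le> (exp (- z) * H z) * (2 * \<bar>s - z\<bar>)"
    using d H_bounds[of z] by (intro mult_left_mono) auto
  finally show ?thesis by (simp add: mult_ac)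
qed

text \<open>Both increments are compared with \<open>K * D\<close>, where \<open>D\<close> is the
  integral of \<open>h\<close> over the interval and \<open>K\<close> the value of
  \<open>exp (- s) * H s\<close> at the left end. Expanding the exponential costs
  \<open>K * (y - x)^2\<close>; freezing the integrand of \<open>G\<close> at \<open>x\<close> costs
  twice as much. Together they give the factor 3.\<close>

lemma G_diff_near:
  assumes xy: "x \<le> y" "y - x \<le> 1"
  shows "\<bar>(exp (- x) * H x - exp (- y) * H y) - (G x - G y)\<bar> \<le> 3 * exp (- x) * (y - x)\<^sup>2"
proof -
  define K where "K = exp (- x) * H x"
  have K: "0 \<le> K" "K \<le> exp (- x)" using H_bounds[of x] by (auto simp: K_def mult_left_le)
  define D where "D = (\<integral>s. indicator {x<..y} s * h s \<partial>lborel)"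
  have D: "D = (y + tail y) - (x + tail x)" using B_diff xy by (simp add: D_def)
  have Dl: "\<bar>D\<bar> \<le> y - x" using B_lipschitz[of y x] D xy by simp
  have 1: "\<bar>(exp (- x) * H x - exp (- y) * H y) - K * D\<bar> \<le> K * (y - x)\<^sup>2"
  proof -
    have "exp (- y) * H y = K * exp (- D)"
      unfolding K_def expB D by (simp add: mult_exp_exp)
    then have "(exp (- x) * H x - exp (- y) * H y) - K * D = - (K * (exp (- D) - 1 + D))"
      by (simp add: K_def algebra_simps)
    then have "\<bar>(exp (- x) * H x - exp (- y) * H y) - K * D\<bar> \<le> K * D\<^sup>2"
      using exp_neg_quadratic_bound[of D] Dl xy K by (simp add: abs_mult mult_left_mono)
    also have "\<dots> \<le> K * (y - x)\<^sup>2"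
      using Dl xy K by (intro mult_left_mono) (simp_all add: abs_le_square_iff[symmetric])
    finally show ?thesis .
  qed
  have 2: "\<bar>(G x - G y) - K * D\<bar> \<le> 2 * K * (y - x)\<^sup>2"
  proof -
    have i1: "integrable lborel (\<lambda>s. indicator {x<..y} s * (exp (- s) * h s * H s))"
      by (rule Bochner_Integration.integrable_bound[OF G_int[of x]]) (auto split: split_indicator)
    have i2: "integrable lborel (\<lambda>s. K * (indicator {x<..y} s * h s))"
      using h_int_Ioc by (rule integrable_mult_right)
    define f where "f s = indicator {x<..y} s * (exp (- s) * h s * H s) - K * (indicator {x<..y} s * h s)" for s
    have i3: "integrable lborel f"
      unfolding f_def using i1 i2 by (rule Bochner_Integration.integrable_diff)
    have "(G x - G y) - K * D = integral\<^sup>L lborel f"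
      unfolding G_diff[OF xy(1)] D_def f_def using i1 i2 by simp
    then have "\<bar>(G x - G y) - K * D\<bar> \<le> (\<integral>s. \<bar>f s\<bar> \<partial>lborel)"
      using integral_abs_bound[of lborel f] by simp
    also have "\<dots> \<le> (\<integral>s. indicator {x<..y} s * (2 * K * (y - x)) \<partial>lborel)"
    proof (rule integral_mono)
      show "integrable lborel (\<lambda>s. \<bar>f s\<bar>)"
        using i3 by (rule integrable_abs)
      show "integrable lborel (\<lambda>s. indicator {x<..y} s * (2 * K * (y - x)))"
        by (rule int_const_Ioc)
      fix s
      show "\<bar>f s\<bar> \<le> indicator {x<..y} s * (2 * K * (y - x))"
      proof (cases "s \<in> {x<..y}")
        case True
        then have "\<bar>s - x\<bar> \<le> y - x" by auto
        then have "\<bar>exp (- s) * H s - K\<bar> \<le> 2 * K * \<bar>s - x\<bar>"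
          using expB_near[of s x] xy by (simp add: K_def)
        also have "\<dots> \<le> 2 * K * (y - x)" using \<open>\<bar>s - x\<bar> \<le> y - x\<close> K by (intro mult_left_mono) auto
        finally have "\<bar>exp (- s) * H s - K\<bar> * \<bar>h s\<bar> \<le> 2 * K * (y - x) * 1"
          using h_le[of s] by (intro mult_mono) auto
        moreover have "exp (- s) * h s * H s - K * h s = (exp (- s) * H s - K) * h s"
          by (simp add: algebra_simps)
        ultimately show ?thesis using True by (simp add: abs_mult f_def)
      qed (simp add: f_def)
    qed
    also have "\<dots> = 2 * K * (y - x)\<^sup>2"
      using int_const_Ioc(2)[OF xy(1), of "2 * K * (y - x)"] by (simp add: power2_eq_square mult_ac)
    finally show ?thesis .
  qed
  have "3 * K * (y - x)\<^sup>2 \<le> 3 * exp (- x) * (y - x)\<^sup>2" using K by (intro mult_right_mono) auto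
  then show ?thesis using 1 2 by linarith
qed

text \<open>Neither side need be differentiable where \<open>h\<close> jumps, but the quadratic
  bound makes the difference of the sides differentiable with derivative 0 everywhere. It is
  therefore constant, and it vanishes at infinity because both sides do.\<close>

lemma G_eq: "G x = exp (- x) * H x"
proof -
  define F where "F x = exp (- x) * H x - G x" for x
  have der: "(F has_real_derivative 0) (at z)" for z
  proof -
    \<comment> \<open>Within distance 1 of \<open>z\<close> the smaller of the two points is at
      least \<open>z - 1\<close>, so one constant bounds \<open>3 * exp (- min y z)\<close>.\<close>
    define C where "C = 3 * exp (1 - z)"
    have "eventually (\<lambda>y. \<bar>(F y - F z) / (y - z)\<bar> \<le> C * \<bar>y - z\<bar>) (at z)"
      unfolding eventually_at
    proof (intro exI[of _ 1] conjI ballI impI)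
      fix y assume y: "y \<noteq> z \<and> dist y z < 1"
      have "\<bar>F y - F z\<bar> \<le> 3 * exp (- min y z) * (y - z)\<^sup>2"
      proof (cases "z \<le> y")
        case True
        then show ?thesis using G_diff_near[of z y] y
          by (simp add: F_def dist_real_def algebra_simps abs_minus_commute)
      next
        case False
        then show ?thesis using G_diff_near[of y z] y
          by (simp add: F_def dist_real_def algebra_simps abs_minus_commute power2_commute)
      qed
      also have "\<dots> \<le> C * (y - z)\<^sup>2"
        unfolding C_def using y by (intro mult_right_mono) (auto simp: dist_real_def)
      finally have "\<bar>F y - F z\<bar> \<le> C * (y - z)\<^sup>2" .
      then show "\<bar>(F y - F z) / (y - z)\<bar> \<le> C * \<bar>y - z\<bar>" using y
        by (simp add: power2_eq_square divide_simps abs_mult[symmetric] mult.assoc)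
    qed simp
    moreover have "((\<lambda>y. C * \<bar>y - z\<bar>) \<longlongrightarrow> C * \<bar>z - z\<bar>) (at z)"
      by (intro tendsto_intros)
    ultimately have "((\<lambda>y. (F y - F z) / (y - z)) \<longlongrightarrow> 0) (at z)"
      using Lim_null_comparison[of "\<lambda>y. (F y - F z) / (y - z)" "\<lambda>y. C * \<bar>y - z\<bar>" "at z"] by simp
    then show ?thesis by (simp add: has_field_derivative_iff)
  qed
  have const: "F x = F y" for y using DERIV_isconst_all[of F x y] der by simp
  have bound: "\<bar>F y\<bar> \<le> exp (- y) + \<bar>G y\<bar>" for y
  proof -
    have "\<bar>exp (- y) * H y\<bar> \<le> exp (- y)" using H_bounds[of y] by (simp add: abs_mult mult_left_le)
    then show ?thesis unfolding F_def by linarith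
  qed
  have Glim: "(\<lambda>n. G (real n)) \<longlonglongrightarrow> (\<integral>s. 0 \<partial>(lborel :: real measure))"
    unfolding G_def
  proof (rule integral_dominated_convergence[where w="\<lambda>s. indicator {-1<..} s * exp (- s)"])
    show "integrable lborel (\<lambda>s. indicator {-1<..} s * exp (- s) :: real)" by (rule exp_tail_int)
    show "AE s in lborel. (\<lambda>n. indicator {real n<..} s * (exp (- s) * h s * H s)) \<longlonglongrightarrow> 0"
    proof (intro AE_I2 tendsto_eventually)
      fix s :: real
      show "\<forall>\<^sub>F n in sequentially. indicator {real n<..} s * (exp (- s) * h s * H s) = 0"
        using eventually_ge_at_top[of "nat \<lceil>s\<rceil>"]
        by eventually_elim (auto simp: indicator_def)
    qed
    show "AE s in lborel. norm (indicator {real n<..} s * (exp (- s) * h s * H s)) \<le> indicator {-1<..} s * exp (- s)" for n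
      using hH_le by (auto split: split_indicator simp: abs_mult mult.assoc)
  qed measurable
  have elim: "(\<lambda>n. exp (- real n)) \<longlonglongrightarrow> 0"
    by (intro filterlim_compose[OF exp_at_bot] filterlim_uminus_at_bot_at_top[THEN filterlim_compose] filterlim_real_sequentially)
  have "(\<lambda>n. F (real n)) \<longlonglongrightarrow> 0"
  proof (rule tendsto_rabs_zero_cancel, rule tendsto_sandwich[OF _ _ tendsto_const])
    show "(\<lambda>n. exp (- real n) + \<bar>G (real n)\<bar>) \<longlonglongrightarrow> 0"
      using tendsto_add[OF elim tendsto_rabs[OF Glim]] by simp
  qed (use bound in auto)
  moreover have "F (real n) = F x" for n using const[of "real n"] by simp
  ultimately have "F x = 0" by (simp add: LIMSEQ_const_iff)
  then show ?thesis by (simp add: F_def)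
qed

lemma renewal: "(\<integral>s. exponential_density 1 s * (h (x + s) * H (x + s)) \<partial>lborel) = H x"
proof -
  have "G x = (\<integral>s. indicator {x<..} (x + 1 * s) * (exp (- (x + 1 * s)) * h (x + 1 * s) * H (x + 1 * s)) \<partial>lborel)"
    unfolding G_def by (subst lborel_integral_real_affine[where t=x and c=1]) auto
  also have "\<dots> = (\<integral>s. exp (- x) * (exponential_density 1 s * (h (x + s) * H (x + s))) \<partial>lborel)"
  proof (rule integral_cong_AE)
    show "AE s in lborel. indicator {x<..} (x + 1 * s) * (exp (- (x + 1 * s)) * h (x + 1 * s) * H (x + 1 * s)) =
         exp (- x) * (exponential_density 1 s * (h (x + s) * H (x + s)))"
      \<comment> \<open>At \<open>s = 0\<close> the open half-line gives 0 while the exponential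
        density is 1, so the integrands may disagree at this one point.\<close>
      using AE_lborel_singleton[of 0]
      by eventually_elim (auto simp: exponential_density_def exp_add[symmetric] mult.assoc[symmetric] split: split_indicator)
  qed measurable
  finally show ?thesis using G_eq[of x] by (simp add: exp_minus)
qed

lemma H_0: "H 0 = exp (- (\<integral>s. indicator {0<..} s * (1 - h s) \<partial>lborel))"
  by (simp add: H_def tail_def)

lemma H_at_top: "filterlim X at_top sequentially \<Longrightarrow> (\<lambda>n. H (X n)) \<longlonglongrightarrow> 1"
proof -
  assume X: "filterlim X at_top sequentially"
  have "(\<lambda>n. tail (X n)) \<longlonglongrightarrow> (\<integral>s. 0 \<partial>(lborel :: real measure))"
    unfolding tail_def
  proof (rule integral_dominated_convergence[where w="\<lambda>s. 1 - h s"])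
    show "integrable lborel (\<lambda>s. 1 - h s)" by (rule h_int)
    show "AE s in lborel. (\<lambda>n. indicator {X n<..} s * (1 - h s)) \<longlonglongrightarrow> 0"
    proof (intro AE_I2 tendsto_eventually)
      fix s :: real
      show "\<forall>\<^sub>F n in sequentially. indicator {X n<..} s * (1 - h s) = 0"
        using filterlim_at_top[THEN iffD1, OF X, rule_format, of s]
        by eventually_elim (auto split: split_indicator)
    qed
    show "AE s in lborel. norm (indicator {X n<..} s * (1 - h s)) \<le> 1 - h s" for n
      using one_minus_h by (auto split: split_indicator)
  qed measurable
  then have "(\<lambda>n. exp (- tail (X n))) \<longlonglongrightarrow> exp (- 0)" by (intro tendsto_intros) simp
  then show ?thesis by (simp add: H_def)
qed

end

section \<open>Exponential arrivals and independent marks\<close>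

lemma borel_measurable_sum_PiM:
  "A \<subseteq> B \<Longrightarrow> (\<lambda>v. \<Sum>k\<in>A. v k :: real) \<in> borel_measurable (\<Pi>\<^sub>M i\<in>B. borel)"
  by (intro borel_measurable_sum measurable_component_singleton) auto

text \<open>Independence makes the joint law a product measure, on which Fubini applies to the
  bounded \<open>f\<close>. Pulled back to \<open>M\<close>, the inner integral runs over a second
  sample point \<omega>' while the other component stays frozen at \<omega>.\<close>

lemma (in prob_space)
  fixes f :: "_ \<Rightarrow> 'b :: {banach, second_countable_topology}"
  assumes ind: "indep_var S X T Y"
    and f: "f \<in> borel_measurable (S \<Otimes>\<^sub>M T)" and bound: "\<And>z. norm (f z) \<le> B"
  shows indep_var_Fubini_snd: "(\<integral>\<omega>. f (X \<omega>, Y \<omega>) \<partial>M) = (\<integral>\<omega>. (\<integral>\<omega>'. f (X \<omega>, Y \<omega>') \<partial>M) \<partial>M)"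
    and indep_var_Fubini_fst: "(\<integral>\<omega>. f (X \<omega>, Y \<omega>) \<partial>M) = (\<integral>\<omega>. (\<integral>\<omega>'. f (X \<omega>', Y \<omega>) \<partial>M) \<partial>M)"
proof -
  have X [measurable]: "X \<in> measurable M S" and Y [measurable]: "Y \<in> measurable M T"
    and eq: "distr M S X \<Otimes>\<^sub>M distr M T Y = distr M (S \<Otimes>\<^sub>M T) (\<lambda>x. (X x, Y x))"
    using ind unfolding indep_var_distribution_eq by auto
  note [measurable] = f
  interpret A: prob_space "distr M S X" by (rule prob_space_distr) fact
  interpret B: prob_space "distr M T Y" by (rule prob_space_distr) fact
  interpret AB: pair_prob_space "distr M S X" "distr M T Y" ..
  have int: "integrable (distr M S X \<Otimes>\<^sub>M distr M T Y) f"
    using bound by (intro AB.integrable_const_bound[of _ B]) auto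
  have lhs: "integral\<^sup>L (distr M S X \<Otimes>\<^sub>M distr M T Y) f = (\<integral>\<omega>. f (X \<omega>, Y \<omega>) \<partial>M)"
    unfolding eq by (subst integral_distr) auto
  have "(\<integral>x. (\<integral>y. f (x, y) \<partial>distr M T Y) \<partial>distr M S X) = (\<integral>\<omega>. (\<integral>\<omega>'. f (X \<omega>, Y \<omega>') \<partial>M) \<partial>M)"
    by (subst integral_distr, measurable, rule Bochner_Integration.integral_cong[OF refl], subst integral_distr)
       (auto simp: measurable_space[OF X])
  then show "(\<integral>\<omega>. f (X \<omega>, Y \<omega>) \<partial>M) = (\<integral>\<omega>. (\<integral>\<omega>'. f (X \<omega>, Y \<omega>') \<partial>M) \<partial>M)"
    using AB.integral_fst'[OF int] lhs by simp
  have "(\<integral>y. (\<integral>x. f (x, y) \<partial>distr M S X) \<partial>distr M T Y) = (\<integral>\<omega>. (\<integral>\<omega>'. f (X \<omega>', Y \<omega>) \<partial>M) \<partial>M)"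
    by (subst integral_distr, measurable, rule Bochner_Integration.integral_cong[OF refl], subst integral_distr)
       (auto simp: measurable_space[OF Y])
  then show "(\<integral>\<omega>. f (X \<omega>, Y \<omega>) \<partial>M) = (\<integral>\<omega>. (\<integral>\<omega>'. f (X \<omega>', Y \<omega>) \<partial>M) \<partial>M)"
    using AB.integral_snd[of "\<lambda>x y. f (x, y)"] int lhs by simp
qed

text \<open>Fubini for the indicator of the failure of \<open>P\<close>. It allows an almost sure
  property to be proved with \<open>Y\<close> frozen at a typical value, which is how convergence
  with random arrivals is reduced to convergence with deterministic weights.\<close>

lemma (in prob_space) indep_var_AE:
  assumes ind: "indep_var S X T Y"
    and P [measurable]: "Measurable.pred (S \<Otimes>\<^sub>M T) P"
    and AE: "AE \<omega>' in M. AE \<omega> in M. P (X \<omega>, Y \<omega>')"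
  shows "AE \<omega> in M. P (X \<omega>, Y \<omega>)"
proof -
  have [measurable]: "X \<in> measurable M S" "Y \<in> measurable M T"
    using ind unfolding indep_var_distribution_eq by auto
  define f :: "_ \<Rightarrow> real" where "f z = (if P z then 0 else 1)" for z
  have f [measurable]: "f \<in> borel_measurable (S \<Otimes>\<^sub>M T)" unfolding f_def by measurable
  have "(\<integral>\<omega>. f (X \<omega>, Y \<omega>) \<partial>M) = (\<integral>\<omega>. (\<integral>\<omega>'. f (X \<omega>', Y \<omega>) \<partial>M) \<partial>M)"
    by (rule indep_var_Fubini_fst[OF ind f, of 1]) (simp add: f_def)
  also have "\<dots> = (\<integral>\<omega>. 0 \<partial>M)"
  proof (rule Bochner_Integration.integral_cong_AE)
    show "AE \<omega> in M. (\<integral>\<omega>'. f (X \<omega>', Y \<omega>) \<partial>M) = 0"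
      using AE
    proof eventually_elim
      case (elim \<omega>)
      then have "AE \<omega>' in M. f (X \<omega>', Y \<omega>) = 0" by eventually_elim (simp add: f_def)
      then show ?case by (rule integral_eq_zero_AE)
    qed
  qed measurable
  finally have "(\<integral>\<omega>. f (X \<omega>, Y \<omega>) \<partial>M) = 0" by simp
  moreover have "integrable M (\<lambda>\<omega>. f (X \<omega>, Y \<omega>))"
    by (rule integrable_const_bound[of _ 1]) (auto simp: f_def)
  ultimately have "AE \<omega> in M. f (X \<omega>, Y \<omega>) = 0"
    by (subst (asm) integral_nonneg_eq_0_iff_AE) (auto simp: f_def)
  then show ?thesis by eventually_elim (auto simp: f_def split: if_splits)
qed

section \<open>Arrival times as sums of independent exponential waiting times\<close>

locale exp_arrivals = prob_space M for M :: "'w measure" +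
  fixes \<zeta> :: "nat \<Rightarrow> 'w \<Rightarrow> real"
  assumes iid: "iid_std_exponential M \<zeta>"
begin

lemma indep_\<zeta>: "indep_vars (\<lambda>_. borel) \<zeta> UNIV"
  and distributed_\<zeta>: "distributed M lborel (\<zeta> k) (exponential_density 1)"
  using iid by (auto simp: iid_std_exponential_def)

lemma \<zeta>_meas [measurable]: "\<zeta> k \<in> borel_measurable M"
  using distributed_measurable[OF distributed_\<zeta>, of k] by simp

lemma arrival_meas [measurable]: "arrival \<zeta> k \<in> borel_measurable M"
  unfolding arrival_def[abs_def] by measurable

lemma expectation_\<zeta>:
  assumes [measurable]: "g \<in> borel_measurable borel"
  shows "(\<integral>\<omega>. g (\<zeta> k \<omega>) \<partial>M) = (\<integral>s. exponential_density 1 s * g s \<partial>lborel)"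
  using distributed_integral[OF distributed_\<zeta>, of g k] by (simp add: exponential_density_nonneg)

lemma AE_\<zeta>_pos: "AE \<omega> in M. \<forall>k. 0 < \<zeta> k \<omega>"
proof (subst AE_all_countable, intro allI)
  fix k
  have "AE s in lborel. 0 < ennreal (exponential_density 1 s) \<longrightarrow> 0 < (s :: real)"
    using AE_lborel_singleton[of "0::real"] by eventually_elim (auto simp: exponential_density_def)
  then show "AE \<omega> in M. 0 < \<zeta> k \<omega>"
    by (subst distributed_AE2[OF distributed_\<zeta>]) auto
qed

lemma AE_arrival_pos: "AE \<omega> in M. \<forall>k. 0 < arrival \<zeta> k \<omega>"
  using AE_\<zeta>_pos by eventually_elim (auto simp: arrival_def intro!: sum_pos)

text \<open>The integrand \<open>exp (- 2 * s)\<close> is half of the exponential density of rate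
  2.\<close>

lemma expectation_exp_neg_\<zeta>: "(\<integral>\<omega>. exp (- \<zeta> k \<omega>) \<partial>M) = 1 / 2"
proof -
  have "(\<integral>\<omega>. exp (- \<zeta> k \<omega>) \<partial>M) = (\<integral>s. exponential_density 1 s * exp (- s) \<partial>lborel)"
    by (rule expectation_\<zeta>) measurable
  also have "\<dots> = (\<integral>s. 1 / 2 * exponential_density 2 s \<partial>lborel)"
    by (intro Bochner_Integration.integral_cong) (auto simp: exponential_density_def mult_exp_exp)
  also have "\<dots> = 1 / 2"
  proof -
    have "(\<integral>\<^sup>+s. ennreal (exponential_density 2 s) \<partial>lborel) = 1"
      using nn_integral_erlang_ith_moment[of 2 0 0] by simp
    then have "(\<integral>s. exponential_density 2 s \<partial>lborel) = 1"
      by (intro integral_eq_nn_integral[THEN trans]) (auto simp: exponential_density_nonneg)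
    then show ?thesis by simp
  qed
  finally show ?thesis .
qed

text \<open>The exponential of the sum is a product of \<open>k + 1\<close> independent factors of
  mean 1/2. This is the moment that enters Chernoff's bound.\<close>

lemma expectation_exp_neg_arrival: "(\<integral>\<omega>. exp (- arrival \<zeta> k \<omega>) \<partial>M) = (1 / 2) ^ Suc k"
  and integrable_exp_neg_arrival: "integrable M (\<lambda>\<omega>. exp (- arrival \<zeta> k \<omega>))"
proof -
  have eq: "exp (- arrival \<zeta> k \<omega>) = (\<Prod>i\<le>k. exp (- \<zeta> i \<omega>))" for \<omega>
    by (simp add: arrival_def exp_sum sum_negf[symmetric])
  have ind: "indep_vars (\<lambda>_. borel) (\<lambda>i \<omega>. exp (- \<zeta> i \<omega>)) {..k}"
    using indep_vars_compose2[OF indep_vars_subset[OF indep_\<zeta>, of "{..k}"], of "\<lambda>_ x. exp (- x)" "\<lambda>_. borel"] by auto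
  have int: "integrable M (\<lambda>\<omega>. exp (- \<zeta> i \<omega>))" for i
    using AE_\<zeta>_pos by (intro integrable_const_bound[of _ 1]) (auto intro: AE_mp less_imp_le)
  show "(\<integral>\<omega>. exp (- arrival \<zeta> k \<omega>) \<partial>M) = (1 / 2) ^ Suc k"
    unfolding eq using ind int by (subst indep_vars_lebesgue_integral) (auto simp: expectation_exp_neg_\<zeta>)
  show "integrable M (\<lambda>\<omega>. exp (- arrival \<zeta> k \<omega>))"
    unfolding eq using ind int by (intro indep_vars_integrable) auto
qed

text \<open>By Chernoff's bound, \<open>P (\<Gamma>\<^sub>n \<le> n / 2) \<le> (\<surd>e / 2)\<^sup>n\<close>.\<close>

lemma AE_arrival_ge: "AE \<omega> in M. eventually (\<lambda>k. real (Suc k) / 2 < arrival \<zeta> k \<omega>) sequentially"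
proof -
  define A where "A k = {\<omega> \<in> space M. arrival \<zeta> k \<omega> \<le> real (Suc k) / 2}" for k
  have [measurable]: "A k \<in> sets M" for k unfolding A_def by measurable
  define q :: real where "q = exp (1 / 2) / 2"
  have q: "0 < q" "q < 1"
  proof -
    have "exp (1 / 2 :: real) ^ 2 = exp 1" by (simp add: power2_eq_square mult_exp_exp)
    also have "\<dots> < 2 ^ 2" using exp_le by simp
    finally have "exp (1 / 2 :: real) < 2" by (rule power2_less_imp_less) simp
    then show "0 < q" "q < 1" by (auto simp: q_def)
  qed
  have le: "norm (measure M (A k)) \<le> q ^ Suc k" for k
  proof -
    have "measure M (A k) = measure M {\<omega> \<in> space M. exp (- arrival \<zeta> k \<omega>) \<ge> exp (- (real (Suc k) / 2))}"
      unfolding A_def by (intro arg_cong[of _ _ "measure M"]) auto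
    also have "\<dots> \<le> (\<integral>\<omega>. exp (- arrival \<zeta> k \<omega>) \<partial>M) / exp (- (real (Suc k) / 2))"
      by (intro integral_Markov_inequality_measure[where A="{}"] integrable_exp_neg_arrival) auto
    also have "\<dots> = exp (real (Suc k) * (1 / 2)) / 2 ^ Suc k"
      unfolding expectation_exp_neg_arrival by (simp add: exp_minus field_simps)
    also have "\<dots> = q ^ Suc k"
      unfolding exp_of_nat_mult q_def power_divide ..
    finally show ?thesis by simp
  qed
  have "summable (\<lambda>k. q ^ Suc k)"
    using q by (subst summable_Suc_iff) (auto intro: summable_geometric)
  from summable_comparison_test'[OF this le] have "summable (\<lambda>k. measure M (A k))" .
  then have "AE \<omega> in M. eventually (\<lambda>k. \<omega> \<in> space M - A k) sequentially"
    by (intro borel_cantelli_AE1) (auto simp: emeasure_eq_measure)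
  then show ?thesis
    by (rule AE_mp) (auto simp: A_def not_le elim!: eventually_mono)
qed

lemma AE_arrival_at_top: "AE \<omega> in M. filterlim (\<lambda>k. arrival \<zeta> k \<omega>) at_top sequentially"
  using AE_arrival_ge
proof eventually_elim
  case (elim \<omega>)
  show ?case unfolding filterlim_at_top
  proof
    fix Z
    show "eventually (\<lambda>k. Z \<le> arrival \<zeta> k \<omega>) sequentially"
      using elim eventually_ge_at_top[of "nat \<lceil>2 * Z\<rceil>"]
    proof eventually_elim
      case (elim k)
      then have "2 * Z \<le> real k" by linarith
      with elim show ?case by simp
    qed
  qed
qed

end

section \<open>Expected products of a thinning function along the arrivals\<close>

locale thinned_arrivals = exp_arrivals M \<zeta> + thinning h
  for M :: "'w measure" and \<zeta> :: "nat \<Rightarrow> 'w \<Rightarrow> real" and h :: "real \<Rightarrow> real"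
begin

lemma prod_h_le: "\<bar>\<Prod>k\<in>A. h (x k)\<bar> \<le> 1"
  by (induction A rule: infinite_finite_induct) (auto simp: abs_mult intro: mult_le_one h_le)

text \<open>Averaging over waiting time \<open>n + 1\<close> with the earlier ones frozen replaces
  the last factor \<open>h * H\<close> by its mean over one exponential step from the arrival
  \<open>n\<close>. By the renewal equation that mean is \<open>H\<close> at the arrival
  \<open>n\<close>, so the expectation does not depend on \<open>n\<close>.\<close>

lemma expectation_prod_H: "(\<integral>\<omega>. (\<Prod>k\<le>n. h (arrival \<zeta> k \<omega>)) * H (arrival \<zeta> n \<omega>) \<partial>M) = H 0"
proof (induction n)
  case 0
  have "(\<integral>\<omega>. h (\<zeta> 0 \<omega>) * H (\<zeta> 0 \<omega>) \<partial>M) = (\<integral>s. exponential_density 1 s * (h s * H s) \<partial>lborel)"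
    by (rule expectation_\<zeta>) measurable
  then show ?case using renewal[of 0] by (simp add: arrival_def)
next
  case (Suc n)
  define V where "V \<omega> = restrict (\<lambda>i. \<zeta> i \<omega>) {..n}" for \<omega>
  define W where "W \<omega> = restrict (\<lambda>i. \<zeta> i \<omega>) {Suc n}" for \<omega>
  have ind: "indep_var (\<Pi>\<^sub>M i\<in>{..n}. borel) V (\<Pi>\<^sub>M i\<in>{Suc n}. borel) W"
    unfolding V_def W_def by (rule indep_var_restrict[OF indep_\<zeta>]) auto
  \<comment> \<open>The integrand as a function of two independent blocks of waiting times:
    \<open>v\<close> holds the times up to \<open>n\<close>, \<open>w\<close> the single time
    \<open>n + 1\<close>.\<close>
  define f :: "(nat \<Rightarrow> real) \<times> (nat \<Rightarrow> real) \<Rightarrow> real" where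
    "f = (\<lambda>(v, w). (\<Prod>k\<le>n. h (\<Sum>i\<le>k. v i)) * (h ((\<Sum>i\<le>n. v i) + w (Suc n)) * H ((\<Sum>i\<le>n. v i) + w (Suc n))))"
  have m1: "(\<lambda>z. h (\<Sum>i\<le>k. fst z i)) \<in> borel_measurable ((\<Pi>\<^sub>M i\<in>{..n}. borel) \<Otimes>\<^sub>M (\<Pi>\<^sub>M i\<in>{Suc n}. borel))" if "k \<le> n" for k
    by (rule measurable_compose[OF measurable_compose[OF measurable_fst borel_measurable_sum_PiM] h_meas]) (use that in auto)
  have m2: "(\<lambda>z. (\<Sum>i\<le>n. fst z i) + snd z (Suc n) :: real) \<in> borel_measurable ((\<Pi>\<^sub>M i\<in>{..n}. borel) \<Otimes>\<^sub>M (\<Pi>\<^sub>M i\<in>{Suc n}. borel))"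
  proof (rule borel_measurable_add)
    show "(\<lambda>z. \<Sum>i\<le>n. fst z i :: real) \<in> borel_measurable ((\<Pi>\<^sub>M i\<in>{..n}. borel) \<Otimes>\<^sub>M (\<Pi>\<^sub>M i\<in>{Suc n}. borel))"
      by (rule measurable_compose[OF measurable_fst borel_measurable_sum_PiM[OF order_refl]])
    show "(\<lambda>z. snd z (Suc n)) \<in> borel_measurable ((\<Pi>\<^sub>M i\<in>{..n}. borel) \<Otimes>\<^sub>M (\<Pi>\<^sub>M i\<in>{Suc n}. borel))"
      by (rule measurable_compose[OF measurable_snd measurable_component_singleton]) simp
  qed
  have f_meas: "f \<in> borel_measurable ((\<Pi>\<^sub>M i\<in>{..n}. borel) \<Otimes>\<^sub>M (\<Pi>\<^sub>M i\<in>{Suc n}. borel))"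
    unfolding f_def case_prod_beta
    by (intro borel_measurable_times borel_measurable_prod m1 measurable_compose[OF m2 h_meas]
        measurable_compose[OF m2 H_meas]) auto
  have f_bound: "norm (f z) \<le> 1" for z
    unfolding f_def case_prod_beta real_norm_def
    using mult_le_one[OF prod_h_le abs_ge_zero hH_le] by (simp add: abs_mult)
  have sumV: "(\<Sum>i\<le>k. V \<omega> i) = arrival \<zeta> k \<omega>" if "k \<le> n" for k \<omega>
    using that unfolding arrival_def V_def by (intro sum.cong) auto
  have fVW: "f (V \<omega>, W \<omega>') = (\<Prod>k\<le>n. h (arrival \<zeta> k \<omega>)) *
      (h (arrival \<zeta> n \<omega> + \<zeta> (Suc n) \<omega>') * H (arrival \<zeta> n \<omega> + \<zeta> (Suc n) \<omega>'))" for \<omega> \<omega>'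
    unfolding f_def by (auto simp: sumV W_def intro!: prod.cong)
  have "(\<integral>\<omega>. (\<Prod>k\<le>Suc n. h (arrival \<zeta> k \<omega>)) * H (arrival \<zeta> (Suc n) \<omega>) \<partial>M) = (\<integral>\<omega>. f (V \<omega>, W \<omega>) \<partial>M)"
    unfolding fVW by (simp add: arrival_def mult.assoc)
  also have "\<dots> = (\<integral>\<omega>. (\<integral>\<omega>'. f (V \<omega>, W \<omega>') \<partial>M) \<partial>M)"
    by (rule indep_var_Fubini_snd[OF ind f_meas f_bound])
  also have "\<dots> = (\<integral>\<omega>. (\<Prod>k\<le>n. h (arrival \<zeta> k \<omega>)) * H (arrival \<zeta> n \<omega>) \<partial>M)"
  proof (intro Bochner_Integration.integral_cong refl)
    fix \<omega>
    have "(\<integral>\<omega>'. f (V \<omega>, W \<omega>') \<partial>M) = (\<Prod>k\<le>n. h (arrival \<zeta> k \<omega>)) *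
       (\<integral>\<omega>'. h (arrival \<zeta> n \<omega> + \<zeta> (Suc n) \<omega>') * H (arrival \<zeta> n \<omega> + \<zeta> (Suc n) \<omega>') \<partial>M)"
      unfolding fVW by (rule integral_mult_right_zero)
    also have "(\<integral>\<omega>'. h (arrival \<zeta> n \<omega> + \<zeta> (Suc n) \<omega>') * H (arrival \<zeta> n \<omega> + \<zeta> (Suc n) \<omega>') \<partial>M) = H (arrival \<zeta> n \<omega>)"
      by (subst expectation_\<zeta>[where g="\<lambda>s. h (arrival \<zeta> n \<omega> + s) * H (arrival \<zeta> n \<omega> + s)"])
         (auto simp: renewal)
    finally show "(\<integral>\<omega>'. f (V \<omega>, W \<omega>') \<partial>M) = (\<Prod>k\<le>n. h (arrival \<zeta> k \<omega>)) * H (arrival \<zeta> n \<omega>)" .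
  qed
  finally show ?case using Suc by simp
qed

text \<open>The arrivals tend to infinity, where \<open>H\<close> tends to 1, and the products of
  \<open>h\<close> are bounded by 1; dropping the factor \<open>H\<close> therefore costs nothing in
  the limit.\<close>

theorem expectation_prod_lim: "(\<lambda>n. \<integral>\<omega>. (\<Prod>k<n. h (arrival \<zeta> k \<omega>)) \<partial>M) \<longlonglongrightarrow> H 0"
proof -
  have b: "\<bar>(\<Prod>k\<le>n. h (arrival \<zeta> k \<omega>)) * H (arrival \<zeta> n \<omega>)\<bar> \<le> 1" for n \<omega>
    using H_bounds prod_h_le by (auto simp: abs_mult intro!: mult_le_one)
  have i1: "integrable M (\<lambda>\<omega>. \<Prod>k\<le>n. h (arrival \<zeta> k \<omega>))" for n
    by (rule integrable_const_bound[of _ 1]) (auto simp: prod_h_le)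
  have i2: "integrable M (\<lambda>\<omega>. (\<Prod>k\<le>n. h (arrival \<zeta> k \<omega>)) * H (arrival \<zeta> n \<omega>))" for n
    by (rule integrable_const_bound[of _ 1]) (auto simp: b)
  have "(\<lambda>n. \<integral>\<omega>. (\<Prod>k\<le>n. h (arrival \<zeta> k \<omega>)) * (1 - H (arrival \<zeta> n \<omega>)) \<partial>M) \<longlonglongrightarrow> (\<integral>\<omega>. 0 \<partial>M)"
  proof (rule integral_dominated_convergence[where w="\<lambda>_. 1"])
    show "AE \<omega> in M. (\<lambda>n. (\<Prod>k\<le>n. h (arrival \<zeta> k \<omega>)) * (1 - H (arrival \<zeta> n \<omega>))) \<longlonglongrightarrow> 0"
      using AE_arrival_at_top
    proof eventually_elim
      case (elim \<omega>)
      have "(\<lambda>n. 1 - H (arrival \<zeta> n \<omega>)) \<longlonglongrightarrow> 1 - 1"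
        by (intro tendsto_intros H_at_top elim)
      then have lim: "(\<lambda>n. \<bar>1 - H (arrival \<zeta> n \<omega>)\<bar>) \<longlonglongrightarrow> 0"
        by (simp add: tendsto_rabs_zero)
      show ?case
      proof (rule Lim_null_comparison[OF _ lim], intro always_eventually allI)
        show "norm ((\<Prod>k\<le>n. h (arrival \<zeta> k \<omega>)) * (1 - H (arrival \<zeta> n \<omega>))) \<le> \<bar>1 - H (arrival \<zeta> n \<omega>)\<bar>" for n
          using prod_h_le[of "\<lambda>k. arrival \<zeta> k \<omega>" "{..n}"] by (simp add: abs_mult mult_left_le_one_le)
      qed
    qed
    show "AE \<omega> in M. norm ((\<Prod>k\<le>n. h (arrival \<zeta> k \<omega>)) * (1 - H (arrival \<zeta> n \<omega>))) \<le> 1" for n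
    proof (intro AE_I2)
      fix \<omega>
      show "norm ((\<Prod>k\<le>n. h (arrival \<zeta> k \<omega>)) * (1 - H (arrival \<zeta> n \<omega>))) \<le> 1"
        unfolding real_norm_def abs_mult using H_bounds[of "arrival \<zeta> n \<omega>"]
        by (intro mult_le_one prod_h_le) auto
    qed
  qed measurable
  moreover have "(\<integral>\<omega>. (\<Prod>k\<le>n. h (arrival \<zeta> k \<omega>)) * (1 - H (arrival \<zeta> n \<omega>)) \<partial>M)
    = (\<integral>\<omega>. (\<Prod>k\<le>n. h (arrival \<zeta> k \<omega>)) \<partial>M) - H 0" for n
    using i1 i2 expectation_prod_H[of n] by (simp add: right_diff_distrib)
  ultimately have "(\<lambda>n. (\<integral>\<omega>. (\<Prod>k\<le>n. h (arrival \<zeta> k \<omega>)) \<partial>M) - H 0) \<longlonglongrightarrow> 0" by simp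
  then have "(\<lambda>n. (\<integral>\<omega>. (\<Prod>k<Suc n. h (arrival \<zeta> k \<omega>)) \<partial>M)) \<longlonglongrightarrow> H 0"
    unfolding lessThan_Suc_atMost by (rule LIM_zero_cancel)
  then show ?thesis by (rule LIMSEQ_imp_Suc)
qed

end

section \<open>Arrivals carrying independent real marks\<close>

locale lepage_marks = exp_arrivals M \<zeta>
  for M :: "'w measure" and \<zeta> :: "nat \<Rightarrow> 'w \<Rightarrow> real" +
  fixes \<psi> :: "nat \<Rightarrow> 'w \<Rightarrow> real" and \<mu> :: "real measure"
  assumes indep_\<psi>: "indep_vars (\<lambda>_. borel) \<psi> UNIV"
    and distr_\<psi>: "\<And>k. distr M borel (\<psi> k) = \<mu>"
    and indep_\<psi>_arrival: "indep_var (\<Pi>\<^sub>M k\<in>UNIV. borel) (\<lambda>\<omega> k. \<psi> k \<omega>) (\<Pi>\<^sub>M k\<in>UNIV. borel) (\<lambda>\<omega> k. arrival \<zeta> k \<omega>)"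
begin

lemma \<psi>_meas [measurable]: "\<psi> k \<in> borel_measurable M"
  using indep_\<psi> by (auto simp: indep_vars_def)

lemma sets_\<mu> [measurable_cong, simp]: "sets \<mu> = sets borel"
  using distr_\<psi>[of 0] by (metis sets_distr)

sublocale \<mu>: prob_space \<mu>
  using prob_space_distr[OF \<psi>_meas[of 0]] by (simp add: distr_\<psi>)

lemma integral_\<mu>:
  fixes f :: "real \<Rightarrow> 'b :: {banach, second_countable_topology}"
  assumes [measurable]: "f \<in> borel_measurable borel"
  shows "(\<integral>x. f x \<partial>\<mu>) = (\<integral>\<omega>. f (\<psi> k \<omega>) \<partial>M)"
  by (subst distr_\<psi>[of k, symmetric]) (simp add: integral_distr)

text \<open>Fubini freezes the whole arrival sequence; the factors are then functions of independent
  marks and the expectation factorizes. The field \<open>'b\<close> is left open because the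
  characteristic function uses complex factors and the maximum real ones.\<close>

lemma expectation_prod_marks:
  fixes f :: "real \<Rightarrow> real \<Rightarrow> 'b :: {real_normed_field, banach, second_countable_topology}"
  assumes [measurable]: "case_prod f \<in> borel_measurable (borel \<Otimes>\<^sub>M borel)"
    and bound: "\<And>x s. norm (f x s) \<le> 1"
  shows "(\<integral>\<omega>. (\<Prod>k<n. f (\<psi> k \<omega>) (arrival \<zeta> k \<omega>)) \<partial>M) = (\<integral>\<omega>. (\<Prod>k<n. (\<integral>x. f x (arrival \<zeta> k \<omega>) \<partial>\<mu>)) \<partial>M)"
proof -
  define F :: "(nat \<Rightarrow> real) \<times> (nat \<Rightarrow> real) \<Rightarrow> 'b" where "F = (\<lambda>(v, w). \<Prod>k<n. f (v k) (w k))"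
  have [measurable]: "F \<in> borel_measurable ((\<Pi>\<^sub>M k\<in>UNIV. borel) \<Otimes>\<^sub>M (\<Pi>\<^sub>M k\<in>UNIV. borel))"
    unfolding F_def by measurable
  have F_bound: "norm (F z) \<le> 1" for z
    unfolding F_def using bound by (auto simp: split_beta prod_norm[symmetric] intro!: prod_le_1)
  have "(\<integral>\<omega>. F ((\<lambda>k. \<psi> k \<omega>), (\<lambda>k. arrival \<zeta> k \<omega>)) \<partial>M) = (\<integral>\<omega>. (\<integral>\<omega>'. F ((\<lambda>k. \<psi> k \<omega>'), (\<lambda>k. arrival \<zeta> k \<omega>)) \<partial>M) \<partial>M)"
    by (rule indep_var_Fubini_fst[OF indep_\<psi>_arrival _ F_bound]) measurable
  also have "\<dots> = (\<integral>\<omega>. (\<Prod>k<n. (\<integral>x. f x (arrival \<zeta> k \<omega>) \<partial>\<mu>)) \<partial>M)"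
  proof (intro Bochner_Integration.integral_cong refl)
    fix \<omega>
    have m: "(\<lambda>x. f x s) \<in> borel_measurable borel" for s by measurable
    have "indep_vars (\<lambda>_. borel) (\<lambda>k \<omega>'. f (\<psi> k \<omega>') (arrival \<zeta> k \<omega>)) {..<n}"
      using indep_vars_compose2[OF indep_vars_subset[OF indep_\<psi>, of "{..<n}"], of "\<lambda>k x. f x (arrival \<zeta> k \<omega>)" "\<lambda>_. borel"] m by auto
    then have "(\<integral>\<omega>'. (\<Prod>k<n. f (\<psi> k \<omega>') (arrival \<zeta> k \<omega>)) \<partial>M) = (\<Prod>k<n. \<integral>\<omega>'. f (\<psi> k \<omega>') (arrival \<zeta> k \<omega>) \<partial>M)"
      using bound m by (intro indep_vars_lebesgue_integral) (auto intro!: integrable_const_bound[of _ 1])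
    also have "\<dots> = (\<Prod>k<n. (\<integral>x. f x (arrival \<zeta> k \<omega>) \<partial>\<mu>))"
      by (intro prod.cong refl integral_\<mu>[OF m, symmetric])
    finally show "(\<integral>\<omega>'. F ((\<lambda>k. \<psi> k \<omega>'), (\<lambda>k. arrival \<zeta> k \<omega>)) \<partial>M) = (\<Prod>k<n. (\<integral>x. f x (arrival \<zeta> k \<omega>) \<partial>\<mu>))"
      by (simp add: F_def)
  qed
  finally show ?thesis by (simp add: F_def)
qed

end

section \<open>Kolmogorov's maximal inequality and convergence of centered series\<close>

locale centered_indep = prob_space M for M :: "'w measure" +
  fixes D :: "nat \<Rightarrow> 'w \<Rightarrow> real"
  assumes indep_D: "indep_vars (\<lambda>_. borel) D UNIV"
    and sq_int: "\<And>k. integrable M (\<lambda>\<omega>. (D k \<omega>)\<^sup>2)"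
    and centered: "\<And>k. (\<integral>\<omega>. D k \<omega> \<partial>M) = 0"
begin

lemma D_meas [measurable]: "D k \<in> borel_measurable M"
  using indep_D by (auto simp: indep_vars_def)

lemma D_int: "integrable M (D k)"
  by (rule square_integrable_imp_integrable[OF D_meas sq_int])

lemma expectation_split:
  assumes f: "f \<in> borel_measurable (\<Pi>\<^sub>M i\<in>A. borel)" and g: "g \<in> borel_measurable (\<Pi>\<^sub>M i\<in>C. borel)"
    and "A \<inter> C = {}"
    and "integrable M (\<lambda>\<omega>. f (restrict (\<lambda>i. D i \<omega>) A))" "integrable M (\<lambda>\<omega>. g (restrict (\<lambda>i. D i \<omega>) C))"
  shows "(\<integral>\<omega>. f (restrict (\<lambda>i. D i \<omega>) A) * g (restrict (\<lambda>i. D i \<omega>) C) \<partial>M)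
    = (\<integral>\<omega>. f (restrict (\<lambda>i. D i \<omega>) A) \<partial>M) * (\<integral>\<omega>. (g (restrict (\<lambda>i. D i \<omega>) C) :: real) \<partial>M)"
proof -
  have "indep_var borel (f \<circ> (\<lambda>\<omega>. restrict (\<lambda>i. D i \<omega>) A)) borel (g \<circ> (\<lambda>\<omega>. restrict (\<lambda>i. D i \<omega>) C))"
    by (rule indep_var_compose[OF indep_var_restrict[OF indep_D] f g]) (use assms in auto)
  from indep_var_lebesgue_integral[OF this] show ?thesis using assms(4,5) by (simp add: comp_def)
qed

definition S :: "nat \<Rightarrow> nat \<Rightarrow> 'w \<Rightarrow> real" where
  "S m n \<omega> = (\<Sum>k\<in>{m..<n}. D k \<omega>)"

lemma S_meas [measurable]: "S m n \<in> borel_measurable M"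
  unfolding S_def[abs_def] by measurable

lemma S_sq_int: "integrable M (\<lambda>\<omega>. (S m n \<omega>)\<^sup>2)"
proof (induction n)
  case (Suc n)
  show ?case
  proof (cases "m \<le> n")
    case True
    have "integrable M (\<lambda>\<omega>. 2 * (S m n \<omega>)\<^sup>2 + 2 * (D n \<omega>)\<^sup>2)"
      using Suc sq_int by auto
    then show ?thesis
    proof (rule Bochner_Integration.integrable_bound)
      have "(S m (Suc n) \<omega>)\<^sup>2 \<le> 2 * (S m n \<omega>)\<^sup>2 + 2 * (D n \<omega>)\<^sup>2" for \<omega>
        using True sum_squares_bound[of "S m n \<omega>" "D n \<omega>"] by (simp add: S_def power2_sum)
      then show "AE \<omega> in M. norm ((S m (Suc n) \<omega>)\<^sup>2) \<le> norm (2 * (S m n \<omega>)\<^sup>2 + 2 * (D n \<omega>)\<^sup>2)"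
        by auto
    qed measurable
  qed (simp add: S_def)
qed (simp add: S_def)

lemma S_int: "integrable M (S m n)"
  by (rule square_integrable_imp_integrable[OF S_meas S_sq_int])

lemma expectation_S: "(\<integral>\<omega>. S m n \<omega> \<partial>M) = 0"
  unfolding S_def using D_int by (simp add: centered)

lemma sum_restrict: "A \<subseteq> B \<Longrightarrow> (\<Sum>k\<in>A. restrict (\<lambda>i. D i \<omega>) B k) = (\<Sum>k\<in>A. D k \<omega>)"
  by (intro sum.cong) auto

text \<open>The sum over \<open>{n..<N}\<close> is centered and independent of the block
  \<open>{m..<n}\<close>. This orthogonality removes the cross terms both in the variance of the
  sums and in the maximal inequality.\<close>

lemma expectation_past_future:
  assumes "n \<le> N" and f: "f \<in> borel_measurable (\<Pi>\<^sub>M i\<in>{m..<n}. borel)"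
    and "integrable M (\<lambda>\<omega>. f (restrict (\<lambda>i. D i \<omega>) {m..<n}))"
  shows "(\<integral>\<omega>. f (restrict (\<lambda>i. D i \<omega>) {m..<n}) * S n N \<omega> \<partial>M) = 0"
  using expectation_split[OF f borel_measurable_sum_PiM[of "{n..<N}" "{n..<N}"]] assms S_int[of n N] expectation_S[of n N]
  unfolding S_def by (simp add: sum_restrict)

lemma expectation_S_sq: "(\<integral>\<omega>. (S m n \<omega>)\<^sup>2 \<partial>M) = (\<Sum>k\<in>{m..<n}. \<integral>\<omega>. (D k \<omega>)\<^sup>2 \<partial>M)"
proof (induction n)
  case (Suc n)
  show ?case
  proof (cases "m \<le> n")
    case True
    have eq: "(S m (Suc n) \<omega>)\<^sup>2 = (S m n \<omega>)\<^sup>2 + (D n \<omega>)\<^sup>2 + 2 * (S m n \<omega> * S n (Suc n) \<omega>)" for \<omega>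
      using True by (simp add: S_def power2_sum)
    have 0: "(\<integral>\<omega>. S m n \<omega> * S n (Suc n) \<omega> \<partial>M) = 0"
      using expectation_past_future[of n "Suc n" "\<lambda>v. \<Sum>k\<in>{m..<n}. v k" m] borel_measurable_sum_PiM S_int[of m n, unfolded S_def[abs_def]]
      by (simp add: sum_restrict S_def)
    have i: "integrable M (\<lambda>\<omega>. S m n \<omega> * S n (Suc n) \<omega>)"
    proof (rule Bochner_Integration.integrable_bound)
      show "integrable M (\<lambda>\<omega>. (S m n \<omega>)\<^sup>2 + (S n (Suc n) \<omega>)\<^sup>2)" using S_sq_int by auto
      show "AE \<omega> in M. norm (S m n \<omega> * S n (Suc n) \<omega>) \<le> norm ((S m n \<omega>)\<^sup>2 + (S n (Suc n) \<omega>)\<^sup>2)"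
      proof (intro AE_I2)
        fix \<omega>
        have "2 * \<bar>S m n \<omega>\<bar> * \<bar>S n (Suc n) \<omega>\<bar> \<le> (S m n \<omega>)\<^sup>2 + (S n (Suc n) \<omega>)\<^sup>2"
          using sum_squares_bound[of "\<bar>S m n \<omega>\<bar>" "\<bar>S n (Suc n) \<omega>\<bar>"] by simp
        moreover have "0 \<le> \<bar>S m n \<omega>\<bar> * \<bar>S n (Suc n) \<omega>\<bar>" by simp
        ultimately have "\<bar>S m n \<omega>\<bar> * \<bar>S n (Suc n) \<omega>\<bar> \<le> (S m n \<omega>)\<^sup>2 + (S n (Suc n) \<omega>)\<^sup>2" by linarith
        then show "norm (S m n \<omega> * S n (Suc n) \<omega>) \<le> norm ((S m n \<omega>)\<^sup>2 + (S n (Suc n) \<omega>)\<^sup>2)"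
          by (simp add: abs_mult)
      qed
    qed measurable
    show ?thesis unfolding eq using True 0 i S_sq_int sq_int Suc by simp
  qed (simp add: S_def)
qed (simp add: S_def)

text \<open>The indicator of the event that \<open>n\<close> is the first index from
  \<open>m\<close> on at which the partial sum leaves the interval of radius \<open>e\<close>. As a
  product it is visibly a function of the block \<open>{m..<n}\<close>, and its sum over
  \<open>n\<close> telescopes.\<close>

definition first_exit :: "real \<Rightarrow> nat \<Rightarrow> nat \<Rightarrow> 'w \<Rightarrow> real" where
  "first_exit e m n \<omega> = indicator {e..} \<bar>S m n \<omega>\<bar> * (\<Prod>j\<in>{m..<n}. indicator {..<e} \<bar>S m j \<omega>\<bar>)"

lemma first_exit_meas [measurable]: "first_exit e m n \<in> borel_measurable M"
  unfolding first_exit_def[abs_def] by measurable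

lemma first_exit_01: "0 \<le> first_exit e m n \<omega>" "first_exit e m n \<omega> \<le> 1"
  unfolding first_exit_def by (auto intro!: mult_le_one prod_le_1 mult_nonneg_nonneg prod_nonneg)

text \<open>Each weight is the difference of two successive products, so the sum telescopes from the
  empty product 1.\<close>

lemma sum_first_exit:
  "(\<Sum>n\<in>{m..<N}. first_exit e m n \<omega>) = 1 - (\<Prod>j\<in>{m..<N}. indicator {..<e} \<bar>S m j \<omega>\<bar>)"
proof (induction N)
  case (Suc N)
  show ?case
  proof (cases "m \<le> N")
    case True
    have "indicator {e..} \<bar>S m N \<omega>\<bar> = (1 - indicator {..<e} \<bar>S m N \<omega>\<bar> :: real)"
      by (auto split: split_indicator)
    then have "first_exit e m N \<omega> = (1 - indicator {..<e} \<bar>S m N \<omega>\<bar>) * (\<Prod>j\<in>{m..<N}. indicator {..<e} \<bar>S m j \<omega>\<bar>)"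
      unfolding first_exit_def by simp
    then show ?thesis using True Suc by (simp only: sum.atLeastLessThan_Suc prod.atLeastLessThan_Suc) (simp add: algebra_simps)
  qed simp
qed simp

text \<open>At a first exit the square of \<open>S m n\<close> is at least \<open>e^2\<close>.
  Passing from \<open>n\<close> to \<open>N\<close> adds a square, which is nonnegative, and a cross
  term in which \<open>S n N\<close> is multiplied by a function of the past and hence has mean
  0.\<close>

lemma first_exit_sq_le:
  assumes "0 < e" "m \<le> n" "n \<le> N"
  shows "e\<^sup>2 * (\<integral>\<omega>. first_exit e m n \<omega> \<partial>M) \<le> (\<integral>\<omega>. first_exit e m n \<omega> * (S m N \<omega>)\<^sup>2 \<partial>M)"
proof -
  define f where "f v = 2 * ((\<Sum>k\<in>{m..<n}. v k) * (indicator {e..} \<bar>\<Sum>k\<in>{m..<n}. v k\<bar> *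
      (\<Prod>j\<in>{m..<n}. indicator {..<e} \<bar>\<Sum>k\<in>{m..<j}. v k\<bar>)) :: real)" for v :: "nat \<Rightarrow> real"
  have ind: "(\<lambda>v. indicator B \<bar>\<Sum>k\<in>{m..<j}. v k\<bar> :: real) \<in> borel_measurable (\<Pi>\<^sub>M i\<in>{m..<n}. borel)"
    if "j \<le> n" and [measurable]: "B \<in> sets borel" for j and B :: "real set"
  proof -
    have [measurable]: "(\<lambda>v. \<Sum>k\<in>{m..<j}. v k :: real) \<in> borel_measurable (\<Pi>\<^sub>M i\<in>{m..<n}. borel)"
      by (rule borel_measurable_sum_PiM) (use that in auto)
    show ?thesis by measurable
  qed
  have f_meas: "f \<in> borel_measurable (\<Pi>\<^sub>M i\<in>{m..<n}. borel)"
    unfolding f_def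
    by (intro borel_measurable_times borel_measurable_prod borel_measurable_const ind borel_measurable_sum_PiM order_refl) auto
  have f_eq: "f (restrict (\<lambda>i. D i \<omega>) {m..<n}) = 2 * (S m n \<omega> * first_exit e m n \<omega>)" for \<omega>
  proof -
    have "(\<Sum>k\<in>{m..<j}. restrict (\<lambda>i. D i \<omega>) {m..<n} k) = S m j \<omega>" if "j \<le> n" for j
      unfolding S_def by (rule sum_restrict) (use that in auto)
    then show ?thesis unfolding f_def first_exit_def by simp
  qed
  have i1: "integrable M (\<lambda>\<omega>. first_exit e m n \<omega> * (S a b \<omega>)\<^sup>2)" for a b
    by (rule Bochner_Integration.integrable_bound[OF S_sq_int[of a b]])
       (use first_exit_01 in \<open>auto simp: abs_mult mult_left_le_one_le\<close>)
  have i2: "integrable M (\<lambda>\<omega>. S m n \<omega> * first_exit e m n \<omega>)"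
    by (rule Bochner_Integration.integrable_bound[OF S_int[of m n]])
       (use first_exit_01 in \<open>auto simp: abs_mult mult_left_le\<close>)
  have 0: "(\<integral>\<omega>. 2 * (S m n \<omega> * first_exit e m n \<omega>) * S n N \<omega> \<partial>M) = 0"
    using expectation_past_future[OF assms(3) f_meas] i2 unfolding f_eq by simp
  have decomp: "first_exit e m n \<omega> * (S m N \<omega>)\<^sup>2 = first_exit e m n \<omega> * (S m n \<omega>)\<^sup>2
      + 2 * (S m n \<omega> * first_exit e m n \<omega>) * S n N \<omega> + first_exit e m n \<omega> * (S n N \<omega>)\<^sup>2" for \<omega>
  proof -
    have "S m N \<omega> = S m n \<omega> + S n N \<omega>"
      unfolding S_def using assms by (simp add: sum.atLeastLessThan_concat)
    then show ?thesis by (simp add: power2_sum algebra_simps)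
  qed
  \<comment> \<open>The cross term is a difference of the three square terms of
    \<open>decomp\<close>, and its integrability is read off from theirs.\<close>
  have i3: "integrable M (\<lambda>\<omega>. 2 * (S m n \<omega> * first_exit e m n \<omega>) * S n N \<omega>)"
  proof -
    have "integrable M (\<lambda>\<omega>. first_exit e m n \<omega> * (S m N \<omega>)\<^sup>2 - first_exit e m n \<omega> * (S m n \<omega>)\<^sup>2 - first_exit e m n \<omega> * (S n N \<omega>)\<^sup>2)"
      using i1 by (intro Bochner_Integration.integrable_diff)
    then show ?thesis by (simp add: decomp)
  qed
  have "e\<^sup>2 * (\<integral>\<omega>. first_exit e m n \<omega> \<partial>M) = (\<integral>\<omega>. e\<^sup>2 * first_exit e m n \<omega> \<partial>M)" by simp
  also have "\<dots> \<le> (\<integral>\<omega>. first_exit e m n \<omega> * (S m n \<omega>)\<^sup>2 \<partial>M)"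
  proof (rule integral_mono[OF _ i1])
    show "integrable M (\<lambda>\<omega>. e\<^sup>2 * first_exit e m n \<omega>)"
      by (rule integrable_const_bound[of _ "e\<^sup>2"]) (use first_exit_01 in \<open>auto simp: abs_mult mult_left_le\<close>)
    show "e\<^sup>2 * first_exit e m n \<omega> \<le> first_exit e m n \<omega> * (S m n \<omega>)\<^sup>2" for \<omega>
    proof (cases "e \<le> \<bar>S m n \<omega>\<bar>")
      case True
      then have "e\<^sup>2 \<le> (S m n \<omega>)\<^sup>2" using assms by (simp add: abs_le_square_iff[symmetric])
      from mult_left_mono[OF this first_exit_01(1)[of e m n \<omega>]] show ?thesis by (simp add: mult.commute)
    qed (simp add: first_exit_def)
  qed
  also have "\<dots> \<le> (\<integral>\<omega>. first_exit e m n \<omega> * (S m N \<omega>)\<^sup>2 \<partial>M)"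
  proof -
    have "0 \<le> (\<integral>\<omega>. first_exit e m n \<omega> * (S n N \<omega>)\<^sup>2 \<partial>M)"
      using first_exit_01 by (intro integral_nonneg_AE) auto
    then show ?thesis unfolding decomp using i1 i3 0 by simp
  qed
  finally show ?thesis .
qed

text \<open>The event is the disjoint union of the first exits at \<open>n\<close> in
  \<open>{m..<N}\<close>, so the bounds for the single exits add up, and their total weight is at
  most 1. The range stops before \<open>N\<close>, the index at which the square is
  evaluated.\<close>

lemma kolmogorov_maximal:
  assumes "0 < e"
  shows "e\<^sup>2 * prob {\<omega> \<in> space M. \<exists>n\<in>{m..<N}. e \<le> \<bar>S m n \<omega>\<bar>} \<le> (\<Sum>k\<in>{m..<N}. \<integral>\<omega>. (D k \<omega>)\<^sup>2 \<partial>M)"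
proof -
  define E where "E = {\<omega> \<in> space M. \<exists>n\<in>{m..<N}. e \<le> \<bar>S m n \<omega>\<bar>}"
  have [measurable]: "E \<in> sets M" unfolding E_def by measurable
  have fi: "integrable M (first_exit e m n)" for n
    by (rule integrable_const_bound[of _ 1]) (use first_exit_01 in auto)
  have i1: "integrable M (\<lambda>\<omega>. first_exit e m n \<omega> * (S m N \<omega>)\<^sup>2)" for n
    by (rule Bochner_Integration.integrable_bound[OF S_sq_int[of m N]])
       (use first_exit_01 in \<open>auto simp: abs_mult mult_left_le_one_le\<close>)
  have "prob E = (\<integral>\<omega>. indicator E \<omega> \<partial>M)" by simp
  also have "\<dots> = (\<integral>\<omega>. (\<Sum>n\<in>{m..<N}. first_exit e m n \<omega>) \<partial>M)"
  proof (intro Bochner_Integration.integral_cong refl)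
    fix \<omega> assume "\<omega> \<in> space M"
    show "indicator E \<omega> = (\<Sum>n\<in>{m..<N}. first_exit e m n \<omega>)"
    proof (cases "\<omega> \<in> E")
      case True
      then obtain n where "n \<in> {m..<N}" "e \<le> \<bar>S m n \<omega>\<bar>" by (auto simp: E_def)
      then have "(\<Prod>j\<in>{m..<N}. indicator {..<e} \<bar>S m j \<omega>\<bar> :: real) = 0"
        by (intro prod_zero) (auto intro!: bexI[of _ n])
      then show ?thesis using True by (simp add: sum_first_exit)
    next
      case False
      then have "(\<Prod>j\<in>{m..<N}. indicator {..<e} \<bar>S m j \<omega>\<bar> :: real) = 1"
        using \<open>\<omega> \<in> space M\<close> by (intro prod.neutral) (auto simp: E_def indicator_def not_le)
      then show ?thesis using False by (simp add: sum_first_exit)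
    qed
  qed
  also have "\<dots> = (\<Sum>n\<in>{m..<N}. \<integral>\<omega>. first_exit e m n \<omega> \<partial>M)" using fi by simp
  finally have "e\<^sup>2 * prob E = (\<Sum>n\<in>{m..<N}. e\<^sup>2 * (\<integral>\<omega>. first_exit e m n \<omega> \<partial>M))"
    by (simp add: sum_distrib_left)
  also have "\<dots> \<le> (\<Sum>n\<in>{m..<N}. \<integral>\<omega>. first_exit e m n \<omega> * (S m N \<omega>)\<^sup>2 \<partial>M)"
    using assms by (intro sum_mono first_exit_sq_le) auto
  also have "\<dots> = (\<integral>\<omega>. (\<Sum>n\<in>{m..<N}. first_exit e m n \<omega>) * (S m N \<omega>)\<^sup>2 \<partial>M)"
    using i1 by (simp add: sum_distrib_right)
  also have "\<dots> \<le> (\<integral>\<omega>. (S m N \<omega>)\<^sup>2 \<partial>M)"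
  proof (rule integral_mono[OF _ S_sq_int])
    show "integrable M (\<lambda>\<omega>. (\<Sum>n\<in>{m..<N}. first_exit e m n \<omega>) * (S m N \<omega>)\<^sup>2)"
      using i1 by (simp add: sum_distrib_right)
    have "(\<Sum>n\<in>{m..<N}. first_exit e m n \<omega>) \<le> 1" for \<omega>
      unfolding sum_first_exit by (auto intro!: prod_nonneg)
    then show "(\<Sum>n\<in>{m..<N}. first_exit e m n \<omega>) * (S m N \<omega>)\<^sup>2 \<le> (S m N \<omega>)\<^sup>2" for \<omega>
      using first_exit_01 by (intro mult_left_le_one_le sum_nonneg) auto
  qed
  also have "\<dots> = (\<Sum>k\<in>{m..<N}. \<integral>\<omega>. (D k \<omega>)\<^sup>2 \<partial>M)" by (rule expectation_S_sq)
  finally show ?thesis unfolding E_def .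
qed

text \<open>Letting \<open>N\<close> grow in the maximal inequality bounds the probability that the
  sums started at \<open>m\<close> ever reach \<open>e\<close> by a tail of the variance series,
  divided by \<open>e^2\<close>. The tails vanish, so almost surely some starting index keeps all
  later sums below \<open>e\<close>, which is the Cauchy criterion.\<close>

theorem AE_summable:
  assumes "summable (\<lambda>k. \<integral>\<omega>. (D k \<omega>)\<^sup>2 \<partial>M)"
  shows "AE \<omega> in M. summable (\<lambda>k. D k \<omega>)"
proof -
  define v where "v k = (\<integral>\<omega>. (D k \<omega>)\<^sup>2 \<partial>M)" for k
  have v: "summable v" "\<And>k. 0 \<le> v k" using assms by (auto simp: v_def[abs_def])
  define B where "B e m N = {\<omega> \<in> space M. \<exists>n\<in>{m..<N}. e \<le> \<bar>S m n \<omega>\<bar>}" for e m N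
  have B [measurable]: "B e m N \<in> sets M" for e m N unfolding B_def by measurable
  have B_all: "prob (\<Union>N. B e m N) \<le> (\<Sum>k. v (k + m)) / e\<^sup>2" if "0 < e" for e m
  proof (rule LIMSEQ_le_const2[OF finite_Lim_measure_incseq])
    show "range (B e m) \<subseteq> sets M" by auto
    show "incseq (B e m)" unfolding B_def incseq_def by fastforce
    have "prob (B e m N) \<le> (\<Sum>k. v (k + m)) / e\<^sup>2" for N
    proof -
      have "e\<^sup>2 * prob (B e m N) \<le> (\<Sum>k\<in>{m..<N}. v k)"
        using kolmogorov_maximal[OF that, of m N] by (simp add: B_def v_def)
      also have "(\<Sum>k\<in>{m..<N}. v k) = (\<Sum>k<N - m. v (k + m))"
        by (rule sum.reindex_bij_witness[of _ "\<lambda>k. k + m" "\<lambda>k. k - m"]) auto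
      also have "\<dots> \<le> (\<Sum>k. v (k + m))"
        using v by (intro sum_le_suminf) auto
      finally show ?thesis using that by (simp add: field_simps)
    qed
    then show "\<exists>N. \<forall>n\<ge>N. prob (B e m n) \<le> (\<Sum>k. v (k + m)) / e\<^sup>2" by auto
  qed
  have AE_e: "AE \<omega> in M. \<exists>m. \<forall>n\<ge>m. \<bar>S m n \<omega>\<bar> < e" if "0 < e" for e
  proof -
    define C where "C = (\<Inter>m. \<Union>N. B e m N)"
    have [measurable]: "C \<in> sets M" unfolding C_def by measurable
    have "prob C \<le> 0"
    proof (rule LIMSEQ_le_const)
      show "(\<lambda>m. (\<Sum>k. v (k + m)) / e\<^sup>2) \<longlonglongrightarrow> 0"
        using tendsto_divide[OF suminf_exist_split2[OF v(1)] tendsto_const[of "e\<^sup>2"]] that by simp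
      have "prob C \<le> (\<Sum>k. v (k + m)) / e\<^sup>2" for m
      proof -
        have "prob C \<le> prob (\<Union>N. B e m N)" by (rule finite_measure_mono) (auto simp: C_def)
        with B_all[OF that, of m] show ?thesis by simp
      qed
      then show "\<exists>N. \<forall>n\<ge>N. prob C \<le> (\<Sum>k. v (k + n)) / e\<^sup>2" by auto
    qed
    then have "prob C = 0" using measure_nonneg[of M C] by linarith
    then have "AE \<omega> in M. \<omega> \<notin> C" by (subst AE_iff_measurable[OF \<open>C \<in> sets M\<close>]) (auto simp: emeasure_eq_measure dest: sets.sets_into_space[OF \<open>C \<in> sets M\<close>, THEN subsetD])
    then show ?thesis
    proof (rule AE_mp, intro AE_I2 impI)
      fix \<omega> assume "\<omega> \<in> space M" "\<omega> \<notin> C"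
      then obtain m where m: "\<And>N. \<omega> \<notin> B e m N" by (auto simp: C_def)
      have "\<bar>S m n \<omega>\<bar> < e" if "m \<le> n" for n
        using m[of "Suc n"] \<open>\<omega> \<in> space M\<close> that by (auto simp: B_def not_le)
      then show "\<exists>m. \<forall>n\<ge>m. \<bar>S m n \<omega>\<bar> < e" by blast
    qed
  qed
  have "AE \<omega> in M. \<forall>j. \<exists>m. \<forall>n\<ge>m. \<bar>S m n \<omega>\<bar> < inverse (real (Suc j))"
    by (subst AE_all_countable) (auto intro: AE_e)
  then show ?thesis
  proof eventually_elim
    case (elim \<omega>)
    show ?case unfolding summable_Cauchy
    proof (intro allI impI)
      fix e :: real assume "0 < e"
      \<comment> \<open>Half of the tolerance, since a block \<open>{a..<b}\<close> is the
        difference of two sums started at \<open>m\<close>.\<close>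
      then obtain j where j: "inverse (real (Suc j)) < e / 2"
        using reals_Archimedean[of "e / 2"] by auto
      from elim obtain m where m: "\<And>n. m \<le> n \<Longrightarrow> \<bar>S m n \<omega>\<bar> < e / 2"
        using j by (meson order_less_trans)
      have "norm (\<Sum>k\<in>{a..<b}. D k \<omega>) < e" if "m \<le> a" for a b
      proof (cases "a \<le> b")
        case True
        then have "S m a \<omega> + (\<Sum>k\<in>{a..<b}. D k \<omega>) = S m b \<omega>"
          unfolding S_def using that by (simp add: sum.atLeastLessThan_concat)
        then show ?thesis using m[of a] m[of b] that True unfolding real_norm_def by linarith
      qed (use \<open>0 < e\<close> in simp)
      then show "\<exists>N. \<forall>m\<ge>N. \<forall>n. norm (\<Sum>k = m..<n. D k \<omega>) < e" by blast
    qed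
  qed
qed

end

section \<open>Scalar LePage series\<close>

text \<open>Counts the positive integers below \<open>\<bar>x\<bar>\<close>. Integrated over the law
  of the marks, it bounds the sum of the exceedance probabilities by the first absolute
  moment.\<close>

lemma sum_exceed_le: "(\<Sum>k<n. if real (Suc k) < \<bar>x\<bar> then 1 else 0) \<le> \<bar>x\<bar>"
proof -
  have "(\<Sum>k<n. if real (Suc k) < \<bar>x\<bar> then 1 else 0) \<le> min (real n) \<bar>x\<bar>"
    by (induction n) (auto simp: min_def split: if_splits)
  then show ?thesis by simp
qed

text \<open>Only indices beyond \<open>\<bar>x\<bar>\<close> contribute, and there the sum of
  \<open>1 / k^2\<close> is of order \<open>1 / \<bar>x\<bar>\<close>. Integrated over the law of
  the marks, it bounds the sum of the normalized truncated second moments by twice the first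
  absolute moment.\<close>

lemma sum_truncated_le: "(\<Sum>k<n. if \<bar>x\<bar> \<le> real (Suc k) then (x / real (Suc k))\<^sup>2 else 0) \<le> 2 * \<bar>x\<bar>"
proof -
  define a where "a = \<bar>x\<bar>"
  define s where "s n = (\<Sum>k<n. if a \<le> real (Suc k) then (a / real (Suc k))\<^sup>2 else 0)" for n
  have a: "0 \<le> a" by (simp add: a_def)
  \<comment> \<open>Below \<open>a\<close> no term is present. Above it, the correction
    \<open>- a\<^sup>2 / n\<close> strengthens the bound enough for the induction to
    telescope.\<close>
  have inv: "(real n < a \<or> n = 0 \<longrightarrow> s n = 0) \<and> (a \<le> real n \<and> 0 < n \<longrightarrow> s n \<le> 2 * a - a\<^sup>2 / real n)" for n
  proof (induction n)
    case 0
    then show ?case by (simp add: s_def)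
  next
    case (Suc n)
    have step: "s (Suc n) = s n + (if a \<le> real (Suc n) then (a / real (Suc n))\<^sup>2 else 0)" by (simp add: s_def)
    show ?case
    proof (cases "a \<le> real (Suc n)")
      case False
      then show ?thesis using Suc step by auto
    next
      case le: True
      have "s (Suc n) \<le> 2 * a - a\<^sup>2 / real (Suc n)"
      proof (cases "a \<le> real n \<and> 0 < n")
        case True
        \<comment> \<open>The comparison of \<open>1 / (n + 1)^2\<close> with
          \<open>1 / n - 1 / (n + 1)\<close>, which drives the telescoping.\<close>
        have "1 / (real (Suc n))\<^sup>2 + 1 / real (Suc n) \<le> 1 / real n"
        proof -
          have y: "0 < real n" using True by simp
          have "(real n + 2) * real n \<le> (real (Suc n))\<^sup>2" by (simp add: power2_eq_square algebra_simps)
          then have "real n + 2 \<le> (1 / real n) * (real (Suc n))\<^sup>2" using y by (simp add: pos_le_divide_eq)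
          then have "(real n + 2) / (real (Suc n))\<^sup>2 \<le> 1 / real n" by (subst pos_divide_le_eq) (auto simp del: of_nat_Suc)
          moreover have "1 / (real (Suc n))\<^sup>2 + 1 / real (Suc n) = (real n + 2) / (real (Suc n))\<^sup>2"
          proof -
            have "1 / real (Suc n) = real (Suc n) / (real (Suc n))\<^sup>2" by (simp add: power2_eq_square)
            then show ?thesis by (simp add: add_divide_distrib[symmetric] add.commute)
          qed
          ultimately show ?thesis by simp
        qed
        from mult_left_mono[OF this, of "a\<^sup>2"]
        have "(a / real (Suc n))\<^sup>2 + a\<^sup>2 / real (Suc n) \<le> a\<^sup>2 / real n"
          by (simp add: power_divide distrib_left)
        moreover have "s n \<le> 2 * a - a\<^sup>2 / real n" using Suc True by blast
        ultimately show ?thesis using step le by simp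
      next
        case False
        \<comment> \<open>Here \<open>n + 1\<close> is the first index that contributes: its term
          and the correction \<open>a\<^sup>2 / (n + 1)\<close> are each at most \<open>a\<close>,
          which leaves room inside \<open>2 * a\<close>.\<close>
        then have "s n = 0" using Suc a by force
        have "a / real (Suc n) \<le> 1" using le by simp
        then have "a * (a / real (Suc n)) \<le> a * 1" using a by (intro mult_left_mono) auto
        moreover have "(a / real (Suc n))\<^sup>2 \<le> a"
        proof -
          have "(a / real (Suc n))\<^sup>2 \<le> a / real (Suc n)"
            unfolding power2_eq_square using \<open>a / real (Suc n) \<le> 1\<close> a by (intro mult_left_le) auto
          also have "\<dots> \<le> a" using a by (simp add: field_simps)
          finally show ?thesis .
        qed
        ultimately show ?thesis using step le \<open>s n = 0\<close> by (simp add: power2_eq_square)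
      qed
      then show ?thesis using le by auto
    qed
  qed
  have "s n \<le> 2 * a"
  proof (cases "a \<le> real n \<and> 0 < n")
    case True
    then have "s n \<le> 2 * a - a\<^sup>2 / real n" using inv[of n] by blast
    moreover have "0 \<le> a\<^sup>2 / real n" by simp
    ultimately show ?thesis by linarith
  next
    case False
    then have "s n = 0" using inv[of n] by force
    then show ?thesis using a by simp
  qed
  moreover have "s n = (\<Sum>k<n. if \<bar>x\<bar> \<le> real (Suc k) then (x / real (Suc k))\<^sup>2 else 0)"
    unfolding s_def a_def by (intro sum.cong refl) (simp add: power_divide del: of_nat_Suc)
  ultimately show ?thesis by (simp add: a_def)
qed

text \<open>The integral of \<open>1 - cos (1 / s)\<close> over the positive half-line; with
  \<open>t = 1 / s\<close> it becomes the integral of \<open>(1 - cos t) / t^2\<close>, whose value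
  is \<pi>/2. The argument 0 at nonpositive \<open>s\<close> makes the integrand vanish there. It is
  positive and finite, so it can be cancelled from the exponents.\<close>

definition cos_const :: real where
  "cos_const = enn2real (\<integral>\<^sup>+s. ennreal (1 - cos (if 0 < s then inverse s else 0)) \<partial>lborel)"

lemma one_minus_cos_le: "1 - cos x \<le> x\<^sup>2 / (2::real)"
proof -
  have "1 - cos x = 2 * (sin (x / 2))\<^sup>2" using cos_double_sin[of "x / 2"] by simp
  moreover have "(sin (x / 2))\<^sup>2 \<le> (x / 2)\<^sup>2" using abs_sin_x_le_abs_x[of "x / 2"] by (simp only: abs_le_square_iff)
  ultimately show ?thesis by (simp add: power_divide)
qed

text \<open>The integrand is at most 2 near the origin and, as \<open>1 - cos x\<close> is
  quadratic, at most \<open>1 / s^2\<close> beyond 1.\<close>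

lemma cos_const_finite: "(\<integral>\<^sup>+s. ennreal (1 - cos (if 0 < s then inverse s else 0)) \<partial>lborel) < \<infinity>"
proof -
  have int: "(\<integral>\<^sup>+s. ennreal (inverse s ^ 2) * indicator {1..} s \<partial>lborel) = ennreal (0 - (- inverse 1))"
  proof (rule nn_integral_FTC_atLeast)
    show "((\<lambda>s. - inverse s) has_real_derivative (inverse s)\<^sup>2) (at s)" if "1 \<le> s" for s :: real
      using that by (auto intro!: derivative_eq_intros simp: power2_eq_square)
    show "((\<lambda>s. - inverse s) \<longlongrightarrow> (0 :: real)) at_top"
      using tendsto_minus[OF tendsto_inverse_0_at_top[OF filterlim_ident]] by simp
  qed auto
  have "(\<integral>\<^sup>+s. ennreal (1 - cos (if 0 < s then inverse s else 0)) \<partial>lborel)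
    \<le> (\<integral>\<^sup>+s. 2 * indicator {0..1} s + ennreal (inverse s ^ 2) * indicator {1..} s \<partial>(lborel :: real measure))"
  proof (rule nn_integral_mono)
    fix s :: real
    have "1 - cos (inverse s) \<le> 2" using cos_ge_minus_one[of "inverse s"] by simp
    moreover have "1 - cos (inverse s) \<le> inverse s ^ 2"
      using one_minus_cos_le[of "inverse s"] by (rule order_trans) simp
    ultimately show "ennreal (1 - cos (if 0 < s then inverse s else 0))
      \<le> 2 * indicator {0..1} s + ennreal (inverse s ^ 2) * indicator {1..} s"
      by (cases "0 < s"; cases "s \<le> 1")
         (auto simp: indicator_def ennreal_leI intro: order_trans[OF ennreal_leI[of _ 2]])
  qed
  also have "\<dots> = 2 * emeasure lborel {0..1::real} + 1"
    by (subst nn_integral_add) (auto simp: int nn_integral_cmult_indicator)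
  also have "\<dots> < \<infinity>" by (simp add: ennreal_mult_less_top flip: ennreal_numeral ennreal_1 ennreal_plus)
  finally show ?thesis .
qed

lemma ennreal_cos_const: "(\<integral>\<^sup>+s. ennreal (1 - cos (if 0 < s then inverse s else 0)) \<partial>lborel) = ennreal cos_const"
  using cos_const_finite unfolding cos_const_def by (simp add: less_top)

lemma cos_const_pos: "0 < cos_const"
proof (rule ccontr)
  assume "\<not> 0 < cos_const"
  then have "(\<integral>\<^sup>+s. ennreal (1 - cos (if 0 < s then inverse s else 0)) \<partial>lborel) = 0"
    unfolding ennreal_cos_const by (simp add: ennreal_eq_0_iff)
  then have "AE s in lborel. ennreal (1 - cos (if 0 < s then inverse s else 0)) = 0"
    by (subst (asm) nn_integral_0_iff_AE) auto
  \<comment> \<open>For \<open>s\<close> in this interval \<open>1 / s\<close> lies between 1 and 3,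
    hence strictly between 0 and \<pi>, where the cosine is below 1. An interval of positive length
    would thus be null.\<close>
  then have "AE s in lborel. s \<notin> {1/3..1::real}"
  proof eventually_elim
    case (elim s)
    show ?case
    proof
      assume "s \<in> {1/3..1}"
      then have s: "0 < s" "1 \<le> inverse s" "inverse s \<le> 3" by (auto simp: field_simps)
      then have "cos (inverse s) < cos 0" using pi_gt3 by (intro cos_monotone_0_pi) auto
      then show False using elim s by (simp add: ennreal_eq_0_iff)
    qed
  qed
  then have "emeasure lborel {s \<in> space lborel. \<not> s \<notin> {1/3..1::real}} = 0"
    by (subst (asm) AE_iff_measurable[OF _ refl]) simp_all
  moreover have "{s \<in> space lborel. \<not> s \<notin> {1/3..1::real}} = {1/3..1}" by auto
  ultimately have "emeasure lborel {1/3..1::real} = 0" by simp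
  moreover have "emeasure lborel {1/3..1::real} = ennreal (1 - 1 / 3)" by (rule emeasure_lborel_Icc) simp
  ultimately show False by (simp add: ennreal_eq_0_iff)
qed

text \<open>Rescaling \<open>s\<close> by \<open>\<bar>x\<bar>\<close> removes \<open>x\<close> from
  the cosine, which is even, and produces the factor \<open>\<bar>x\<bar>\<close>. This is the
  origin of the absolute value in zonoid equivalence.\<close>

lemma nn_integral_one_minus_cos:
  "(\<integral>\<^sup>+s. ennreal (1 - cos (x * (if 0 < s then inverse s else 0))) \<partial>lborel) = ennreal (cos_const * \<bar>x\<bar>)"
proof (cases "x = 0")
  case False
  have "(\<integral>\<^sup>+s. ennreal (1 - cos (x * (if 0 < s then inverse s else 0))) \<partial>lborel)
    = ennreal \<bar>\<bar>x\<bar>\<bar> * (\<integral>\<^sup>+s. ennreal (1 - cos (x * (if 0 < 0 + \<bar>x\<bar> * s then inverse (0 + \<bar>x\<bar> * s) else 0))) \<partial>lborel)"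
    using False by (intro nn_integral_real_affine) auto
  also have "(\<integral>\<^sup>+s. ennreal (1 - cos (x * (if 0 < 0 + \<bar>x\<bar> * s then inverse (0 + \<bar>x\<bar> * s) else 0))) \<partial>lborel)
    = (\<integral>\<^sup>+s. ennreal (1 - cos (if 0 < s then inverse s else 0)) \<partial>lborel)"
  proof (intro nn_integral_cong)
    fix s :: real
    have "cos (x * inverse (\<bar>x\<bar> * s)) = cos (inverse s)"
      using False by (cases "0 < x") (auto simp: field_simps)
    then show "ennreal (1 - cos (x * (if 0 < 0 + \<bar>x\<bar> * s then inverse (0 + \<bar>x\<bar> * s) else 0))) =
       ennreal (1 - cos (if 0 < s then inverse s else 0))"
      using False by (simp add: zero_less_mult_iff)
  qed
  finally show ?thesis unfolding ennreal_cos_const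
    using cos_const_pos by (simp add: ennreal_mult'[symmetric] mult.commute)
qed simp

section \<open>Convergence and laws of the scalar series and maximum\<close>

context lepage_marks
begin

text \<open>Borel-Cantelli: the exceedance probabilities sum to at most the first absolute moment of
  \<mu>.\<close>

lemma AE_eventually_mark_le:
  assumes int: "integrable \<mu> (\<lambda>x. x)"
  shows "AE \<omega> in M. eventually (\<lambda>k. \<bar>\<psi> k \<omega>\<bar> \<le> real (Suc k)) sequentially"
proof -
  define A where "A k = {\<omega> \<in> space M. real (Suc k) < \<bar>\<psi> k \<omega>\<bar>}" for k
  have [measurable]: "A k \<in> sets M" for k unfolding A_def by measurable
  have pA: "measure M (A k) = (\<integral>x. (if real (Suc k) < \<bar>x\<bar> then 1 else 0) \<partial>\<mu>)" for k
  proof -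
    have "measure M (A k) = (\<integral>\<omega>. indicator (A k) \<omega> \<partial>M)" by simp
    also have "\<dots> = (\<integral>\<omega>. (if real (Suc k) < \<bar>\<psi> k \<omega>\<bar> then 1 else 0) \<partial>M)"
      by (intro Bochner_Integration.integral_cong) (auto simp: A_def)
    also have "\<dots> = (\<integral>x. (if real (Suc k) < \<bar>x\<bar> then 1 else 0) \<partial>\<mu>)"
      by (rule integral_\<mu>[symmetric]) measurable
    finally show ?thesis .
  qed
  have i: "integrable \<mu> (\<lambda>x. if real (Suc k) < \<bar>x\<bar> then 1 else 0 :: real)" for k
    by (rule \<mu>.integrable_const_bound[of _ 1]) auto
  have "summable (\<lambda>k. measure M (A k))"
  proof (rule summableI_nonneg_bounded)
    fix n
    have "(\<Sum>k<n. measure M (A k)) = (\<integral>x. (\<Sum>k<n. if real (Suc k) < \<bar>x\<bar> then 1 else 0) \<partial>\<mu>)"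
      unfolding pA using i by simp
    also have "\<dots> \<le> (\<integral>x. \<bar>x\<bar> \<partial>\<mu>)"
      using i int by (intro integral_mono sum_exceed_le Bochner_Integration.integrable_sum) auto
    finally show "(\<Sum>k<n. measure M (A k)) \<le> (\<integral>x. \<bar>x\<bar> \<partial>\<mu>)" .
  qed simp
  then have "AE \<omega> in M. eventually (\<lambda>k. \<omega> \<in> space M - A k) sequentially"
    by (intro borel_cantelli_AE1) (auto simp: emeasure_eq_measure)
  then show ?thesis
    by (rule AE_mp) (auto simp: A_def not_less elim!: eventually_mono)
qed

text \<open>Eventually the marks are at most \<open>k + 1\<close> in absolute value and the arrivals
  above \<open>(k + 1) / 2\<close>, so the terms are bounded by 2. A real supremum has its
  order-theoretic meaning only under such a bound.\<close>

lemma AE_bdd_above: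
  assumes int: "integrable \<mu> (\<lambda>x. x)"
  shows "AE \<omega> in M. bdd_above (range (\<lambda>k. inverse (arrival \<zeta> k \<omega>) * \<psi> k \<omega>))"
  using AE_eventually_mark_le[OF int] AE_arrival_ge
proof eventually_elim
  case (elim \<omega>)
  have "eventually (\<lambda>k. norm (inverse (arrival \<zeta> k \<omega>) * \<psi> k \<omega>) \<le> 2) sequentially"
    using elim
  proof eventually_elim
    case (elim k)
    then have "0 < arrival \<zeta> k \<omega>" by (smt (verit) of_nat_0_le_iff divide_nonneg_nonneg)
    moreover have "\<bar>\<psi> k \<omega>\<bar> \<le> 2 * arrival \<zeta> k \<omega>"
      by (rule order_trans[OF elim(1)]) (use elim(2) in simp)
    ultimately show ?case by (simp add: abs_mult field_simps)
  qed
  then have "Bseq (\<lambda>k. inverse (arrival \<zeta> k \<omega>) * \<psi> k \<omega>)"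
    by (rule BfunI)
  then have "bounded (range (\<lambda>k. inverse (arrival \<zeta> k \<omega>) * \<psi> k \<omega>))"
    by (simp add: Bseq_eq_bounded)
  then show ?case by (rule bounded_imp_bdd_above)
qed

text \<open>The marks are truncated at level \<open>k + 1\<close>. Truncation is odd, so symmetry
  keeps the truncated terms centered; their variances are summable by integrability of the marks. By
  Borel-Cantelli only finitely many terms are changed by the truncation.\<close>

lemma AE_summable_deterministic:
  assumes int: "integrable \<mu> (\<lambda>x. x)" and sym: "distr \<mu> borel uminus = \<mu>"
    and \<gamma>: "eventually (\<lambda>k. real (Suc k) / 2 < \<gamma> k) sequentially"
  shows "AE \<omega> in M. summable (\<lambda>k. inverse (\<gamma> k) * \<psi> k \<omega>)"
proof -
  define T where "T k x = (if \<bar>x\<bar> \<le> real (Suc k) then x else 0)" for k and x :: real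
  have T_meas [measurable]: "T k \<in> borel_measurable borel" for k unfolding T_def[abs_def] by measurable
  have T_le: "\<bar>T k x\<bar> \<le> real (Suc k)" for k x by (simp add: T_def)
  define D where "D k \<omega> = inverse (\<gamma> k) * T k (\<psi> k \<omega>)" for k \<omega>
  have T_sq: "(T k x)\<^sup>2 \<le> (real (Suc k))\<^sup>2" for k x
    using T_le[of k x] by (simp add: abs_le_square_iff[symmetric] del: of_nat_Suc)
  have Tsq_int: "integrable \<mu> (\<lambda>x. (T k x)\<^sup>2)" for k
    by (rule \<mu>.integrable_const_bound[of _ "(real (Suc k))\<^sup>2"]) (use T_sq in auto)
  interpret centered_indep M D
  proof
    show "indep_vars (\<lambda>_. borel) D UNIV"
      unfolding D_def using indep_vars_compose2[OF indep_\<psi>, of "\<lambda>k x. inverse (\<gamma> k) * T k x" "\<lambda>_. borel"] by auto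
    show "integrable M (\<lambda>\<omega>. (D k \<omega>)\<^sup>2)" for k
    proof (rule integrable_const_bound[of _ "(inverse (\<gamma> k))\<^sup>2 * (real (Suc k))\<^sup>2"])
      show "AE \<omega> in M. norm ((D k \<omega>)\<^sup>2) \<le> (inverse (\<gamma> k))\<^sup>2 * (real (Suc k))\<^sup>2"
        unfolding D_def power_mult_distrib using T_sq[of k] by (auto intro!: mult_left_mono AE_I2 simp del: of_nat_Suc)
    qed (simp add: D_def)
    show "(\<integral>\<omega>. D k \<omega> \<partial>M) = 0" for k
    proof -
      have "(\<integral>x. T k x \<partial>\<mu>) = (\<integral>x. T k x \<partial>distr \<mu> borel uminus)" using sym by simp
      also have "\<dots> = (\<integral>x. T k (- x) \<partial>\<mu>)" by (rule integral_distr) auto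
      also have "\<dots> = - (\<integral>x. T k x \<partial>\<mu>)" by (simp add: T_def if_distrib[of uminus] flip: integral_minus cong: if_cong)
      finally have "(\<integral>x. T k x \<partial>\<mu>) = 0" by simp
      then show ?thesis unfolding D_def using integral_\<mu>[of "T k" k] by simp
    qed
  qed
  define v where "v k = (\<integral>x. (T k x / real (Suc k))\<^sup>2 \<partial>\<mu>)" for k
  have vi: "integrable \<mu> (\<lambda>x. (T k x / real (Suc k))\<^sup>2)" for k
    unfolding power_divide using Tsq_int by auto
  have "summable v"
  proof (rule summableI_nonneg_bounded)
    show "0 \<le> v k" for k unfolding v_def by simp
    fix n
    have "(\<Sum>k<n. v k) = (\<integral>x. (\<Sum>k<n. (T k x / real (Suc k))\<^sup>2) \<partial>\<mu>)"
      unfolding v_def using vi by simp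
    also have "\<dots> \<le> (\<integral>x. 2 * \<bar>x\<bar> \<partial>\<mu>)"
    proof (rule integral_mono)
      fix x
      have "(\<Sum>k<n. (T k x / real (Suc k))\<^sup>2) = (\<Sum>k<n. if \<bar>x\<bar> \<le> real (Suc k) then (x / real (Suc k))\<^sup>2 else 0)"
        by (intro sum.cong refl) (simp add: T_def)
      then show "(\<Sum>k<n. (T k x / real (Suc k))\<^sup>2) \<le> 2 * \<bar>x\<bar>" using sum_truncated_le[of x n] by simp
    qed (use vi int in auto)
    finally show "(\<Sum>k<n. v k) \<le> (\<integral>x. 2 * \<bar>x\<bar> \<partial>\<mu>)" .
  qed
  \<comment> \<open>Since \<open>\<gamma> k\<close> exceeds \<open>(k + 1) / 2\<close>, the quotient
    \<open>(k + 1) / \<gamma> k\<close> is at most 2; its square is the factor between the variance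
    of \<open>D k\<close> and \<open>v k\<close>.\<close>
  then have "summable (\<lambda>k. 4 * v k)" by (rule summable_mult)
  then have "summable (\<lambda>k. \<integral>\<omega>. (D k \<omega>)\<^sup>2 \<partial>M)"
  proof (rule summable_comparison_test_ev[rotated])
    show "eventually (\<lambda>k. norm (\<integral>\<omega>. (D k \<omega>)\<^sup>2 \<partial>M) \<le> 4 * v k) sequentially"
      using \<gamma>
    proof eventually_elim
      case (elim k)
      have "(\<integral>\<omega>. (D k \<omega>)\<^sup>2 \<partial>M) = (\<integral>x. (inverse (\<gamma> k) * T k x)\<^sup>2 \<partial>\<mu>)"
        unfolding D_def by (rule integral_\<mu>[symmetric]) measurable
      also have "\<dots> = (inverse (\<gamma> k))\<^sup>2 * (real (Suc k))\<^sup>2 * v k"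
        unfolding v_def by (simp add: power_mult_distrib power_divide del: of_nat_Suc)
      also have "\<dots> \<le> 4 * v k"
      proof (rule mult_right_mono)
        have "0 < real (Suc k) / 2" by simp
        then have "0 < \<gamma> k" using elim by linarith
        then have "inverse (\<gamma> k) * real (Suc k) \<le> 2" using elim by (simp add: field_simps)
        then have "(inverse (\<gamma> k) * real (Suc k))\<^sup>2 \<le> 2\<^sup>2" using \<open>0 < \<gamma> k\<close> by (intro power_mono) auto
        then show "(inverse (\<gamma> k))\<^sup>2 * (real (Suc k))\<^sup>2 \<le> 4" by (simp add: power_mult_distrib)
      qed (simp add: v_def)
      finally show ?case by simp
    qed
  qed
  from AE_summable[OF this] AE_eventually_mark_le[OF int] show ?thesis
  proof eventually_elim
    case (elim \<omega>)
    from elim(2) have "eventually (\<lambda>k. D k \<omega> = inverse (\<gamma> k) * \<psi> k \<omega>) sequentially"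
      by eventually_elim (simp add: D_def T_def)
    from summable_cong[OF this] elim(1) show ?case by simp
  qed
qed

text \<open>Almost every arrival sequence grows fast enough for the deterministic weights of the
  preceding lemma; independence of marks and arrivals combines the two exceptional sets.\<close>

lemma AE_summable_series:
  assumes int: "integrable \<mu> (\<lambda>x. x)" and sym: "distr \<mu> borel uminus = \<mu>"
  shows "AE \<omega> in M. summable (\<lambda>k. inverse (arrival \<zeta> k \<omega>) * \<psi> k \<omega>)"
proof -
  \<comment> \<open>Summability is phrased through the Cauchy criterion, which is a measurable
    condition on the pair of sequences.\<close>
  define P :: "(nat \<Rightarrow> real) \<times> (nat \<Rightarrow> real) \<Rightarrow> bool" where
    "P z \<longleftrightarrow> Cauchy (\<lambda>n. \<Sum>k<n. inverse (snd z k) * fst z k)" for z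
  have P: "P (x, g) \<longleftrightarrow> summable (\<lambda>k. inverse (g k) * x k)" for x g
    unfolding P_def by (simp add: summable_iff_convergent Cauchy_convergent_iff)
  have [measurable]: "Measurable.pred ((\<Pi>\<^sub>M k\<in>UNIV. borel) \<Otimes>\<^sub>M (\<Pi>\<^sub>M k\<in>UNIV. borel)) P"
    unfolding P_def pred_def by (rule sets_Collect_Cauchy) measurable
  have "AE \<omega> in M. P ((\<lambda>k. \<psi> k \<omega>), (\<lambda>k. arrival \<zeta> k \<omega>))"
  proof (rule indep_var_AE[OF indep_\<psi>_arrival])
    show "AE \<omega>' in M. AE \<omega> in M. P (\<lambda>k. \<psi> k \<omega>, \<lambda>k. arrival \<zeta> k \<omega>')"
      unfolding P using AE_arrival_ge by eventually_elim (rule AE_summable_deterministic[OF int sym])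
  qed measurable
  then show ?thesis by (simp add: P)
qed

text \<open>The common pattern of both functionals: \<open>f\<close> is the factor contributed by
  one marked arrival and \<open>h\<close> its mean over the mark. With \<open>h = 1\<close> on
  nonpositive \<open>s\<close>, the integral of \<open>1 - h\<close> over the line is the one over
  the half-line in \<open>H 0\<close>. Stating it as a nonnegative integral with value
  \<open>K\<close> also yields integrability.\<close>

lemma expectation_prod_marks_lim:
  fixes f :: "real \<Rightarrow> real \<Rightarrow> 'b :: {real_normed_field, banach, second_countable_topology}"
  assumes f: "case_prod f \<in> borel_measurable (borel \<Otimes>\<^sub>M borel)" and f_le: "\<And>x s. norm (f x s) \<le> 1"
    and fh: "\<And>s. (\<integral>x. f x s \<partial>\<mu>) = of_real (h s)" and h [measurable]: "h \<in> borel_measurable borel"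
    and h_neg: "\<And>s. s \<le> 0 \<Longrightarrow> h s = 1"
    and K: "(\<integral>\<^sup>+s. ennreal (1 - h s) \<partial>lborel) = ennreal K" "0 \<le> K"
  shows "(\<lambda>n. \<integral>\<omega>. (\<Prod>k<n. f (\<psi> k \<omega>) (arrival \<zeta> k \<omega>)) \<partial>M) \<longlonglongrightarrow> of_real (exp (- K))"
proof -
  have h_le: "\<bar>h s\<bar> \<le> 1" for s
  proof -
    have [measurable]: "(\<lambda>x. f x s) \<in> borel_measurable borel" using f by measurable
    have "norm (of_real (h s) :: 'b) \<le> (\<integral>x. norm (f x s) \<partial>\<mu>)"
      unfolding fh[symmetric] by (rule integral_norm_bound)
    also have "\<dots> \<le> (\<integral>x. 1 \<partial>\<mu>)"
      using f_le by (intro integral_mono \<mu>.integrable_const_bound[of _ 1]) auto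
    finally show ?thesis by (simp add: \<mu>.prob_space)
  qed
  have h_nonneg: "0 \<le> 1 - h s" for s using h_le[of s] by simp
  interpret thinned_arrivals M \<zeta> h
  proof
    show "integrable lborel (\<lambda>s. 1 - h s)"
      using h_nonneg K by (intro integrableI_nonneg) auto
  qed (fact h h_le)+
  have "(\<lambda>s. indicator {0<..} s * (1 - h s)) = (\<lambda>s. 1 - h s)"
    by (auto simp: fun_eq_iff h_neg split: split_indicator)
  then have "H 0 = exp (- (\<integral>s. 1 - h s \<partial>lborel))" unfolding H_0 by presburger
  also have "(\<integral>s. 1 - h s \<partial>lborel) = K"
    using K h_nonneg by (subst integral_eq_nn_integral) auto
  finally have H0: "H 0 = exp (- K)" .
  have "(\<integral>\<omega>. (\<Prod>k<n. f (\<psi> k \<omega>) (arrival \<zeta> k \<omega>)) \<partial>M) = of_real (\<integral>\<omega>. (\<Prod>k<n. h (arrival \<zeta> k \<omega>)) \<partial>M)" for n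
    unfolding expectation_prod_marks[OF f f_le] fh of_real_prod[symmetric]
    by (rule integral_of_real, rule integrable_const_bound[of _ 1]) (auto simp: prod_h_le)
  then show ?thesis using tendsto_of_real[OF expectation_prod_lim, where 'a='b] by (simp add: H0)
qed

text \<open>The sine is odd, so symmetry removes the imaginary part and the mean factor is a real
  \<open>h\<close>. Fubini and the rescaled cosine integral give the exponent. Partial sums may be
  replaced by the series because it converges almost surely and \<open>iexp\<close> has modulus
  1.\<close>

theorem char_series:
  assumes int: "integrable \<mu> (\<lambda>x. x)" and sym: "distr \<mu> borel uminus = \<mu>"
  shows "(\<integral>\<omega>. iexp (\<Sum>k. inverse (arrival \<zeta> k \<omega>) * \<psi> k \<omega>) \<partial>M) = of_real (exp (- cos_const * (\<integral>x. \<bar>x\<bar> \<partial>\<mu>)))"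
proof -
  \<comment> \<open>The extension by 0 makes \<open>h\<close> equal to 1 at nonpositive
    \<open>s\<close>; the arrivals, being almost surely positive, only meet the branch
    \<open>inverse s\<close>.\<close>
  define r where "r s = (if 0 < s then inverse s else 0)" for s :: real
  have r_meas [measurable]: "r \<in> borel_measurable borel" unfolding r_def[abs_def] by measurable
  define f where "f x s = iexp (x * r s)" for x s
  define h where "h s = (\<integral>x. cos (x * r s) \<partial>\<mu>)" for s
  have f_meas: "case_prod f \<in> borel_measurable (borel \<Otimes>\<^sub>M borel)" unfolding f_def by measurable
  have f_le: "norm (f x s) \<le> 1" for x s by (simp add: f_def)
  have fh: "(\<integral>x. f x s \<partial>\<mu>) = of_real (h s)" for s
  proof -
    have i: "integrable \<mu> (\<lambda>x. cos (x * r s))" "integrable \<mu> (\<lambda>x. sin (x * r s))"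
      by (rule \<mu>.integrable_const_bound[of _ 1]; auto)+
    have "(\<integral>x. sin (x * r s) \<partial>\<mu>) = (\<integral>x. sin (x * r s) \<partial>distr \<mu> borel uminus)" using sym by simp
    also have "\<dots> = (\<integral>x. sin (- x * r s) \<partial>\<mu>)" by (rule integral_distr) auto
    also have "\<dots> = - (\<integral>x. sin (x * r s) \<partial>\<mu>)" by simp
    finally have s0: "(\<integral>x. sin (x * r s) \<partial>\<mu>) = 0" by simp
    have "(\<integral>x. f x s \<partial>\<mu>) = (\<integral>x. complex_of_real (cos (x * r s)) + \<i> * complex_of_real (sin (x * r s)) \<partial>\<mu>)"
    proof (intro Bochner_Integration.integral_cong refl)
      show "f x s = complex_of_real (cos (x * r s)) + \<i> * complex_of_real (sin (x * r s))" for x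
        unfolding f_def cis_conv_exp[symmetric] by (simp add: complex_eq_iff)
    qed
    also have "\<dots> = of_real (h s) + \<i> * of_real (\<integral>x. sin (x * r s) \<partial>\<mu>)"
      unfolding h_def using i by (subst Bochner_Integration.integral_add) auto
    finally show ?thesis using s0 by simp
  qed
  have nn: "(\<integral>\<^sup>+s. ennreal (1 - h s) \<partial>lborel) = ennreal (cos_const * (\<integral>x. \<bar>x\<bar> \<partial>\<mu>))"
  proof -
    interpret P: pair_sigma_finite "lborel :: real measure" \<mu> ..
    have "ennreal (1 - h s) = (\<integral>\<^sup>+x. ennreal (1 - cos (x * r s)) \<partial>\<mu>)" for s
    proof -
      have "integrable \<mu> (\<lambda>x. cos (x * r s))" by (rule \<mu>.integrable_const_bound[of _ 1]) auto
      then show ?thesis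
        unfolding h_def by (subst nn_integral_eq_integral) (auto simp: \<mu>.prob_space)
    qed
    then have "(\<integral>\<^sup>+s. ennreal (1 - h s) \<partial>lborel) = (\<integral>\<^sup>+s. (\<integral>\<^sup>+x. ennreal (1 - cos (x * r s)) \<partial>\<mu>) \<partial>lborel)" by simp
    also have "\<dots> = (\<integral>\<^sup>+x. (\<integral>\<^sup>+s. ennreal (1 - cos (x * r s)) \<partial>lborel) \<partial>\<mu>)"
      by (rule P.Fubini'[symmetric]) measurable
    also have "\<dots> = (\<integral>\<^sup>+x. ennreal (cos_const * \<bar>x\<bar>) \<partial>\<mu>)"
      unfolding r_def nn_integral_one_minus_cos ..
    also have "\<dots> = ennreal (cos_const * (\<integral>x. \<bar>x\<bar> \<partial>\<mu>))"
      using int cos_const_pos by (subst nn_integral_eq_integral) auto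
    finally show ?thesis .
  qed
  have h_meas: "h \<in> borel_measurable borel" unfolding h_def[abs_def] by measurable
  have partial: "(\<integral>\<omega>. (\<Prod>k<n. f (\<psi> k \<omega>) (arrival \<zeta> k \<omega>)) \<partial>M) = (\<integral>\<omega>. iexp (\<Sum>k<n. inverse (arrival \<zeta> k \<omega>) * \<psi> k \<omega>) \<partial>M)" for n
  proof (rule Bochner_Integration.integral_cong_AE)
    show "(\<lambda>\<omega>. \<Prod>k<n. f (\<psi> k \<omega>) (arrival \<zeta> k \<omega>)) \<in> borel_measurable M"
      unfolding f_def by measurable
    show "AE \<omega> in M. (\<Prod>k<n. f (\<psi> k \<omega>) (arrival \<zeta> k \<omega>)) = iexp (\<Sum>k<n. inverse (arrival \<zeta> k \<omega>) * \<psi> k \<omega>)"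
      using AE_arrival_pos
      by eventually_elim (auto simp: f_def r_def exp_sum sum_distrib_left mult.commute)
  qed measurable
  have "(\<lambda>n. \<integral>\<omega>. iexp (\<Sum>k<n. inverse (arrival \<zeta> k \<omega>) * \<psi> k \<omega>) \<partial>M) \<longlonglongrightarrow>
    (\<integral>\<omega>. iexp (\<Sum>k. inverse (arrival \<zeta> k \<omega>) * \<psi> k \<omega>) \<partial>M)"
  proof (rule integral_dominated_convergence[where w="\<lambda>_. 1"])
    show "AE \<omega> in M. (\<lambda>n. iexp (\<Sum>k<n. inverse (arrival \<zeta> k \<omega>) * \<psi> k \<omega>)) \<longlonglongrightarrow>
      iexp (\<Sum>k. inverse (arrival \<zeta> k \<omega>) * \<psi> k \<omega>)"
      using AE_summable_series[OF int sym]
    proof eventually_elim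
      case (elim \<omega>)
      show ?case by (intro tendsto_intros summable_LIMSEQ elim)
    qed
  qed auto
  moreover have "(\<lambda>n. \<integral>\<omega>. (\<Prod>k<n. f (\<psi> k \<omega>) (arrival \<zeta> k \<omega>)) \<partial>M) \<longlonglongrightarrow> of_real (exp (- (cos_const * (\<integral>x. \<bar>x\<bar> \<partial>\<mu>))))"
    by (rule expectation_prod_marks_lim[OF f_meas f_le fh h_meas _ nn])
       (use cos_const_pos in \<open>auto simp: h_def r_def \<mu>.prob_space\<close>)
  ultimately show ?thesis unfolding partial using LIMSEQ_unique by fastforce
qed

text \<open>The event is an infinite product of indicators. For a mark \<open>x\<close>, the
  complementary indicator is that of \<open>0 < s < x\<close>, of Lebesgue measure
  \<open>max 0 x\<close>.\<close>

theorem prob_marks_le_arrivals: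
  assumes int: "integrable \<mu> (\<lambda>x. x)"
  shows "prob {\<omega> \<in> space M. \<forall>k. \<psi> k \<omega> \<le> arrival \<zeta> k \<omega>} = exp (- (\<integral>x. max 0 x \<partial>\<mu>))"
proof -
  \<comment> \<open>The condition \<open>0 < s\<close> forces the factor 1 on the nonpositive axis,
    as the general limit requires; on positive arrivals \<open>f\<close> is the indicator of
    \<open>x \<le> s\<close>.\<close>
  define f where "f x s = (if 0 < s \<and> s < x then 0 else 1 :: real)" for x s :: real
  define h where "h s = (\<integral>x. f x s \<partial>\<mu>)" for s
  have f_meas [measurable]: "case_prod f \<in> borel_measurable (borel \<Otimes>\<^sub>M borel)" unfolding f_def by measurable
  have f_le: "norm (f x s) \<le> 1" for x s by (simp add: f_def)
  have fi: "integrable \<mu> (\<lambda>x. f x s)" for s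
    by (rule \<mu>.integrable_const_bound[of _ 1]) (auto simp: f_def)
  have nn: "(\<integral>\<^sup>+s. ennreal (1 - h s) \<partial>lborel) = ennreal (\<integral>x. max 0 x \<partial>\<mu>)"
  proof -
    interpret P: pair_sigma_finite "lborel :: real measure" \<mu> ..
    have "ennreal (1 - h s) = (\<integral>\<^sup>+x. ennreal (1 - f x s) \<partial>\<mu>)" for s
      unfolding h_def using fi f_le
      by (subst nn_integral_eq_integral) (auto simp: \<mu>.prob_space f_def)
    then have "(\<integral>\<^sup>+s. ennreal (1 - h s) \<partial>lborel) = (\<integral>\<^sup>+s. (\<integral>\<^sup>+x. ennreal (1 - f x s) \<partial>\<mu>) \<partial>lborel)" by simp
    also have "\<dots> = (\<integral>\<^sup>+x. (\<integral>\<^sup>+s. ennreal (1 - f x s) \<partial>lborel) \<partial>\<mu>)"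
      by (rule P.Fubini'[symmetric]) measurable
    also have "\<dots> = (\<integral>\<^sup>+x. ennreal (max 0 x) \<partial>\<mu>)"
    proof (intro nn_integral_cong)
      fix x :: real
      have "(\<integral>\<^sup>+s. ennreal (1 - f x s) \<partial>lborel) = (\<integral>\<^sup>+s. indicator {0<..<x} s \<partial>lborel)"
        by (intro nn_integral_cong) (auto simp: f_def split: split_indicator)
      then show "(\<integral>\<^sup>+s. ennreal (1 - f x s) \<partial>lborel) = ennreal (max 0 x)"
        by (cases "0 \<le> x") (auto simp: max_def)
    qed
    also have "\<dots> = ennreal (\<integral>x. max 0 x \<partial>\<mu>)"
      using int by (subst nn_integral_eq_integral) auto
    finally show ?thesis .
  qed
  have h_meas: "h \<in> borel_measurable borel" unfolding h_def[abs_def] by measurable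
  define A where "A = {\<omega> \<in> space M. \<forall>k. \<psi> k \<omega> \<le> arrival \<zeta> k \<omega>}"
  have [measurable]: "A \<in> sets M" unfolding A_def by measurable
  have "(\<lambda>n. \<integral>\<omega>. (\<Prod>k<n. f (\<psi> k \<omega>) (arrival \<zeta> k \<omega>)) \<partial>M) \<longlonglongrightarrow> (\<integral>\<omega>. indicator A \<omega> \<partial>M)"
  proof (rule integral_dominated_convergence[where w="\<lambda>_. 1"])
    show "AE \<omega> in M. (\<lambda>n. \<Prod>k<n. f (\<psi> k \<omega>) (arrival \<zeta> k \<omega>)) \<longlonglongrightarrow> indicator A \<omega>"
    proof (use AE_arrival_pos in \<open>rule AE_mp\<close>, intro AE_I2 impI tendsto_eventually)
      fix \<omega> assume \<omega>: "\<omega> \<in> space M" and pos: "\<forall>k. 0 < arrival \<zeta> k \<omega>"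
      show "\<forall>\<^sub>F n in sequentially. (\<Prod>k<n. f (\<psi> k \<omega>) (arrival \<zeta> k \<omega>)) = indicator A \<omega>"
      proof (cases "\<omega> \<in> A")
        case True
        then show ?thesis by (intro always_eventually allI) (auto simp: A_def f_def not_less intro!: prod.neutral)
      next
        case False
        then obtain k where "arrival \<zeta> k \<omega> < \<psi> k \<omega>" using \<omega> by (auto simp: A_def not_le)
        then have "f (\<psi> k \<omega>) (arrival \<zeta> k \<omega>) = 0" using pos by (simp add: f_def)
        then have "(\<Prod>k<n. f (\<psi> k \<omega>) (arrival \<zeta> k \<omega>)) = 0" if "k < n" for n
          using that by (intro prod_zero) (auto intro!: bexI[of _ k])
        then show ?thesis using False eventually_mono[OF eventually_gt_at_top[of k]] by simp
      qed
    qed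
    show "AE \<omega> in M. norm (\<Prod>k<n. f (\<psi> k \<omega>) (arrival \<zeta> k \<omega>)) \<le> 1" for n
      unfolding prod_norm[symmetric] using f_le by (intro AE_I2 prod_le_1) auto
  qed (auto simp: f_def)
  moreover have "(\<lambda>n. \<integral>\<omega>. (\<Prod>k<n. f (\<psi> k \<omega>) (arrival \<zeta> k \<omega>)) \<partial>M) \<longlonglongrightarrow> (of_real (exp (- (\<integral>x. max 0 x \<partial>\<mu>))) :: real)"
    by (rule expectation_prod_marks_lim[OF f_meas f_le _ h_meas _ nn])
       (auto simp: h_def f_def \<mu>.prob_space)
  ultimately have "(\<integral>\<omega>. indicator A \<omega> \<partial>M) = (of_real (exp (- (\<integral>x. max 0 x \<partial>\<mu>))) :: real)" by (rule LIMSEQ_unique)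
  then show ?thesis unfolding A_def by simp
qed

end

section \<open>Uniqueness of joint distributions\<close>

lemma finite_measure_density:
  fixes g :: "'a \<Rightarrow> real"
  assumes g: "integrable M g" and nonneg: "AE x in M. 0 \<le> g x"
  shows "finite_measure (density M (\<lambda>x. ennreal (g x)))"
proof (rule finite_measureI)
  have [measurable]: "g \<in> borel_measurable M" using g by simp
  have "emeasure (density M (\<lambda>x. ennreal (g x))) (space M) = (\<integral>\<^sup>+x. ennreal (g x) * indicator (space M) x \<partial>M)"
    by (rule emeasure_density) auto
  also have "\<dots> = (\<integral>\<^sup>+x. ennreal (g x) \<partial>M)" by (intro nn_integral_cong) auto
  also have "\<dots> = ennreal (\<integral>x. g x \<partial>M)" by (rule nn_integral_eq_integral[OF g nonneg])
  finally show "emeasure (density M (\<lambda>x. ennreal (g x))) (space (density M (\<lambda>x. ennreal (g x)))) \<noteq> \<infinity>" by simp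
qed

lemma measure_density_real:
  fixes g :: "'a \<Rightarrow> real"
  assumes g: "integrable M g" and nonneg: "AE x in M. 0 \<le> g x" and A: "A \<in> sets M"
  shows "measure (density M (\<lambda>x. ennreal (g x))) A = (\<integral>x. g x * indicator A x \<partial>M)"
proof -
  have [measurable]: "g \<in> borel_measurable M" using g by simp
  have "measure (density M (\<lambda>x. ennreal (g x))) A = (\<integral>x. indicator A x \<partial>density M (\<lambda>x. ennreal (g x)))"
    using A by (simp add: sets.sets_into_space Int_absorb2)
  also have "\<dots> = (\<integral>x. g x *\<^sub>R indicator A x \<partial>M)"
    using A nonneg by (intro integral_density) auto
  finally show ?thesis by simp
qed

lemma measure_distr_density:
  fixes g :: "'a \<Rightarrow> real"
  assumes g: "integrable M g" "AE x in M. 0 \<le> g x" and V [measurable]: "V \<in> borel_measurable M" "B \<in> sets borel"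
  shows "measure (distr (density M (\<lambda>x. ennreal (g x))) borel V) B = (\<integral>x. g x * indicator B (V x) \<partial>M)"
proof -
  have "measure (distr (density M (\<lambda>x. ennreal (g x))) borel V) B = (\<integral>x. g x * indicator (V -` B \<inter> space M) x \<partial>M)"
    using g by (subst measure_distr) (auto simp: measure_density_real)
  also have "\<dots> = (\<integral>x. g x * indicator B (V x) \<partial>M)"
    by (intro Bochner_Integration.integral_cong) (auto split: split_indicator)
  finally show ?thesis .
qed

text \<open>The value at \<open>t = 0\<close> is the total mass. A null measure is treated apart;
  otherwise division by the common mass reduces to probability laws.\<close>

lemma finite_Levy_uniqueness:
  fixes M1 M2 :: "real measure"
  assumes fin: "finite_measure M1" "finite_measure M2"
    and sets [simp]: "sets M1 = sets borel" "sets M2 = sets borel"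
    and eq: "\<And>t. (\<integral>x. iexp (t * x) \<partial>M1) = (\<integral>x. iexp (t * x) \<partial>M2)"
  shows "M1 = M2"
proof -
  interpret M1: finite_measure M1 by fact
  interpret M2: finite_measure M2 by fact
  have sp: "space M1 = UNIV" "space M2 = UNIV" using sets by (metis sets_eq_imp_space_eq space_borel)+
  define m where "m = measure M1 UNIV"
  have "complex_of_real (measure M1 UNIV) = complex_of_real (measure M2 UNIV)"
    using eq[of 0] by (simp add: sp scaleR_conv_of_real)
  then have m: "measure M1 UNIV = m" "measure M2 UNIV = m" by (simp_all add: m_def)
  show ?thesis
  proof (cases "m = 0")
    case True
    have "emeasure M1 A = 0" "emeasure M2 A = 0" for A
      using True m M1.bounded_measure[of A] M2.bounded_measure[of A] measure_nonneg[of M1 A] measure_nonneg[of M2 A]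
      by (auto simp: sp M1.emeasure_eq_measure M2.emeasure_eq_measure)
    then show ?thesis by (intro measure_eqI) auto
  next
    case False
    then have mpos: "0 < m" by (simp add: m_def zero_less_measure_iff)
    have rd: "real_distribution (density M (\<lambda>_. ennreal (1 / m)))"
      if s: "sets M = sets (borel :: real measure)" and f: "finite_measure M" and mm: "measure M UNIV = m" for M
    proof -
      interpret finite_measure M by fact
      have sp: "space M = UNIV" using s by (metis sets_eq_imp_space_eq space_borel)
      have "emeasure (density M (\<lambda>_. ennreal (1 / m))) UNIV = 1"
        using mpos s by (subst emeasure_density_const) (auto simp: emeasure_eq_measure mm ennreal_mult[symmetric])
      then have "prob_space (density M (\<lambda>_. ennreal (1 / m)))" by (intro prob_spaceI) (simp add: sp)
      then show ?thesis unfolding real_distribution_def real_distribution_axioms_def using s by (simp add: sp)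
    qed
    have ch: "char (density M (\<lambda>_. ennreal (1 / m))) t = (1 / m) *\<^sub>R (\<integral>x. iexp (t * x) \<partial>M)"
      if [measurable_cong]: "sets M = sets (borel :: real measure)" for M t
      unfolding char_def
      using mpos by (subst integral_density) auto
    have "density M1 (\<lambda>_. ennreal (1 / m)) = density M2 (\<lambda>_. ennreal (1 / m))"
    proof (rule Levy_uniqueness)
      show "char (density M1 (\<lambda>_. ennreal (1 / m))) = char (density M2 (\<lambda>_. ennreal (1 / m)))"
        by (rule ext) (simp only: ch[OF sets(1)] ch[OF sets(2)] eq)
    qed (rule rd[OF sets(1) fin(1) m(1)] rd[OF sets(2) fin(2) m(2)])+
    then have scaled: "ennreal (1 / m) * emeasure M1 A = ennreal (1 / m) * emeasure M2 A" if "A \<in> sets borel" for A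
      using that emeasure_density_const[of A M1 "ennreal (1 / m)"] emeasure_density_const[of A M2 "ennreal (1 / m)"] by simp
    have "measure M1 A = measure M2 A" if "A \<in> sets borel" for A
    proof -
      have "emeasure M1 A = emeasure M2 A"
        using scaled[OF that] mpos by (simp add: ennreal_mult_cancel_left ennreal_eq_0_iff)
      then show ?thesis by (simp add: measure_def)
    qed
    then show ?thesis
      by (intro measure_eqI) (auto simp: M1.emeasure_eq_measure M2.emeasure_eq_measure)
  qed
qed

lemma integral_indicator_density:
  fixes f :: "'c \<Rightarrow> 'd :: {banach, second_countable_topology}"
  assumes [measurable]: "V \<in> borel_measurable N" "f \<in> borel_measurable N" "B \<in> sets borel"
  shows "(\<integral>x. f x \<partial>density N (\<lambda>x. ennreal (indicator B (V x)))) = (\<integral>x. indicator B (V x) *\<^sub>R f x \<partial>N)"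
  by (subst integral_density) auto

text \<open>Euler's formulas arranged so that the right-hand sides contain only exponentials at
  \<open>a\<close>, \<open>a + w\<close> and \<open>a - w\<close>, whose integrals are values of a
  joint characteristic function. The left-hand weights are real and nonnegative, hence
  densities.\<close>

lemma iexp_cos: "(1 + cos w) *\<^sub>R iexp a = iexp a + (iexp (a + w) + iexp (a + (- w))) / 2"
  and iexp_sin: "(1 + sin w) *\<^sub>R iexp a = iexp a - \<i> * (iexp (a + w) - iexp (a + (- w))) / 2"
  unfolding cis_conv_exp[symmetric] by (simp_all add: complex_eq_iff cos_add sin_add cos_diff sin_diff field_simps)

locale two_finite = \<mu>: finite_measure \<mu> + \<nu>: finite_measure \<nu>
  for \<mu> :: "'a measure" and \<nu> :: "'b measure"
begin

text \<open>The integrals in \<open>eq\<close> are the characteristic functions of the images under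
  \<open>V\<close> and \<open>V'\<close> of the measures with densities \<open>g\<close> and
  \<open>g'\<close>. Boundedness of the weights keeps these measures finite.\<close>

lemma weighted_uniqueness:
  assumes [measurable]: "V \<in> borel_measurable \<mu>" "V' \<in> borel_measurable \<nu>" "g \<in> borel_measurable \<mu>" "g' \<in> borel_measurable \<nu>"
    and g: "\<And>x. 0 \<le> g x" "\<And>x. g x \<le> C" and g': "\<And>x. 0 \<le> g' x" "\<And>x. g' x \<le> (C :: real)"
    and eq: "\<And>s. (\<integral>x. g x *\<^sub>R iexp (s * V x) \<partial>\<mu>) = (\<integral>x. g' x *\<^sub>R iexp (s * V' x) \<partial>\<nu>)"
    and B [measurable]: "B \<in> sets borel"
  shows "(\<integral>x. g x * indicator B (V x) \<partial>\<mu>) = (\<integral>x. g' x * indicator B (V' x) \<partial>\<nu>)"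
proof -
  define \<alpha> where "\<alpha> = distr (density \<mu> (\<lambda>x. ennreal (g x))) borel V"
  define \<beta> where "\<beta> = distr (density \<nu> (\<lambda>x. ennreal (g' x))) borel V'"
  have gi: "integrable \<mu> g" "integrable \<nu> g'"
    using g g' by (auto intro!: \<mu>.integrable_const_bound[of _ C] \<nu>.integrable_const_bound[of _ C])
  have "\<alpha> = \<beta>"
  proof (rule finite_Levy_uniqueness)
    show "finite_measure \<alpha>" unfolding \<alpha>_def using gi g
      by (intro finite_measure.finite_measure_distr finite_measure_density) auto
    show "finite_measure \<beta>" unfolding \<beta>_def using gi g'
      by (intro finite_measure.finite_measure_distr finite_measure_density) auto
    show "(\<integral>x. iexp (t * x) \<partial>\<alpha>) = (\<integral>x. iexp (t * x) \<partial>\<beta>)" for t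
      unfolding \<alpha>_def \<beta>_def using g g' eq[of t]
      by (subst (1 2) integral_distr) (auto simp: integral_density)
  qed (simp_all add: \<alpha>_def \<beta>_def)
  have "measure \<alpha> B = (\<integral>x. g x * indicator B (V x) \<partial>\<mu>)" "measure \<beta> B = (\<integral>x. g' x * indicator B (V' x) \<partial>\<nu>)"
    unfolding \<alpha>_def \<beta>_def using gi g g' by (auto intro!: measure_distr_density)
  then show ?thesis using \<open>\<alpha> = \<beta>\<close> by simp
qed

lemma iexp_int:
  assumes [measurable]: "V \<in> borel_measurable \<mu>" shows "integrable \<mu> (\<lambda>x. iexp (V x))"
  by (rule \<mu>.integrable_const_bound[of _ 1]) auto

lemma iexp_int':
  assumes [measurable]: "V \<in> borel_measurable \<nu>" shows "integrable \<nu> (\<lambda>x. iexp (V x))"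
  by (rule \<nu>.integrable_const_bound[of _ 1]) auto

text \<open>Complex weights are avoided by weighting with \<open>1 + cos W\<close> and \<open>1 + sin W\<close>.\<close>

lemma twisted_uniqueness:
  assumes [measurable]: "V \<in> borel_measurable \<mu>" "V' \<in> borel_measurable \<nu>" "W \<in> borel_measurable \<mu>" "W' \<in> borel_measurable \<nu>"
    and eq: "\<And>s t. (\<integral>x. iexp (s * V x + t * W x) \<partial>\<mu>) = (\<integral>x. iexp (s * V' x + t * W' x) \<partial>\<nu>)"
    and B [measurable]: "B \<in> sets borel"
  shows "(\<integral>x. indicator B (V x) *\<^sub>R iexp (W x) \<partial>\<mu>) = (\<integral>x. indicator B (V' x) *\<^sub>R iexp (W' x) \<partial>\<nu>)"
proof -
  \<comment> \<open>The arguments 0, 1 and -1 of \<open>W\<close> are those that arise from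
    expanding the cosine and sine weights.\<close>
  note eq0 = eq[of _ 0, unfolded mult_zero_left add_0_right]
    and eq1 = eq[of _ 1, unfolded mult_1] and eq2 = eq[of _ "- 1", unfolded mult_minus1]
  have lin: "(\<integral>x. F x + (F1 x + F2 x) / 2 \<partial>N) = integral\<^sup>L N F + (integral\<^sup>L N F1 + integral\<^sup>L N F2) / 2"
    "(\<integral>x. F x - \<i> * (F1 x - F2 x) / 2 \<partial>N) = integral\<^sup>L N F - \<i> * (integral\<^sup>L N F1 - integral\<^sup>L N F2) / 2"
    if "integrable N F" "integrable N F1" "integrable N F2" for N :: "'c measure" and F F1 F2 :: "'c \<Rightarrow> complex"
    using that by simp_all
  have m: "(\<lambda>x. s * V x) \<in> borel_measurable \<mu>" "(\<lambda>x. s * V x + W x) \<in> borel_measurable \<mu>"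
    "(\<lambda>x. s * V x + - W x) \<in> borel_measurable \<mu>" "(\<lambda>x. s * V' x) \<in> borel_measurable \<nu>"
    "(\<lambda>x. s * V' x + W' x) \<in> borel_measurable \<nu>" "(\<lambda>x. s * V' x + - W' x) \<in> borel_measurable \<nu>" for s
    by measurable
  note lin_\<mu> = lin[OF iexp_int[OF m(1)] iexp_int[OF m(2)] iexp_int[OF m(3)]]
    and lin_\<nu> = lin[OF iexp_int'[OF m(4)] iexp_int'[OF m(5)] iexp_int'[OF m(6)]]
  have 1: "(\<integral>x. 1 * indicator B (V x) \<partial>\<mu>) = (\<integral>x. (1 :: real) * indicator B (V' x) \<partial>\<nu>)"
    by (rule weighted_uniqueness[where C=1]) (use eq0 in auto)
  have c: "(\<integral>x. (1 + cos (W x)) * indicator B (V x) \<partial>\<mu>) = (\<integral>x. (1 + cos (W' x)) * indicator B (V' x) \<partial>\<nu>)"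
  proof (rule weighted_uniqueness[where C=2])
    show "(\<integral>x. (1 + cos (W x)) *\<^sub>R iexp (s * V x) \<partial>\<mu>) = (\<integral>x. (1 + cos (W' x)) *\<^sub>R iexp (s * V' x) \<partial>\<nu>)" for s
      unfolding iexp_cos lin_\<mu>(1) lin_\<nu>(1) eq0 eq1 eq2 ..
    show "0 \<le> 1 + cos (W x)" "0 \<le> 1 + cos (W' y)" for x y
      using cos_ge_minus_one[of "W x"] cos_ge_minus_one[of "W' y"] by linarith+
  qed auto
  have s: "(\<integral>x. (1 + sin (W x)) * indicator B (V x) \<partial>\<mu>) = (\<integral>x. (1 + sin (W' x)) * indicator B (V' x) \<partial>\<nu>)"
  proof (rule weighted_uniqueness[where C=2])
    show "(\<integral>x. (1 + sin (W x)) *\<^sub>R iexp (s * V x) \<partial>\<mu>) = (\<integral>x. (1 + sin (W' x)) *\<^sub>R iexp (s * V' x) \<partial>\<nu>)" for s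
      unfolding iexp_sin lin_\<mu>(2) lin_\<nu>(2) eq0 eq1 eq2 ..
    show "0 \<le> 1 + sin (W x)" "0 \<le> 1 + sin (W' y)" for x y
      using sin_ge_minus_one[of "W x"] sin_ge_minus_one[of "W' y"] by linarith+
  qed auto
  have i\<mu>: "integrable \<mu> (\<lambda>x. indicator B (V x) :: real)" "integrable \<mu> (\<lambda>x. cos (W x) * indicator B (V x))"
    "integrable \<mu> (\<lambda>x. sin (W x) * indicator B (V x))"
    by (rule \<mu>.integrable_const_bound[of _ 1]; auto simp: abs_mult mult_le_one split: split_indicator)+
  have i\<nu>: "integrable \<nu> (\<lambda>x. indicator B (V' x) :: real)" "integrable \<nu> (\<lambda>x. cos (W' x) * indicator B (V' x))"
    "integrable \<nu> (\<lambda>x. sin (W' x) * indicator B (V' x))"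
    by (rule \<nu>.integrable_const_bound[of _ 1]; auto simp: abs_mult mult_le_one split: split_indicator)+
  have cc: "(\<integral>x. cos (W x) * indicator B (V x) \<partial>\<mu>) = (\<integral>x. cos (W' x) * indicator B (V' x) \<partial>\<nu>)"
    using c 1 i\<mu> i\<nu> by (simp add: distrib_right)
  have ss: "(\<integral>x. sin (W x) * indicator B (V x) \<partial>\<mu>) = (\<integral>x. sin (W' x) * indicator B (V' x) \<partial>\<nu>)"
    using s 1 i\<mu> i\<nu> by (simp add: distrib_right)
  have euler: "indicator b v *\<^sub>R iexp w = complex_of_real (cos w * indicator b v) + \<i> * complex_of_real (sin w * indicator b v)"
    for b and v w :: real
    unfolding cis_conv_exp[symmetric] by (simp add: complex_eq_iff)
  have clin: "(\<integral>x. complex_of_real (F x) + \<i> * complex_of_real (F1 x) \<partial>N)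
      = complex_of_real (integral\<^sup>L N F) + \<i> * complex_of_real (integral\<^sup>L N F1)"
    if "integrable N F" "integrable N F1" for N :: "'c measure" and F F1
    using that by simp
  show ?thesis
    unfolding euler clin[OF i\<mu>(2,3)] clin[OF i\<nu>(2,3)] cc ss ..
qed

end

lemma measure_indicator_density:
  assumes "finite_measure N" and [measurable]: "V \<in> borel_measurable N" "B \<in> sets borel" "A \<in> sets N"
  shows "measure (density N (\<lambda>x. ennreal (indicator B (V x)))) A = measure N {x \<in> A. V x \<in> B}"
proof -
  interpret finite_measure N by fact
  have "measure (density N (\<lambda>x. ennreal (indicator B (V x)))) A = (\<integral>x. indicator B (V x) * indicator A x \<partial>N)"
    by (intro measure_density_real integrable_const_bound[of _ 1]) auto
  also have "\<dots> = (\<integral>x. indicator {x \<in> A. V x \<in> B} x \<partial>N)"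
    by (intro Bochner_Integration.integral_cong) (auto split: split_indicator)
  also have "\<dots> = measure N {x \<in> A. V x \<in> B}"
    using sets.sets_into_space[OF \<open>A \<in> sets N\<close>] by (auto intro!: arg_cong[of _ _ "measure N"])
  finally show ?thesis .
qed

lemma measure_distr_indicator_density:
  assumes "finite_measure N" and A [measurable]: "A \<in> sets N" and V [measurable]: "V \<in> borel_measurable N" "C \<in> sets borel"
  shows "measure (distr (density N (\<lambda>x. ennreal (indicator A x))) borel V) C = measure N {x \<in> A. V x \<in> C}"
proof -
  interpret finite_measure N by fact
  have "measure (distr (density N (\<lambda>x. ennreal (indicator A x))) borel V) C = (\<integral>x. indicator A x * indicator C (V x) \<partial>N)"
    by (intro measure_distr_density integrable_const_bound[of _ 1]) auto
  also have "\<dots> = (\<integral>x. indicator {x \<in> A. V x \<in> C} x \<partial>N)"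
    by (intro Bochner_Integration.integral_cong) (auto split: split_indicator)
  finally show ?thesis
    using sets.sets_into_space[OF A] by (simp add: Int_absorb2 subset_eq)
qed

text \<open>One step of the inductions over coordinates: restricting to \<open>X j \<in> B j\<close>
  absorbs this coordinate into the measure.\<close>

lemma measure_indicator_density_box:
  assumes N: "finite_measure N" and I: "finite I" and V [measurable]: "X j \<in> borel_measurable N" "B j \<in> sets borel"
    and X: "\<And>i. i \<in> I \<Longrightarrow> X i \<in> borel_measurable N" "\<And>i. i \<in> I \<Longrightarrow> B i \<in> sets borel"
  defines "N' \<equiv> density N (\<lambda>x. ennreal (indicator (B j) (X j x)))"
  shows "measure N' {x \<in> space N'. \<forall>i\<in>I. X i x \<in> B i} = measure N {x \<in> space N. \<forall>i\<in>insert j I. X i x \<in> B i}"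
proof -
  have [measurable]: "{x \<in> space N. \<forall>i\<in>I. X i x \<in> B i} \<in> sets N"
    using I X by (intro sets.sets_Collect_finite_All) auto
  show ?thesis unfolding N'_def space_density
    by (subst measure_indicator_density[OF N]) (auto intro!: arg_cong[of _ _ "measure N"])
qed

lemma finite_measure_indicator_density:
  assumes "finite_measure N" and [measurable]: "V \<in> borel_measurable N" "B \<in> sets borel"
  shows "finite_measure (density N (\<lambda>x. ennreal (indicator B (V x))))"
  by (intro finite_measure_density finite_measure.integrable_const_bound[OF assms(1), of _ 1]) auto

text \<open>The Cramer-Wold device by induction over the coordinates. Restricting both measures to
  the side \<open>B j\<close> preserves, by \<open>twisted_uniqueness\<close>, the agreement of the
  characteristic functions of the remaining coordinates. The restriction loses mass, which is why
  the induction runs over finite measures.\<close>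

lemma boxes_eq_of_char:
  fixes \<mu> :: "'a measure" and \<nu> :: "'b measure" and X :: "'i \<Rightarrow> 'a \<Rightarrow> real" and Y :: "'i \<Rightarrow> 'b \<Rightarrow> real"
  assumes "finite I" "finite_measure \<mu>" "finite_measure \<nu>"
    and "\<And>i. i \<in> I \<Longrightarrow> X i \<in> borel_measurable \<mu>" "\<And>i. i \<in> I \<Longrightarrow> Y i \<in> borel_measurable \<nu>"
    and "\<And>u. (\<integral>x. iexp (\<Sum>i\<in>I. u i * X i x) \<partial>\<mu>) = (\<integral>x. iexp (\<Sum>i\<in>I. u i * Y i x) \<partial>\<nu>)"
    and "\<And>i. i \<in> I \<Longrightarrow> B i \<in> sets borel"
  shows "measure \<mu> {x \<in> space \<mu>. \<forall>i\<in>I. X i x \<in> B i} = measure \<nu> {x \<in> space \<nu>. \<forall>i\<in>I. Y i x \<in> B i}"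
  using assms
proof (induction I arbitrary: \<mu> \<nu> rule: finite_induct)
  case empty
  interpret two_finite \<mu> \<nu> unfolding two_finite_def using empty by simp
  have "complex_of_real (measure \<mu> (space \<mu>)) = complex_of_real (measure \<nu> (space \<nu>))"
    using empty(5) by (simp add: scaleR_conv_of_real)
  then show ?case by simp
next
  case (insert j I)
  interpret two_finite \<mu> \<nu> unfolding two_finite_def using insert by simp
  have m [measurable]: "X j \<in> borel_measurable \<mu>" "Y j \<in> borel_measurable \<nu>" "B j \<in> sets borel"
    using insert.prems by auto
  have mI [measurable]: "\<And>i. i \<in> I \<Longrightarrow> X i \<in> borel_measurable \<mu>" "\<And>i. i \<in> I \<Longrightarrow> Y i \<in> borel_measurable \<nu>"
     "\<And>i. i \<in> I \<Longrightarrow> B i \<in> sets borel"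
    using insert.prems by auto
  define \<mu>' where "\<mu>' = density \<mu> (\<lambda>x. ennreal (indicator (B j) (X j x)))"
  define \<nu>' where "\<nu>' = density \<nu> (\<lambda>x. ennreal (indicator (B j) (Y j x)))"
  have "measure \<mu>' {x \<in> space \<mu>'. \<forall>i\<in>I. X i x \<in> B i} = measure \<nu>' {x \<in> space \<nu>'. \<forall>i\<in>I. Y i x \<in> B i}"
  proof (rule insert.IH)
    show "finite_measure \<mu>'" "finite_measure \<nu>'"
      unfolding \<mu>'_def \<nu>'_def using insert.prems m by (auto intro!: finite_measure_indicator_density)
    show "X i \<in> borel_measurable \<mu>'" "Y i \<in> borel_measurable \<nu>'" "B i \<in> sets borel" if "i \<in> I" for i
      using that mI by (auto simp: \<mu>'_def \<nu>'_def)
    fix u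
    have sm [measurable]: "(\<lambda>x. \<Sum>i\<in>I. u i * X i x) \<in> borel_measurable \<mu>" "(\<lambda>x. \<Sum>i\<in>I. u i * Y i x) \<in> borel_measurable \<nu>"
      using mI by auto
    have key: "(\<integral>x. iexp (s * X j x + t * (\<Sum>i\<in>I. u i * X i x)) \<partial>\<mu>) = (\<integral>x. iexp (s * Y j x + t * (\<Sum>i\<in>I. u i * Y i x)) \<partial>\<nu>)" for s t
    proof -
      \<comment> \<open>A single coefficient vector that yields \<open>s\<close> times the
        coordinate \<open>j\<close> plus \<open>t\<close> times the given combination of the
        others.\<close>
      define w where "w i = (if i = j then s else t * u i)" for i
      have "(\<Sum>i\<in>insert j I. w i * z i) = s * z j + t * (\<Sum>i\<in>I. u i * z i)" for z :: "'i \<Rightarrow> real"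
      proof -
        have "(\<Sum>i\<in>I. w i * z i) = (\<Sum>i\<in>I. t * (u i * z i))"
          using insert.hyps by (intro sum.cong) (auto simp: w_def)
        then show ?thesis using insert.hyps by (simp add: w_def sum_distrib_left)
      qed
      then show ?thesis using insert.prems(5)[of w] by simp
    qed
    have ie: "(\<lambda>x. iexp (\<Sum>i\<in>I. u i * X i x)) \<in> borel_measurable \<mu>" "(\<lambda>x. iexp (\<Sum>i\<in>I. u i * Y i x)) \<in> borel_measurable \<nu>"
      by measurable
    show "(\<integral>x. iexp (\<Sum>i\<in>I. u i * X i x) \<partial>\<mu>') = (\<integral>x. iexp (\<Sum>i\<in>I. u i * Y i x) \<partial>\<nu>')"
      unfolding \<mu>'_def \<nu>'_def integral_indicator_density[OF m(1) ie(1) m(3)] integral_indicator_density[OF m(2) ie(2) m(3)]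
      by (rule twisted_uniqueness[OF m(1,2) sm key m(3)])
  qed
  moreover have "measure \<mu>' {x \<in> space \<mu>'. \<forall>i\<in>I. X i x \<in> B i} = measure \<mu> {x \<in> space \<mu>. \<forall>i\<in>insert j I. X i x \<in> B i}"
    unfolding \<mu>'_def by (rule measure_indicator_density_box[OF \<mu>.finite_measure_axioms insert.hyps(1), of X j B, OF m(1,3) mI(1,3)])
  moreover have "measure \<nu>' {x \<in> space \<nu>'. \<forall>i\<in>I. Y i x \<in> B i} = measure \<nu> {x \<in> space \<nu>. \<forall>i\<in>insert j I. Y i x \<in> B i}"
    unfolding \<nu>'_def by (rule measure_indicator_density_box[OF \<nu>.finite_measure_axioms insert.hyps(1), of Y j B, OF m(2,3) mI(2,3)])
  ultimately show ?case by simp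
qed

text \<open>The same induction with distribution functions. For fixed bounds on the other
  coordinates, the law of \<open>X j\<close> on that event has its distribution function prescribed
  by the hypothesis, so it is determined and the half-line for \<open>j\<close> may be replaced by
  \<open>B j\<close>.\<close>

lemma boxes_eq_of_cdf:
  fixes \<mu> :: "'a measure" and \<nu> :: "'b measure" and X :: "'i \<Rightarrow> 'a \<Rightarrow> real" and Y :: "'i \<Rightarrow> 'b \<Rightarrow> real"
  assumes "finite I" "finite_measure \<mu>" "finite_measure \<nu>"
    and "\<And>i. i \<in> I \<Longrightarrow> X i \<in> borel_measurable \<mu>" "\<And>i. i \<in> I \<Longrightarrow> Y i \<in> borel_measurable \<nu>"
    and "\<And>y. measure \<mu> {x \<in> space \<mu>. \<forall>i\<in>I. X i x \<le> y i} = measure \<nu> {x \<in> space \<nu>. \<forall>i\<in>I. Y i x \<le> y i}"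
    and "\<And>i. i \<in> I \<Longrightarrow> B i \<in> sets borel"
  shows "measure \<mu> {x \<in> space \<mu>. \<forall>i\<in>I. X i x \<in> B i} = measure \<nu> {x \<in> space \<nu>. \<forall>i\<in>I. Y i x \<in> B i}"
  using assms
proof (induction I arbitrary: \<mu> \<nu> rule: finite_induct)
  case empty
  then show ?case by simp
next
  case (insert j I)
  interpret two_finite \<mu> \<nu> unfolding two_finite_def using insert by simp
  have m [measurable]: "X j \<in> borel_measurable \<mu>" "Y j \<in> borel_measurable \<nu>" "B j \<in> sets borel"
    using insert.prems by auto
  have mI [measurable]: "\<And>i. i \<in> I \<Longrightarrow> X i \<in> borel_measurable \<mu>" "\<And>i. i \<in> I \<Longrightarrow> Y i \<in> borel_measurable \<nu>"
     "\<And>i. i \<in> I \<Longrightarrow> B i \<in> sets borel"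
    using insert.prems by auto
  define \<mu>' where "\<mu>' = density \<mu> (\<lambda>x. ennreal (indicator (B j) (X j x)))"
  define \<nu>' where "\<nu>' = density \<nu> (\<lambda>x. ennreal (indicator (B j) (Y j x)))"
  have "measure \<mu>' {x \<in> space \<mu>'. \<forall>i\<in>I. X i x \<in> B i} = measure \<nu>' {x \<in> space \<nu>'. \<forall>i\<in>I. Y i x \<in> B i}"
  proof (rule insert.IH)
    show "finite_measure \<mu>'" "finite_measure \<nu>'"
      unfolding \<mu>'_def \<nu>'_def using insert.prems m by (auto intro!: finite_measure_indicator_density)
    show "X i \<in> borel_measurable \<mu>'" "Y i \<in> borel_measurable \<nu>'" "B i \<in> sets borel" if "i \<in> I" for i
      using that mI by (auto simp: \<mu>'_def \<nu>'_def)
    fix y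
    define A where "A = {x \<in> space \<mu>. \<forall>i\<in>I. X i x \<le> y i}"
    define A' where "A' = {x \<in> space \<nu>. \<forall>i\<in>I. Y i x \<le> y i}"
    have A [measurable]: "A \<in> sets \<mu>" "A' \<in> sets \<nu>"
      unfolding A_def A'_def using insert.hyps mI by (auto intro!: sets.sets_Collect_finite_All)
    define \<alpha> where "\<alpha> = distr (density \<mu> (\<lambda>x. ennreal (indicator A x))) borel (X j)"
    define \<beta> where "\<beta> = distr (density \<nu> (\<lambda>x. ennreal (indicator A' x))) borel (Y j)"
    have \<alpha>: "measure \<alpha> C = measure \<mu> {x \<in> A. X j x \<in> C}" if "C \<in> sets borel" for C
      unfolding \<alpha>_def by (rule measure_distr_indicator_density[OF \<mu>.finite_measure_axioms A(1) m(1) that])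
    have \<beta>: "measure \<beta> C = measure \<nu> {x \<in> A'. Y j x \<in> C}" if "C \<in> sets borel" for C
      unfolding \<beta>_def by (rule measure_distr_indicator_density[OF \<nu>.finite_measure_axioms A(2) m(2) that])
    have "\<alpha> = \<beta>"
    proof (rule cdf_unique')
      have "finite_measure \<alpha>" "finite_measure \<beta>"
        unfolding \<alpha>_def \<beta>_def
        by (auto intro!: finite_measure.finite_measure_distr finite_measure_density \<mu>.integrable_const_bound[of _ 1] \<nu>.integrable_const_bound[of _ 1])
      then show "finite_borel_measure \<alpha>" "finite_borel_measure \<beta>"
        by (auto simp: finite_borel_measure_def finite_borel_measure_axioms_def \<alpha>_def \<beta>_def)
      show "cdf \<alpha> = cdf \<beta>"
      proof
        fix c
        have "{x \<in> A. X j x \<in> {..c}} = {x \<in> space \<mu>. \<forall>i\<in>insert j I. X i x \<le> (y(j := c)) i}"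
          unfolding A_def using insert.hyps by auto
        moreover have "{x \<in> A'. Y j x \<in> {..c}} = {x \<in> space \<nu>. \<forall>i\<in>insert j I. Y i x \<le> (y(j := c)) i}"
          unfolding A'_def using insert.hyps by auto
        ultimately show "cdf \<alpha> c = cdf \<beta> c"
          unfolding cdf_def using insert.prems(5)[of "y(j := c)"] by (simp add: \<alpha> \<beta>)
      qed
    qed
    then have "measure \<mu> {x \<in> A. X j x \<in> B j} = measure \<nu> {x \<in> A'. Y j x \<in> B j}"
      using \<alpha>[OF m(3)] \<beta>[OF m(3)] by simp
    then show "measure \<mu>' {x \<in> space \<mu>'. \<forall>i\<in>I. X i x \<le> y i} = measure \<nu>' {x \<in> space \<nu>'. \<forall>i\<in>I. Y i x \<le> y i}"
      using measure_indicator_density[OF \<mu>.finite_measure_axioms m(1) m(3) A(1)]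
        measure_indicator_density[OF \<nu>.finite_measure_axioms m(2) m(3) A(2)]
      unfolding \<mu>'_def \<nu>'_def space_density A_def A'_def by simp
  qed
  moreover have "measure \<mu>' {x \<in> space \<mu>'. \<forall>i\<in>I. X i x \<in> B i} = measure \<mu> {x \<in> space \<mu>. \<forall>i\<in>insert j I. X i x \<in> B i}"
    unfolding \<mu>'_def by (rule measure_indicator_density_box[OF \<mu>.finite_measure_axioms insert.hyps(1), of X j B, OF m(1,3) mI(1,3)])
  moreover have "measure \<nu>' {x \<in> space \<nu>'. \<forall>i\<in>I. Y i x \<in> B i} = measure \<nu> {x \<in> space \<nu>. \<forall>i\<in>insert j I. Y i x \<in> B i}"
    unfolding \<nu>'_def by (rule measure_indicator_density_box[OF \<nu>.finite_measure_axioms insert.hyps(1), of Y j B, OF m(2,3) mI(2,3)])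
  ultimately show ?case by simp
qed

section \<open>Joint distributions of finite families\<close>

definition joint_distr :: "'i set \<Rightarrow> 'a measure \<Rightarrow> ('i \<Rightarrow> 'a \<Rightarrow> real) \<Rightarrow> ('i \<Rightarrow> real) measure" where
  "joint_distr I M X = distr M (\<Pi>\<^sub>M i\<in>I. borel) (\<lambda>\<omega>. \<lambda>i\<in>I. X i \<omega>)"

lemma joint_distr_eqI:
  assumes I: "finite I" and fin: "finite_measure \<mu>" "finite_measure \<nu>"
    and X [measurable]: "\<And>i. i \<in> I \<Longrightarrow> X i \<in> borel_measurable \<mu>"
    and Y [measurable]: "\<And>i. i \<in> I \<Longrightarrow> Y i \<in> borel_measurable \<nu>"
    and eq: "\<And>B. (\<And>i. i \<in> I \<Longrightarrow> B i \<in> sets borel) \<Longrightarrow>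
       measure \<mu> {x \<in> space \<mu>. \<forall>i\<in>I. X i x \<in> B i} = measure \<nu> {x \<in> space \<nu>. \<forall>i\<in>I. Y i x \<in> B i}"
  shows "joint_distr I \<mu> X = joint_distr I \<nu> Y"
proof -
  interpret two_finite \<mu> \<nu> unfolding two_finite_def using fin by simp
  have mX: "(\<lambda>x. \<lambda>i\<in>I. X i x) \<in> measurable \<mu> (\<Pi>\<^sub>M i\<in>I. borel)" and mY: "(\<lambda>x. \<lambda>i\<in>I. Y i x) \<in> measurable \<nu> (\<Pi>\<^sub>M i\<in>I. borel)"
    using X Y by (auto intro!: measurable_restrict)
  show ?thesis unfolding joint_distr_def
  proof (rule measure_eqI_PiM_finite[OF I])
    fix A assume A: "\<And>i. i \<in> I \<Longrightarrow> A i \<in> sets (borel :: real measure)"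
    have PA: "Pi\<^sub>E I A \<in> sets (\<Pi>\<^sub>M i\<in>I. borel)" using I A by (intro sets_PiM_I_finite) auto
    have "(\<lambda>x. \<lambda>i\<in>I. X i x) -` Pi\<^sub>E I A \<inter> space \<mu> = {x \<in> space \<mu>. \<forall>i\<in>I. X i x \<in> A i}"
      "(\<lambda>x. \<lambda>i\<in>I. Y i x) -` Pi\<^sub>E I A \<inter> space \<nu> = {x \<in> space \<nu>. \<forall>i\<in>I. Y i x \<in> A i}"
      by (auto simp: PiE_iff)
    then show "emeasure (distr \<mu> (\<Pi>\<^sub>M i\<in>I. borel) (\<lambda>x. \<lambda>i\<in>I. X i x)) (Pi\<^sub>E I A) =
        emeasure (distr \<nu> (\<Pi>\<^sub>M i\<in>I. borel) (\<lambda>x. \<lambda>i\<in>I. Y i x)) (Pi\<^sub>E I A)"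
      using eq[OF A] by (simp add: emeasure_distr[OF mX PA] emeasure_distr[OF mY PA] \<mu>.emeasure_eq_measure \<nu>.emeasure_eq_measure)
  next
    show "range (\<lambda>_::nat. Pi\<^sub>E I (\<lambda>_. UNIV :: real set)) \<subseteq> prod_algebra I (\<lambda>_. borel)"
      using I by (auto intro!: prod_algebraI_finite)
    show "(\<Union>i::nat. Pi\<^sub>E I (\<lambda>_. UNIV :: real set)) = space (\<Pi>\<^sub>M i\<in>I. borel)" by (simp add: space_PiM)
    interpret D: finite_measure "distr \<mu> (\<Pi>\<^sub>M i\<in>I. borel) (\<lambda>x. \<lambda>i\<in>I. X i x)"
      by (rule \<mu>.finite_measure_distr[OF mX])
    show "emeasure (distr \<mu> (\<Pi>\<^sub>M i\<in>I. borel) (\<lambda>x. \<lambda>i\<in>I. X i x)) (Pi\<^sub>E I (\<lambda>_. UNIV)) \<noteq> \<infinity>" for i :: nat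
      by simp
  qed simp_all
qed

lemma integral_joint_distr:
  fixes f :: "('i \<Rightarrow> real) \<Rightarrow> 'b :: {banach, second_countable_topology}"
  assumes "\<And>i. i \<in> I \<Longrightarrow> X i \<in> borel_measurable M" and "f \<in> borel_measurable (\<Pi>\<^sub>M i\<in>I. borel)"
  shows "(\<integral>v. f v \<partial>joint_distr I M X) = (\<integral>x. f (\<lambda>i\<in>I. X i x) \<partial>M)"
  unfolding joint_distr_def using assms by (intro integral_distr measurable_restrict) auto

theorem joint_distr_eq_iff_char:
  assumes I: "finite I" and fin: "finite_measure \<mu>" "finite_measure \<nu>"
    and X: "\<And>i. i \<in> I \<Longrightarrow> X i \<in> borel_measurable \<mu>"
    and Y: "\<And>i. i \<in> I \<Longrightarrow> Y i \<in> borel_measurable \<nu>"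
  shows "joint_distr I \<mu> X = joint_distr I \<nu> Y \<longleftrightarrow>
    (\<forall>u. (\<integral>x. iexp (\<Sum>i\<in>I. u i * X i x) \<partial>\<mu>) = (\<integral>x. iexp (\<Sum>i\<in>I. u i * Y i x) \<partial>\<nu>))"
proof
  assume eq: "joint_distr I \<mu> X = joint_distr I \<nu> Y"
  show "\<forall>u. (\<integral>x. iexp (\<Sum>i\<in>I. u i * X i x) \<partial>\<mu>) = (\<integral>x. iexp (\<Sum>i\<in>I. u i * Y i x) \<partial>\<nu>)"
  proof
    fix u
    have m: "(\<lambda>v. iexp (\<Sum>i\<in>I. u i * v i)) \<in> borel_measurable (\<Pi>\<^sub>M i\<in>I. borel)" by measurable
    show "(\<integral>x. iexp (\<Sum>i\<in>I. u i * X i x) \<partial>\<mu>) = (\<integral>x. iexp (\<Sum>i\<in>I. u i * Y i x) \<partial>\<nu>)"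
      using integral_joint_distr[of I X \<mu>, OF X m] integral_joint_distr[of I Y \<nu>, OF Y m] eq by simp
  qed
next
  assume "\<forall>u. (\<integral>x. iexp (\<Sum>i\<in>I. u i * X i x) \<partial>\<mu>) = (\<integral>x. iexp (\<Sum>i\<in>I. u i * Y i x) \<partial>\<nu>)"
  then show "joint_distr I \<mu> X = joint_distr I \<nu> Y"
    using assms by (intro joint_distr_eqI[OF I fin X Y] boxes_eq_of_char) auto
qed

theorem joint_distr_eqI_cdf:
  assumes I: "finite I" and fin: "finite_measure \<mu>" "finite_measure \<nu>"
    and X: "\<And>i. i \<in> I \<Longrightarrow> X i \<in> borel_measurable \<mu>"
    and Y: "\<And>i. i \<in> I \<Longrightarrow> Y i \<in> borel_measurable \<nu>"
    and eq: "\<And>y. measure \<mu> {x \<in> space \<mu>. \<forall>i\<in>I. X i x \<le> y i} = measure \<nu> {x \<in> space \<nu>. \<forall>i\<in>I. Y i x \<le> y i}"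
  shows "joint_distr I \<mu> X = joint_distr I \<nu> Y"
  using assms by (intro joint_distr_eqI[OF I fin X Y] boxes_eq_of_cdf) auto

section \<open>Positive families\<close>

text \<open>The functions are piecewise linear in the parameter, so for each point the quotient to
  the right of \<open>c\<close> is eventually equal to the slope \<open>d\<close>. The Lipschitz
  bound dominates all quotients by 1, also when \<open>W\<close> is unbounded.\<close>

lemma tendsto_integral_difference_quotient:
  fixes F :: "real \<Rightarrow> real \<Rightarrow> real"
  assumes "finite_measure \<mu>" and [measurable]: "W \<in> borel_measurable \<mu>" "\<And>t. F t \<in> borel_measurable borel" "d \<in> borel_measurable borel"
    and lip: "\<And>s t w. \<bar>F s w - F t w\<bar> \<le> \<bar>s - t\<bar>"
    and d: "\<And>w. \<exists>e>0. \<forall>h. 0 < h \<and> h < e \<longrightarrow> F (c + h) w - F c w = d w * h"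
  shows "(\<lambda>n. \<integral>x. (F (c + inverse (real (Suc n))) (W x) - F c (W x)) * real (Suc n) \<partial>\<mu>) \<longlonglongrightarrow> (\<integral>x. d (W x) \<partial>\<mu>)"
proof (rule integral_dominated_convergence[where w="\<lambda>_. 1"])
  interpret finite_measure \<mu> by fact
  show "integrable \<mu> (\<lambda>_. 1 :: real)" by simp
  show "AE x in \<mu>. (\<lambda>n. (F (c + inverse (real (Suc n))) (W x) - F c (W x)) * real (Suc n)) \<longlonglongrightarrow> d (W x)"
  proof (intro AE_I2 tendsto_eventually)
    fix x
    obtain e where e: "0 < e" "\<And>h. 0 < h \<Longrightarrow> h < e \<Longrightarrow> F (c + h) (W x) - F c (W x) = d (W x) * h" using d by blast
    obtain N where N: "inverse (real (Suc N)) < e" using reals_Archimedean[OF e(1)] by auto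
    show "\<forall>\<^sub>F n in sequentially. (F (c + inverse (real (Suc n))) (W x) - F c (W x)) * real (Suc n) = d (W x)"
      using eventually_ge_at_top[of N]
    proof eventually_elim
      case (elim n)
      then have "inverse (real (Suc n)) \<le> inverse (real (Suc N))" by (intro le_imp_inverse_le) auto
      then have "F (c + inverse (real (Suc n))) (W x) - F c (W x) = d (W x) * inverse (real (Suc n))"
        by (intro e(2) order_le_less_trans[OF _ N]) auto
      then show ?case by simp
    qed
  qed
  show "AE x in \<mu>. norm ((F (c + inverse (real (Suc n))) (W x) - F c (W x)) * real (Suc n)) \<le> 1" for n
  proof (intro AE_I2)
    fix x
    have "\<bar>F (c + inverse (real (Suc n))) (W x) - F c (W x)\<bar> * real (Suc n) \<le> inverse (real (Suc n)) * real (Suc n)"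
      using lip[of "c + inverse (real (Suc n))" "W x" c] by (intro mult_right_mono) auto
    then show "norm ((F (c + inverse (real (Suc n))) (W x) - F c (W x)) * real (Suc n)) \<le> 1" by (simp add: abs_mult)
  qed
qed measurable

text \<open>The right derivative of \<open>\<bar>w - t\<bar>\<close> at \<open>t = c\<close> is 1
  for \<open>w \<le> c\<close> and -1 otherwise, that is, twice an indicator minus 1. Recovering the
  distribution function therefore also takes the total mass.\<close>

lemma tendsto_measure_le_abs:
  assumes "finite_measure \<mu>" and [measurable]: "W \<in> borel_measurable \<mu>"
  shows "(\<lambda>n. \<integral>x. (\<bar>W x - (c + inverse (real (Suc n)))\<bar> - \<bar>W x - c\<bar>) * real (Suc n) \<partial>\<mu>)
    \<longlonglongrightarrow> 2 * measure \<mu> {x \<in> space \<mu>. W x \<le> c} - measure \<mu> (space \<mu>)"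
proof -
  interpret finite_measure \<mu> by fact
  define A where "A = {x \<in> space \<mu>. W x \<le> c}"
  have [measurable]: "A \<in> sets \<mu>" unfolding A_def by measurable
  have "(\<lambda>n. \<integral>x. (\<bar>W x - (c + inverse (real (Suc n)))\<bar> - \<bar>W x - c\<bar>) * real (Suc n) \<partial>\<mu>)
    \<longlonglongrightarrow> (\<integral>x. (if W x \<le> c then 1 else - 1) \<partial>\<mu>)"
  proof (rule tendsto_integral_difference_quotient[OF assms, where F="\<lambda>t w. \<bar>w - t\<bar>" and d="\<lambda>w. if w \<le> c then 1 else - 1"])
    show "\<exists>e>0. \<forall>h. 0 < h \<and> h < e \<longrightarrow> \<bar>w - (c + h)\<bar> - \<bar>w - c\<bar> = (if w \<le> c then 1 else - 1) * h" for w
    proof (cases "w \<le> c")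
      case True
      then show ?thesis by (intro exI[of _ 1]) auto
    next
      case False
      then show ?thesis by (intro exI[of _ "w - c"]) auto
    qed
  qed auto
  also have "(\<integral>x. (if W x \<le> c then 1 else - 1) \<partial>\<mu>) = (\<integral>x. 2 * indicator A x - (1 :: real) \<partial>\<mu>)"
    by (intro Bochner_Integration.integral_cong) (auto simp: A_def)
  also have "\<dots> = 2 * measure \<mu> A - measure \<mu> (space \<mu>)"
    by (subst Bochner_Integration.integral_diff) (auto simp: emeasure_eq_measure)
  finally show ?thesis unfolding A_def .
qed

text \<open>The right derivative of \<open>max t v\<close> at \<open>t = 1\<close> is the indicator
  of \<open>v \<le> 1\<close>. The fixed threshold 1 suffices because other thresholds are absorbed
  into the weights of the maximum.\<close>

lemma tendsto_measure_le_max: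
  assumes "finite_measure \<mu>" and [measurable]: "V \<in> borel_measurable \<mu>"
  shows "(\<lambda>n. \<integral>x. (max (1 + inverse (real (Suc n))) (V x) - max 1 (V x)) * real (Suc n) \<partial>\<mu>)
    \<longlonglongrightarrow> measure \<mu> {x \<in> space \<mu>. V x \<le> 1}"
proof -
  interpret finite_measure \<mu> by fact
  define A where "A = {x \<in> space \<mu>. V x \<le> 1}"
  have [measurable]: "A \<in> sets \<mu>" unfolding A_def by measurable
  have "(\<lambda>n. \<integral>x. (max (1 + inverse (real (Suc n))) (V x) - max 1 (V x)) * real (Suc n) \<partial>\<mu>)
    \<longlonglongrightarrow> (\<integral>x. (if V x \<le> 1 then 1 else 0) \<partial>\<mu>)"
  proof (rule tendsto_integral_difference_quotient[OF assms, where F=max and d="\<lambda>v. if v \<le> 1 then 1 else 0"])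
    show "\<exists>e>0. \<forall>h. 0 < h \<and> h < e \<longrightarrow> max (1 + h) v - max 1 v = (if v \<le> 1 then 1 else 0) * h" for v :: real
    proof (cases "v \<le> 1")
      case True
      then show ?thesis by (intro exI[of _ 1]) auto
    next
      case False
      then show ?thesis by (intro exI[of _ "v - 1"]) auto
    qed
  qed auto
  also have "(\<integral>x. (if V x \<le> 1 then 1 else 0) \<partial>\<mu>) = (\<integral>x. indicator A x \<partial>\<mu>)"
    by (intro Bochner_Integration.integral_cong) (auto simp: A_def)
  also have "\<dots> = measure \<mu> A" by simp
  finally show ?thesis unfolding A_def .
qed

lemma integrable_Max:
  fixes f :: "'i \<Rightarrow> 'a \<Rightarrow> real"
  assumes I: "finite I" "I \<noteq> {}" and f: "\<And>i. i \<in> I \<Longrightarrow> integrable M (f i)"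
  shows "integrable M (\<lambda>x. Max ((\<lambda>i. f i x) ` I))"
proof (rule Bochner_Integration.integrable_bound)
  show "integrable M (\<lambda>x. \<Sum>i\<in>I. \<bar>f i x\<bar>)" using f by auto
  show "(\<lambda>x. Max ((\<lambda>i. f i x) ` I)) \<in> borel_measurable M"
    using I f by (intro borel_measurable_Max) auto
  show "AE x in M. norm (Max ((\<lambda>i. f i x) ` I)) \<le> norm (\<Sum>i\<in>I. \<bar>f i x\<bar>)"
  proof (intro AE_I2)
    fix x
    have "Max ((\<lambda>i. f i x) ` I) \<in> (\<lambda>i. f i x) ` I" using I by (intro Max_in) auto
    then obtain i where "i \<in> I" "Max ((\<lambda>i. f i x) ` I) = f i x" by auto
    moreover have "\<bar>f i x\<bar> \<le> (\<Sum>i\<in>I. \<bar>f i x\<bar>)" by (rule member_le_sum) (use \<open>i \<in> I\<close> I in auto)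
    ultimately show "norm (Max ((\<lambda>i. f i x) ` I)) \<le> norm (\<Sum>i\<in>I. \<bar>f i x\<bar>)" by simp
  qed
qed

text \<open>Reweighting by the coordinate \<open>\<xi> i0\<close>: an integral of a function of \<open>\<xi>\<close> that is homogeneous of
  degree one is an integral of the ratios \<open>\<xi> i / \<xi> i0\<close> under the reweighted measure.\<close>

locale positive_family = prob_space P for P :: "'p measure" +
  fixes I :: "'i set" and \<xi> :: "'i \<Rightarrow> 'p \<Rightarrow> real" and i0 :: 'i
  assumes fin: "finite I" and i0: "i0 \<in> I"
    and int: "\<And>i. i \<in> I \<Longrightarrow> integrable P (\<xi> i)"
    and pos: "AE \<omega> in P. \<forall>i\<in>I. 0 < \<xi> i \<omega>"
begin

definition tilt :: "'p measure" where
  "tilt = density P (\<lambda>\<omega>. ennreal (\<xi> i0 \<omega>))"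

definition ratio :: "'i \<Rightarrow> 'p \<Rightarrow> real" where
  "ratio i \<omega> = \<xi> i \<omega> / \<xi> i0 \<omega>"

lemma pos_i0: "AE \<omega> in P. 0 < \<xi> i0 \<omega>"
  using pos i0 by (auto elim: eventually_mono)

lemma \<xi>_meas [measurable]: "i \<in> I \<Longrightarrow> \<xi> i \<in> borel_measurable P"
  using int by auto

lemma sets_tilt [simp, measurable_cong]: "sets tilt = sets P"
  and space_tilt [simp]: "space tilt = space P"
  by (simp_all add: tilt_def)

lemma ratio_meas [measurable]: "i \<in> I \<Longrightarrow> ratio i \<in> borel_measurable P"
  unfolding ratio_def[abs_def] using i0 by measurable

lemma ratio_meas' [measurable]: "i \<in> I \<Longrightarrow> ratio i \<in> borel_measurable tilt"
  using ratio_meas measurable_cong_sets[OF sets_tilt refl] by blast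

lemma finite_tilt: "finite_measure tilt"
  unfolding tilt_def using pos_i0 int[OF i0] by (intro finite_measure_density) (auto elim: eventually_mono)

sublocale tilt: finite_measure tilt by (rule finite_tilt)

lemma integral_tilt:
  fixes f :: "'p \<Rightarrow> real"
  assumes "f \<in> borel_measurable P"
  shows "(\<integral>\<omega>. f \<omega> \<partial>tilt) = (\<integral>\<omega>. \<xi> i0 \<omega> * f \<omega> \<partial>P)"
  unfolding tilt_def using assms i0 pos_i0
  by (subst integral_density) (auto elim: eventually_mono)

lemma integrable_tilt:
  fixes f :: "'p \<Rightarrow> real"
  assumes "f \<in> borel_measurable P"
  shows "integrable tilt f \<longleftrightarrow> integrable P (\<lambda>\<omega>. \<xi> i0 \<omega> * f \<omega>)"
  unfolding tilt_def using assms i0 pos_i0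
  by (subst integrable_density) (auto elim: eventually_mono)

lemma AE_tilt: "AE \<omega> in P. Q \<omega> \<Longrightarrow> AE \<omega> in tilt. Q \<omega>"
  unfolding tilt_def using i0 by (subst AE_density) (auto elim: eventually_mono)

lemma measure_tilt: "measure tilt (space P) = (\<integral>\<omega>. \<xi> i0 \<omega> \<partial>P)"
  using integral_tilt[of "\<lambda>_. 1"] tilt.emeasure_eq_measure by simp

lemma integrable_ratio:
  assumes i: "i \<in> I"
  shows "integrable tilt (ratio i)"
  unfolding integrable_tilt[OF ratio_meas[OF i]]
proof (rule integrable_cong_AE_imp[OF int[OF i]])
  show "(\<lambda>\<omega>. \<xi> i0 \<omega> * ratio i \<omega>) \<in> borel_measurable P" using i i0 by measurable
  show "AE \<omega> in P. \<xi> i \<omega> = \<xi> i0 \<omega> * ratio i \<omega>"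
    using pos_i0 by eventually_elim (simp add: ratio_def)
qed

text \<open>Since the ratio of index \<open>i0\<close> is 1, a shift by \<open>t\<close> is a change
  of its coefficient. The functionals for all \<open>u\<close> thus contain those of every
  combination of ratios with every shift.\<close>

lemma integral_abs_tilt:
  "(\<integral>\<omega>. \<bar>(\<Sum>i\<in>I. u i * ratio i \<omega>) - t\<bar> \<partial>tilt) = (\<integral>\<omega>. \<bar>\<Sum>i\<in>I. (u(i0 := u i0 - t)) i * \<xi> i \<omega>\<bar> \<partial>P)"
proof -
  have "(\<integral>\<omega>. \<bar>(\<Sum>i\<in>I. u i * ratio i \<omega>) - t\<bar> \<partial>tilt) = (\<integral>\<omega>. \<xi> i0 \<omega> * \<bar>(\<Sum>i\<in>I. u i * ratio i \<omega>) - t\<bar> \<partial>P)"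
    by (rule integral_tilt) measurable
  also have "\<dots> = (\<integral>\<omega>. \<bar>\<Sum>i\<in>I. (u(i0 := u i0 - t)) i * \<xi> i \<omega>\<bar> \<partial>P)"
  proof (rule Bochner_Integration.integral_cong_AE)
    show "(\<lambda>\<omega>. \<xi> i0 \<omega> * \<bar>(\<Sum>i\<in>I. u i * ratio i \<omega>) - t\<bar>) \<in> borel_measurable P" using i0 by measurable
    show "AE \<omega> in P. \<xi> i0 \<omega> * \<bar>(\<Sum>i\<in>I. u i * ratio i \<omega>) - t\<bar> = \<bar>\<Sum>i\<in>I. (u(i0 := u i0 - t)) i * \<xi> i \<omega>\<bar>"
      using pos_i0
    proof eventually_elim
      case (elim \<omega>)
      have "(\<Sum>i\<in>I. (u(i0 := u i0 - t)) i * \<xi> i \<omega>) = (\<Sum>i\<in>I. u i * \<xi> i \<omega> - (if i = i0 then t * \<xi> i \<omega> else 0))"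
        by (intro sum.cong) (auto simp: algebra_simps)
      also have "\<dots> = (\<Sum>i\<in>I. u i * \<xi> i \<omega>) - t * \<xi> i0 \<omega>"
        using fin i0 by (simp add: sum_subtractf)
      also have "\<dots> = \<xi> i0 \<omega> * ((\<Sum>i\<in>I. u i * ratio i \<omega>) - t)"
        using elim by (simp add: ratio_def right_diff_distrib sum_distrib_left mult.commute)
      finally show ?case using elim by (simp add: abs_mult)
    qed
  qed measurable
  finally show ?thesis .
qed

definition max_ratio :: "('i \<Rightarrow> real) \<Rightarrow> 'p \<Rightarrow> real" where
  "max_ratio u \<omega> = Max ((\<lambda>i. u i * ratio i \<omega>) ` I)"

lemma max_ratio_meas [measurable]: "max_ratio u \<in> borel_measurable P"
  unfolding max_ratio_def[abs_def] using fin by (intro borel_measurable_Max) auto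

lemma max_ratio_meas' [measurable]: "max_ratio u \<in> borel_measurable tilt"
  using max_ratio_meas measurable_cong_sets[OF sets_tilt refl] by blast

lemma integrable_max_ratio: "integrable tilt (max_ratio u)"
  unfolding max_ratio_def[abs_def] using fin i0 integrable_ratio by (intro integrable_Max) auto

text \<open>Ratios are almost surely positive. This settles the thresholds that are not reciprocals
  of positive weights.\<close>

lemma measure_ratio_le_nonpos:
  assumes j: "j \<in> I" "y j \<le> 0"
  shows "measure tilt {x \<in> space tilt. \<forall>i\<in>I. ratio i x \<le> y i} = 0"
proof -
  have "AE x in tilt. \<not> (\<forall>i\<in>I. ratio i x \<le> y i)"
  proof (rule AE_tilt)
    show "AE x in P. \<not> (\<forall>i\<in>I. ratio i x \<le> y i)"
      using pos
    proof eventually_elim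
      case (elim x)
      then have "0 < ratio j x" using j i0 by (simp add: ratio_def)
      then show ?case using j by force
    qed
  qed
  then have "measure tilt {x \<in> space tilt. \<forall>i\<in>I. ratio i x \<le> y i} = measure tilt {}"
    by (intro measure_eq_AE sets.sets_Collect_finite_All fin) (auto elim: eventually_mono)
  then show ?thesis by simp
qed

text \<open>Since the ratio of index \<open>i0\<close> is 1, the constant \<open>t\<close> competes
  with \<open>u i0\<close> for the same coordinate, and the larger of the two becomes its
  weight.\<close>

lemma integral_max_tilt:
  "(\<integral>\<omega>. max t (max_ratio u \<omega>) \<partial>tilt) = (\<integral>\<omega>. Max ((\<lambda>i. (u(i0 := max t (u i0))) i * \<xi> i \<omega>) ` I) \<partial>P)"
proof -
  have "(\<integral>\<omega>. max t (max_ratio u \<omega>) \<partial>tilt) = (\<integral>\<omega>. \<xi> i0 \<omega> * max t (max_ratio u \<omega>) \<partial>P)"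
    by (rule integral_tilt) measurable
  also have "\<dots> = (\<integral>\<omega>. Max ((\<lambda>i. (u(i0 := max t (u i0))) i * \<xi> i \<omega>) ` I) \<partial>P)"
  proof (rule Bochner_Integration.integral_cong_AE)
    show "(\<lambda>\<omega>. \<xi> i0 \<omega> * max t (max_ratio u \<omega>)) \<in> borel_measurable P" using i0 by measurable
    show "(\<lambda>\<omega>. Max ((\<lambda>i. (u(i0 := max t (u i0))) i * \<xi> i \<omega>) ` I)) \<in> borel_measurable P"
      using fin by (intro borel_measurable_Max borel_measurable_times \<xi>_meas) auto
    show "AE \<omega> in P. \<xi> i0 \<omega> * max t (max_ratio u \<omega>) = Max ((\<lambda>i. (u(i0 := max t (u i0))) i * \<xi> i \<omega>) ` I)"
      using pos_i0
    proof eventually_elim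
      case (elim \<omega>)
      \<comment> \<open>Two reals with the same upper bounds are equal, and upper bounds of a
        maximum split into conditions on the coordinates.\<close>
      have "\<xi> i0 \<omega> * max t (max_ratio u \<omega>) \<le> c \<longleftrightarrow> Max ((\<lambda>i. (u(i0 := max t (u i0))) i * \<xi> i \<omega>) ` I) \<le> c" for c
      proof -
        have "\<xi> i0 \<omega> * max t (max_ratio u \<omega>) \<le> c \<longleftrightarrow> max t (max_ratio u \<omega>) \<le> c / \<xi> i0 \<omega>"
          by (simp only: pos_le_divide_eq[OF elim] mult.commute)
        also have "\<dots> \<longleftrightarrow> t \<le> c / \<xi> i0 \<omega> \<and> (\<forall>i\<in>I. u i * ratio i \<omega> \<le> c / \<xi> i0 \<omega>)"
          unfolding max_ratio_def using fin i0 by (subst max.bounded_iff, subst Max_le_iff) auto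
        also have "\<dots> \<longleftrightarrow> t * \<xi> i0 \<omega> \<le> c \<and> (\<forall>i\<in>I. u i * \<xi> i \<omega> \<le> c)"
          using elim by (simp add: ratio_def pos_le_divide_eq)
        also have "\<dots> \<longleftrightarrow> (\<forall>i\<in>I. (u(i0 := max t (u i0))) i * \<xi> i \<omega> \<le> c)"
        proof -
          have "max t (u i0) * \<xi> i0 \<omega> = max (t * \<xi> i0 \<omega>) (u i0 * \<xi> i0 \<omega>)"
            using elim by (simp add: max_mult_distrib_right)
          then show ?thesis using i0 by auto
        qed
        also have "\<dots> \<longleftrightarrow> Max ((\<lambda>i. (u(i0 := max t (u i0))) i * \<xi> i \<omega>) ` I) \<le> c"
          using fin i0 by (subst Max_le_iff) auto
        finally show ?thesis .
      qed
      then show ?case by (meson order_antisym order_refl)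
    qed
  qed
  finally show ?thesis .
qed

end

section \<open>The law of the ratios as common invariant of two positive families\<close>

locale two_positive_families = A: positive_family P I \<xi> i0 + B: positive_family P' I \<xi>' i0
  for P :: "'p measure" and P' :: "'q measure" and I :: "'c set" and \<xi> \<xi>' i0
begin

definition same_ratios :: bool where
  "same_ratios \<longleftrightarrow> joint_distr I A.tilt A.ratio = joint_distr I B.tilt B.ratio"

text \<open>From left to right, the shifts of a combination \<open>W\<close> of ratios determine its
  distribution function under the tilted measure, hence its characteristic function at 1; letting
  \<open>u\<close> vary gives the joint law. Conversely, the shift 0 expresses each functional
  through the ratios.\<close>

lemma zonoid_iff_same_ratios:
  "(\<forall>u. (\<integral>\<omega>. \<bar>\<Sum>i\<in>I. u i * \<xi> i \<omega>\<bar> \<partial>P) = (\<integral>\<omega>. \<bar>\<Sum>i\<in>I. u i * \<xi>' i \<omega>\<bar> \<partial>P')) \<longleftrightarrow> same_ratios"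
proof
  assume eq: "\<forall>u. (\<integral>\<omega>. \<bar>\<Sum>i\<in>I. u i * \<xi> i \<omega>\<bar> \<partial>P) = (\<integral>\<omega>. \<bar>\<Sum>i\<in>I. u i * \<xi>' i \<omega>\<bar> \<partial>P')"
  \<comment> \<open>The unit vector at \<open>i0\<close> supplies the total mass that appears in the
    limit of the difference quotients.\<close>
  have total: "measure A.tilt (space A.tilt) = measure B.tilt (space B.tilt)"
  proof -
    have "(\<integral>\<omega>. \<bar>\<xi> i0 \<omega>\<bar> \<partial>P) = (\<integral>\<omega>. \<bar>\<xi>' i0 \<omega>\<bar> \<partial>P')"
      using eq[rule_format, of "\<lambda>i. if i = i0 then 1 else 0"] A.fin A.i0 by (simp add: if_distribR if_distrib[of "\<lambda>x. x * _"] cong: if_cong)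
    moreover have "(\<integral>\<omega>. \<bar>\<xi> i0 \<omega>\<bar> \<partial>P) = (\<integral>\<omega>. \<xi> i0 \<omega> \<partial>P)"
      using A.pos_i0 A.i0 by (intro Bochner_Integration.integral_cong_AE) (auto elim: eventually_mono)
    moreover have "(\<integral>\<omega>. \<bar>\<xi>' i0 \<omega>\<bar> \<partial>P') = (\<integral>\<omega>. \<xi>' i0 \<omega> \<partial>P')"
      using B.pos_i0 A.i0 by (intro Bochner_Integration.integral_cong_AE) (auto elim: eventually_mono)
    ultimately show ?thesis by (simp add: A.measure_tilt B.measure_tilt)
  qed
  have "(\<integral>\<omega>. iexp (\<Sum>i\<in>I. u i * A.ratio i \<omega>) \<partial>A.tilt) = (\<integral>\<omega>. iexp (\<Sum>i\<in>I. u i * B.ratio i \<omega>) \<partial>B.tilt)" for u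
  proof -
    define W where "W \<omega> = (\<Sum>i\<in>I. u i * A.ratio i \<omega>)" for \<omega>
    define W' where "W' \<omega> = (\<Sum>i\<in>I. u i * B.ratio i \<omega>)" for \<omega>
    have Wi: "integrable A.tilt W" "integrable B.tilt W'"
      unfolding W_def[abs_def] W'_def[abs_def] using A.integrable_ratio B.integrable_ratio by auto
    then have [measurable]: "W \<in> borel_measurable A.tilt" "W' \<in> borel_measurable B.tilt" by auto
    have abs_eq: "(\<integral>\<omega>. \<bar>W \<omega> - t\<bar> \<partial>A.tilt) = (\<integral>\<omega>. \<bar>W' \<omega> - t\<bar> \<partial>B.tilt)" for t
      unfolding W_def W'_def A.integral_abs_tilt B.integral_abs_tilt using eq by blast
    have quot: "(\<integral>\<omega>. (\<bar>W \<omega> - s\<bar> - \<bar>W \<omega> - t\<bar>) * r \<partial>A.tilt) = (\<integral>\<omega>. (\<bar>W' \<omega> - s\<bar> - \<bar>W' \<omega> - t\<bar>) * r \<partial>B.tilt)" for s t r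
    proof -
      have "integrable A.tilt (\<lambda>\<omega>. \<bar>W \<omega> - s\<bar>)" "integrable B.tilt (\<lambda>\<omega>. \<bar>W' \<omega> - s\<bar>)" for s
        using Wi by auto
      then show ?thesis using abs_eq by simp
    qed
    have cdf: "measure A.tilt {\<omega> \<in> space A.tilt. W \<omega> \<le> c} = measure B.tilt {\<omega> \<in> space B.tilt. W' \<omega> \<le> c}" for c
    proof -
      have "2 * measure A.tilt {\<omega> \<in> space A.tilt. W \<omega> \<le> c} - measure A.tilt (space A.tilt)
        = 2 * measure B.tilt {\<omega> \<in> space B.tilt. W' \<omega> \<le> c} - measure B.tilt (space B.tilt)"
        using LIMSEQ_unique[OF tendsto_measure_le_abs[OF A.finite_tilt, of W c, unfolded quot] tendsto_measure_le_abs[OF B.finite_tilt, of W' c]]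
        by simp
      then show ?thesis using total by simp
    qed
    have "distr A.tilt borel W = distr B.tilt borel W'"
    proof (rule cdf_unique')
      show "finite_borel_measure (distr A.tilt borel W)" "finite_borel_measure (distr B.tilt borel W')"
        by (auto simp: finite_borel_measure_def finite_borel_measure_axioms_def intro!: A.tilt.finite_measure_distr B.tilt.finite_measure_distr)
      show "cdf (distr A.tilt borel W) = cdf (distr B.tilt borel W')"
      proof
        fix c
        have "W -` {..c} \<inter> space A.tilt = {\<omega> \<in> space A.tilt. W \<omega> \<le> c}"
          "W' -` {..c} \<inter> space B.tilt = {\<omega> \<in> space B.tilt. W' \<omega> \<le> c}" by auto
        then show "cdf (distr A.tilt borel W) c = cdf (distr B.tilt borel W') c"
          unfolding cdf_def using cdf[of c] by (simp add: measure_distr)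
      qed
    qed
    then have "(\<integral>x. iexp x \<partial>distr A.tilt borel W) = (\<integral>x. iexp x \<partial>distr B.tilt borel W')" by simp
    then show ?thesis unfolding W_def[symmetric] W'_def[symmetric] by (simp add: integral_distr)
  qed
  then show same_ratios
    unfolding same_ratios_def
    using joint_distr_eq_iff_char[OF A.fin A.finite_tilt B.finite_tilt, of A.ratio B.ratio] by simp
next
  assume eq: same_ratios
  show "\<forall>u. (\<integral>\<omega>. \<bar>\<Sum>i\<in>I. u i * \<xi> i \<omega>\<bar> \<partial>P) = (\<integral>\<omega>. \<bar>\<Sum>i\<in>I. u i * \<xi>' i \<omega>\<bar> \<partial>P')"
  proof
    fix u :: "'c \<Rightarrow> real"
    have m: "(\<lambda>v. \<bar>(\<Sum>i\<in>I. u i * v i) - 0\<bar>) \<in> borel_measurable (\<Pi>\<^sub>M i\<in>I. borel)" by measurable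
    have "(\<integral>\<omega>. \<bar>(\<Sum>i\<in>I. u i * A.ratio i \<omega>) - 0\<bar> \<partial>A.tilt) = (\<integral>\<omega>. \<bar>(\<Sum>i\<in>I. u i * B.ratio i \<omega>) - 0\<bar> \<partial>B.tilt)"
      using integral_joint_distr[of I A.ratio A.tilt, OF _ m] integral_joint_distr[of I B.ratio B.tilt, OF _ m] eq
      by (simp add: same_ratios_def)
    then show "(\<integral>\<omega>. \<bar>\<Sum>i\<in>I. u i * \<xi> i \<omega>\<bar> \<partial>P) = (\<integral>\<omega>. \<bar>\<Sum>i\<in>I. u i * \<xi>' i \<omega>\<bar> \<partial>P')"
      unfolding A.integral_abs_tilt B.integral_abs_tilt by simp
  qed
qed

text \<open>From left to right, weights \<open>1 / y i\<close> turn the joint event of all ratios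
  being at most \<open>y i\<close> into the event that their weighted maximum is at most 1, whose
  measure is a right derivative. The altered weight at \<open>i0\<close> stays positive, so the
  assumed equality applies for every \<open>t\<close>.\<close>

lemma max_iff_same_ratios:
  "(\<forall>u. (\<forall>i\<in>I. 0 < u i) \<longrightarrow> (\<integral>\<omega>. Max ((\<lambda>i. u i * \<xi> i \<omega>) ` I) \<partial>P) = (\<integral>\<omega>. Max ((\<lambda>i. u i * \<xi>' i \<omega>) ` I) \<partial>P'))
    \<longleftrightarrow> same_ratios"
proof
  assume eq: "\<forall>u. (\<forall>i\<in>I. 0 < u i) \<longrightarrow> (\<integral>\<omega>. Max ((\<lambda>i. u i * \<xi> i \<omega>) ` I) \<partial>P) = (\<integral>\<omega>. Max ((\<lambda>i. u i * \<xi>' i \<omega>) ` I) \<partial>P')"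
  have "measure A.tilt {x \<in> space A.tilt. \<forall>i\<in>I. A.ratio i x \<le> y i} = measure B.tilt {x \<in> space B.tilt. \<forall>i\<in>I. B.ratio i x \<le> y i}" for y
  proof (cases "\<forall>i\<in>I. 0 < y i")
    case True
    define u where "u i = 1 / y i" for i
    have max_eq: "(\<integral>\<omega>. max t (A.max_ratio u \<omega>) \<partial>A.tilt) = (\<integral>\<omega>. max t (B.max_ratio u \<omega>) \<partial>B.tilt)" for t
      unfolding A.integral_max_tilt B.integral_max_tilt using True A.i0
      by (intro eq[rule_format]) (auto simp: u_def less_max_iff_disj)
    have quot: "(\<integral>\<omega>. (max s (A.max_ratio u \<omega>) - max t (A.max_ratio u \<omega>)) * r \<partial>A.tilt) =
       (\<integral>\<omega>. (max s (B.max_ratio u \<omega>) - max t (B.max_ratio u \<omega>)) * r \<partial>B.tilt)" for s t r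
    proof -
      have "integrable A.tilt (\<lambda>\<omega>. max s (A.max_ratio u \<omega>))" "integrable B.tilt (\<lambda>\<omega>. max s (B.max_ratio u \<omega>))" for s
        using A.integrable_max_ratio B.integrable_max_ratio by auto
      then show ?thesis using max_eq by simp
    qed
    have "measure A.tilt {x \<in> space A.tilt. A.max_ratio u x \<le> 1} = measure B.tilt {x \<in> space B.tilt. B.max_ratio u x \<le> 1}"
      by (rule LIMSEQ_unique[OF tendsto_measure_le_max[OF A.finite_tilt A.max_ratio_meas'[of u], unfolded quot]
            tendsto_measure_le_max[OF B.finite_tilt B.max_ratio_meas'[of u]]])
    moreover have "A.max_ratio u x \<le> 1 \<longleftrightarrow> (\<forall>i\<in>I. A.ratio i x \<le> y i)" for x
      unfolding A.max_ratio_def using A.fin A.i0 True by (subst Max_le_iff) (auto simp: u_def field_simps)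
    moreover have "B.max_ratio u x \<le> 1 \<longleftrightarrow> (\<forall>i\<in>I. B.ratio i x \<le> y i)" for x
      unfolding B.max_ratio_def using A.fin A.i0 True by (subst Max_le_iff) (auto simp: u_def field_simps)
    ultimately show ?thesis by simp
  next
    case False
    then obtain j where j: "j \<in> I" "y j \<le> 0" by force
    then show ?thesis using A.measure_ratio_le_nonpos[of j y, OF j] B.measure_ratio_le_nonpos[of j y, OF j] by simp
  qed
  then show same_ratios
    unfolding same_ratios_def by (intro joint_distr_eqI_cdf A.fin A.finite_tilt B.finite_tilt) auto
next
  assume eq: same_ratios
  show "\<forall>u. (\<forall>i\<in>I. 0 < u i) \<longrightarrow> (\<integral>\<omega>. Max ((\<lambda>i. u i * \<xi> i \<omega>) ` I) \<partial>P) = (\<integral>\<omega>. Max ((\<lambda>i. u i * \<xi>' i \<omega>) ` I) \<partial>P')"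
  proof (intro allI impI)
    fix u :: "'c \<Rightarrow> real"
    \<comment> \<open>With \<open>t = u i0\<close> the weight at \<open>i0\<close> becomes
      \<open>max (u i0) (u i0)\<close>, so \<open>integral_max_tilt\<close> returns the maximum with
      the weights \<open>u\<close> themselves.\<close>
    have m: "(\<lambda>v. max (u i0) (Max ((\<lambda>i. u i * v i) ` I))) \<in> borel_measurable (\<Pi>\<^sub>M i\<in>I. borel)"
      using A.fin by (intro borel_measurable_max borel_measurable_Max) auto
    have "(\<integral>\<omega>. max (u i0) (A.max_ratio u \<omega>) \<partial>A.tilt) = (\<integral>\<omega>. max (u i0) (B.max_ratio u \<omega>) \<partial>B.tilt)"
      using integral_joint_distr[of I A.ratio A.tilt, OF _ m] integral_joint_distr[of I B.ratio B.tilt, OF _ m] eq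
      by (simp add: same_ratios_def A.max_ratio_def B.max_ratio_def cong: image_cong_simp)
    then show "(\<integral>\<omega>. Max ((\<lambda>i. u i * \<xi> i \<omega>) ` I) \<partial>P) = (\<integral>\<omega>. Max ((\<lambda>i. u i * \<xi>' i \<omega>) ` I) \<partial>P')"
      unfolding A.integral_max_tilt B.integral_max_tilt by simp
  qed
qed

theorem zonoid_iff_max:
  "(\<forall>u. (\<integral>\<omega>. \<bar>\<Sum>i\<in>I. u i * \<xi> i \<omega>\<bar> \<partial>P) = (\<integral>\<omega>. \<bar>\<Sum>i\<in>I. u i * \<xi>' i \<omega>\<bar> \<partial>P')) \<longleftrightarrow>
   (\<forall>u. (\<forall>i\<in>I. 0 < u i) \<longrightarrow> (\<integral>\<omega>. Max ((\<lambda>i. u i * \<xi> i \<omega>) ` I) \<partial>P) = (\<integral>\<omega>. Max ((\<lambda>i. u i * \<xi>' i \<omega>) ` I) \<partial>P'))"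
  unfolding zonoid_iff_same_ratios max_iff_same_ratios ..

end

section \<open>LePage series of finite families\<close>

text \<open>Where the sequence is unbounded, its set of upper bounds is empty and the supremum is
  the default value \<open>LEAST z. False\<close>, the same at all such points. The function is
  therefore constant off the measurable set of boundedness.\<close>

lemma borel_measurable_SUP_real:
  fixes f :: "nat \<Rightarrow> 'a \<Rightarrow> real"
  assumes [measurable]: "\<And>k. f k \<in> borel_measurable M"
  shows "(\<lambda>x. SUP k. f k x) \<in> borel_measurable M"
proof -
  define c :: real where "c = (LEAST z. False)"
  define Q where "Q x \<longleftrightarrow> (\<exists>n::nat. \<forall>k. f k x \<le> real n)" for x
  have [measurable]: "Measurable.pred M Q" unfolding Q_def by measurable
  have Q: "Q x \<longleftrightarrow> bdd_above (range (\<lambda>k. f k x))" for x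
  proof
    assume "bdd_above (range (\<lambda>k. f k x))"
    then obtain b where "\<And>k. f k x \<le> b" by (auto simp: bdd_above_def)
    moreover obtain n :: nat where "b \<le> real n" using real_arch_simple by blast
    ultimately show "Q x" unfolding Q_def using order_trans by blast
  qed (auto simp: Q_def bdd_above_def)
  have "(\<lambda>x. SUP k. f k x) = (\<lambda>x. if Q x then (SUP k. if Q x then f k x else 0) else c)"
  proof
    fix x
    have "(SUP k. f k x) = c" if "\<not> Q x"
    proof -
      have "(\<forall>y\<in>range (\<lambda>k. f k x). y \<le> z) = False" for z
        using that unfolding Q by (auto simp: bdd_above_def)
      then show ?thesis unfolding Sup_real_def c_def by (intro arg_cong[of _ _ Least] ext)
    qed
    then show "(SUP k. f k x) = (if Q x then (SUP k. if Q x then f k x else 0) else c)" by simp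
  qed
  moreover have "(\<lambda>x. if Q x then (SUP k. if Q x then f k x else 0) else c) \<in> borel_measurable M"
  proof (rule measurable_If)
    show "(\<lambda>x. SUP k. if Q x then f k x else 0) \<in> borel_measurable M"
    proof (rule borel_measurable_cSUP)
      show "bdd_above ((\<lambda>k. if Q x then f k x else 0) ` UNIV)" for x by (auto simp: Q)
    qed (simp, measurable)
    show "{x \<in> space M. Q x} \<in> sets M" by measurable
  qed simp
  ultimately show ?thesis by simp
qed

lemma Int_stable_vimage: "Int_stable {X -` A \<inter> \<Omega> | A. A \<in> sets S}"
proof (rule Int_stableI)
  fix a b assume "a \<in> {X -` A \<inter> \<Omega> | A. A \<in> sets S}" "b \<in> {X -` A \<inter> \<Omega> | A. A \<in> sets S}"
  then obtain A B where "A \<in> sets S" "a = X -` A \<inter> \<Omega>" "B \<in> sets S" "b = X -` B \<inter> \<Omega>" by auto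
  then have "A \<inter> B \<in> sets S" "a \<inter> b = X -` (A \<inter> B) \<inter> \<Omega>" by auto
  then show "a \<inter> b \<in> {X -` A \<inter> \<Omega> | A. A \<in> sets S}" by blast
qed

text \<open>Events about the sequence of the \<open>g (Xs k)\<close> are events about the sequence
  of the \<open>Xs k\<close>, so independence from the arrivals is inherited. The marks are real
  like the arrivals, and \<open>indep_elements\<close> with two value types becomes
  \<open>indep_var\<close>.\<close>

lemma lepage_marksI:
  fixes Xs :: "nat \<Rightarrow> 'w \<Rightarrow> 's" and g :: "'s \<Rightarrow> real"
  assumes "prob_space M" and iid: "iid_std_exponential M \<zeta>"
    and ind: "prob_space.indep_vars M (\<lambda>_. S) Xs UNIV"
    and g: "g \<in> borel_measurable S"
    and distr: "\<And>k. distr M borel (\<lambda>\<omega>. g (Xs k \<omega>)) = \<nu>"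
    and el: "indep_elements M (\<Pi>\<^sub>M k\<in>UNIV. S) (\<lambda>\<omega> k. Xs k \<omega>) (\<Pi>\<^sub>M k\<in>UNIV. borel) (\<lambda>\<omega> k. arrival \<zeta> k \<omega>)"
  shows "lepage_marks M \<zeta> (\<lambda>k \<omega>. g (Xs k \<omega>)) \<nu>"
proof -
  interpret prob_space M by fact
  have X [measurable]: "Xs k \<in> measurable M S" for k using ind by (auto simp: indep_vars_def)
  note g [measurable]
  have mX: "(\<lambda>\<omega> k. Xs k \<omega>) \<in> measurable M (\<Pi>\<^sub>M k\<in>UNIV. S)"
    and mA: "(\<lambda>\<omega> k. arrival \<zeta> k \<omega>) \<in> measurable M (\<Pi>\<^sub>M k\<in>UNIV. borel)"
    and iset: "indep_set {(\<lambda>\<omega> k. Xs k \<omega>) -` A \<inter> space M | A. A \<in> sets (\<Pi>\<^sub>M k\<in>UNIV. S)}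
                  {(\<lambda>\<omega> k. arrival \<zeta> k \<omega>) -` B \<inter> space M | B. B \<in> sets (\<Pi>\<^sub>M k\<in>UNIV. borel)}"
    using el by (auto simp: indep_elements_def)
  have mG: "(\<lambda>x k. g (x k)) \<in> measurable (\<Pi>\<^sub>M k\<in>(UNIV :: nat set). S) (\<Pi>\<^sub>M k\<in>UNIV. borel)"
    by (rule measurable_PiM_single') auto
  have mgX: "(\<lambda>\<omega> k. g (Xs k \<omega>)) \<in> measurable M (\<Pi>\<^sub>M k\<in>UNIV. borel)"
    by (rule measurable_PiM_single') auto
  have sub: "{(\<lambda>\<omega> k. g (Xs k \<omega>)) -` A \<inter> space M | A. A \<in> sets (\<Pi>\<^sub>M k\<in>(UNIV :: nat set). borel)} \<subseteq>
      {(\<lambda>\<omega> k. Xs k \<omega>) -` A \<inter> space M | A. A \<in> sets (\<Pi>\<^sub>M k\<in>UNIV. S)}"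
  proof safe
    fix A assume A: "A \<in> sets (\<Pi>\<^sub>M k\<in>(UNIV :: nat set). (borel :: real measure))"
    have "(\<lambda>\<omega> k. g (Xs k \<omega>)) -` A \<inter> space M =
       (\<lambda>\<omega> k. Xs k \<omega>) -` ((\<lambda>x k. g (x k)) -` A \<inter> space (\<Pi>\<^sub>M k\<in>(UNIV :: nat set). S)) \<inter> space M"
      using measurable_space[OF mX] by auto
    then show "\<exists>A'. (\<lambda>\<omega> k. g (Xs k \<omega>)) -` A \<inter> space M = (\<lambda>\<omega> k. Xs k \<omega>) -` A' \<inter> space M \<and> A' \<in> sets (\<Pi>\<^sub>M k\<in>UNIV. S)"
      using measurable_sets[OF mG A] by blast
  qed
  have "indep_set {(\<lambda>\<omega> k. g (Xs k \<omega>)) -` A \<inter> space M | A. A \<in> sets (\<Pi>\<^sub>M k\<in>UNIV. borel)}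
                  {(\<lambda>\<omega> k. arrival \<zeta> k \<omega>) -` B \<inter> space M | B. B \<in> sets (\<Pi>\<^sub>M k\<in>UNIV. borel)}"
  proof (rule indep_setI)
    show "{(\<lambda>\<omega> k. g (Xs k \<omega>)) -` A \<inter> space M | A. A \<in> sets (\<Pi>\<^sub>M k\<in>(UNIV :: nat set). borel)} \<subseteq> events"
      using sub indep_setD_ev1[OF iset] by (rule order_trans)
    show "{(\<lambda>\<omega> k. arrival \<zeta> k \<omega>) -` B \<inter> space M | B. B \<in> sets (\<Pi>\<^sub>M k\<in>(UNIV :: nat set). borel)} \<subseteq> events"
      by (rule indep_setD_ev2[OF iset])
    fix a b
    assume "a \<in> {(\<lambda>\<omega> k. g (Xs k \<omega>)) -` A \<inter> space M | A. A \<in> sets (\<Pi>\<^sub>M k\<in>(UNIV :: nat set). borel)}"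
      and b: "b \<in> {(\<lambda>\<omega> k. arrival \<zeta> k \<omega>) -` B \<inter> space M | B. B \<in> sets (\<Pi>\<^sub>M k\<in>(UNIV :: nat set). borel)}"
    then have "a \<in> {(\<lambda>\<omega> k. Xs k \<omega>) -` A \<inter> space M | A. A \<in> sets (\<Pi>\<^sub>M k\<in>UNIV. S)}"
      using sub by (elim subsetD)
    from indep_setD[OF iset this b] show "prob (a \<inter> b) = prob a * prob b" .
  qed
  \<comment> \<open>The families of preimages are stable under intersection, so independence extends
    to the generated \<sigma>-algebras that define \<open>indep_var\<close>.\<close>
  then have "indep_var (\<Pi>\<^sub>M k\<in>UNIV. borel) (\<lambda>\<omega> k. g (Xs k \<omega>)) (\<Pi>\<^sub>M k\<in>UNIV. borel) (\<lambda>\<omega> k. arrival \<zeta> k \<omega>)"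
    unfolding indep_var_eq using mgX mA by (intro conjI indep_set_sigma_sets Int_stable_vimage)
  moreover have "indep_vars (\<lambda>_. borel) (\<lambda>k \<omega>. g (Xs k \<omega>)) UNIV"
    using indep_vars_compose2[OF ind, of "\<lambda>_. g" "\<lambda>_. borel"] g by simp
  ultimately show ?thesis
    using iid distr by unfold_locales auto
qed

lemma integrable_id_distr:
  fixes f :: "'a \<Rightarrow> real"
  assumes "integrable M f"
  shows "integrable (distr M borel f) (\<lambda>x. x)"
  using assms by (subst integrable_distr_eq) auto

text \<open>Vectors and finite-dimensional marginals of processes are both families indexed by a finite set \<open>I\<close>.
  Of the input of a LePage series only its scalar functionals matter.\<close>

locale lepage_family = P: prob_space P for P :: "'p measure" +
  fixes I :: "'i set" and M :: "'w measure" and \<zeta> :: "nat \<Rightarrow> 'w \<Rightarrow> real"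
    and \<xi>s :: "nat \<Rightarrow> 'i \<Rightarrow> 'w \<Rightarrow> real" and \<xi> :: "'i \<Rightarrow> 'p \<Rightarrow> real"
  assumes fin: "finite I"
    and int: "\<And>i. i \<in> I \<Longrightarrow> integrable P (\<xi> i)"
    and marks: "\<And>\<phi>. \<phi> \<in> borel_measurable (\<Pi>\<^sub>M i\<in>I. borel) \<Longrightarrow>
      lepage_marks M \<zeta> (\<lambda>k \<omega>. \<phi> (\<lambda>i\<in>I. \<xi>s k i \<omega>)) (distr P borel (\<lambda>\<omega>. \<phi> (\<lambda>i\<in>I. \<xi> i \<omega>)))"
begin

lemma \<xi>_meas [measurable]: "i \<in> I \<Longrightarrow> \<xi> i \<in> borel_measurable P"
  using int by auto

lemma \<xi>_restrict_meas [measurable]: "(\<lambda>\<omega>. \<lambda>i\<in>I. \<xi> i \<omega>) \<in> measurable P (\<Pi>\<^sub>M i\<in>I. borel)"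
  by (rule measurable_restrict) measurable

lemma marks_component: "i \<in> I \<Longrightarrow> lepage_marks M \<zeta> (\<lambda>k \<omega>. \<xi>s k i \<omega>) (distr P borel (\<xi> i))"
  using marks[of "\<lambda>v. v i"] measurable_component_singleton[of i I "\<lambda>_. borel"] by simp

sublocale exp_arrivals M \<zeta>
proof -
  \<comment> \<open>The zero functional is available for every \<open>I\<close>, even the empty one,
    and already carries the facts about the arrivals.\<close>
  interpret L: lepage_marks M \<zeta> "\<lambda>k \<omega>. 0" "distr P borel (\<lambda>\<omega>. 0)"
    using marks[of "\<lambda>_. 0"] by simp
  show "exp_arrivals M \<zeta>" by unfold_locales
qed

lemma \<xi>s_meas [measurable]: "i \<in> I \<Longrightarrow> \<xi>s k i \<in> borel_measurable M"
  using lepage_marks.\<psi>_meas[OF marks_component] .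

definition X :: "'i \<Rightarrow> 'w \<Rightarrow> real" where
  "X i \<omega> = (\<Sum>k. inverse (arrival \<zeta> k \<omega>) * \<xi>s k i \<omega>)"

definition Y :: "'i \<Rightarrow> 'w \<Rightarrow> real" where
  "Y i \<omega> = (SUP k. inverse (arrival \<zeta> k \<omega>) * \<xi>s k i \<omega>)"

lemma X_meas [measurable]: "i \<in> I \<Longrightarrow> X i \<in> borel_measurable M"
  unfolding X_def[abs_def] by measurable

lemma Y_meas [measurable]: "i \<in> I \<Longrightarrow> Y i \<in> borel_measurable M"
  unfolding Y_def[abs_def] by (intro borel_measurable_SUP_real) measurable

lemma lin_meas: "(\<lambda>v. \<Sum>i\<in>I. u i * v i :: real) \<in> borel_measurable (\<Pi>\<^sub>M i\<in>I. borel)"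
  by measurable

lemma lin_int: "integrable P (\<lambda>\<omega>. \<Sum>i\<in>I. u i * \<xi> i \<omega>)"
  using int by auto

end

section \<open>Characteristic function of the symmetric series\<close>

locale symmetric_lepage_family = lepage_family +
  assumes sym: "joint_distr I P \<xi> = joint_distr I P (\<lambda>i \<omega>. - \<xi> i \<omega>)"
begin

lemma sym_lin: "distr (distr P borel (\<lambda>\<omega>. \<Sum>i\<in>I. u i * \<xi> i \<omega>)) borel uminus = distr P borel (\<lambda>\<omega>. \<Sum>i\<in>I. u i * \<xi> i \<omega>)"
proof -
  have m: "(\<lambda>\<omega>. \<lambda>i\<in>I. - \<xi> i \<omega>) \<in> measurable P (\<Pi>\<^sub>M i\<in>I. borel)"
    by (rule measurable_restrict) measurable
  have [measurable]: "(\<lambda>\<omega>. \<Sum>i\<in>I. u i * \<xi> i \<omega>) \<in> borel_measurable P" using lin_int by auto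
  have "distr P borel (\<lambda>\<omega>. \<Sum>i\<in>I. u i * \<xi> i \<omega>) = distr (joint_distr I P \<xi>) borel (\<lambda>v. \<Sum>i\<in>I. u i * v i)"
    unfolding joint_distr_def using lin_meas by (subst distr_distr) (auto simp: comp_def intro!: distr_cong)
  also have "\<dots> = distr P borel (\<lambda>\<omega>. \<Sum>i\<in>I. u i * - \<xi> i \<omega>)"
    unfolding sym unfolding joint_distr_def using lin_meas m by (subst distr_distr) (auto simp: comp_def intro!: distr_cong)
  also have "\<dots> = distr (distr P borel (\<lambda>\<omega>. \<Sum>i\<in>I. u i * \<xi> i \<omega>)) borel uminus"
    by (subst distr_distr) (auto simp: comp_def sum_negf intro!: distr_cong)
  finally show ?thesis ..
qed

lemma AE_summable_component:
  assumes "i \<in> I"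
  shows "AE \<omega> in M. summable (\<lambda>k. inverse (arrival \<zeta> k \<omega>) * \<xi>s k i \<omega>)"
proof (rule lepage_marks.AE_summable_series[OF marks_component[OF assms] integrable_id_distr[OF int[OF assms]]])
  have "(\<Sum>j\<in>I. (if j = i then 1 else 0) * \<xi> j \<omega>) = \<xi> i \<omega>" for \<omega>
    using fin assms by (simp add: if_distribR if_distrib[of "\<lambda>x. x * _"] cong: if_cong)
  then show "distr (distr P borel (\<xi> i)) borel uminus = distr P borel (\<xi> i)"
    using sym_lin[of "\<lambda>j. if j = i then 1 else 0"] by simp
qed

lemma AE_summable_components:
  "AE \<omega> in M. \<forall>i\<in>I. summable (\<lambda>k. inverse (arrival \<zeta> k \<omega>) * \<xi>s k i \<omega>)"
  using AE_finite_allI[OF fin AE_summable_component] .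

text \<open>A linear combination of the component series is the scalar series of the combined marks.
  This exchange holds where all components converge, hence almost surely; the scalar result then
  applies.\<close>

lemma char_X: "(\<integral>\<omega>. iexp (\<Sum>i\<in>I. u i * X i \<omega>) \<partial>M) = of_real (exp (- cos_const * (\<integral>\<omega>. \<bar>\<Sum>i\<in>I. u i * \<xi> i \<omega>\<bar> \<partial>P)))"
proof -
  have [measurable]: "(\<lambda>\<omega>. \<Sum>i\<in>I. u i * \<xi> i \<omega>) \<in> borel_measurable P" using lin_int by auto
  have L: "lepage_marks M \<zeta> (\<lambda>k \<omega>. \<Sum>i\<in>I. u i * \<xi>s k i \<omega>) (distr P borel (\<lambda>\<omega>. \<Sum>i\<in>I. u i * \<xi> i \<omega>))"
    using marks[OF lin_meas, of u] by simp
  have "(\<integral>\<omega>. iexp (\<Sum>i\<in>I. u i * X i \<omega>) \<partial>M) =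
    (\<integral>\<omega>. iexp (\<Sum>k. inverse (arrival \<zeta> k \<omega>) * (\<Sum>i\<in>I. u i * \<xi>s k i \<omega>)) \<partial>M)"
  proof (rule Bochner_Integration.integral_cong_AE)
    show "AE \<omega> in M. iexp (\<Sum>i\<in>I. u i * X i \<omega>) = iexp (\<Sum>k. inverse (arrival \<zeta> k \<omega>) * (\<Sum>i\<in>I. u i * \<xi>s k i \<omega>))"
      using AE_summable_components
    proof eventually_elim
      case (elim \<omega>)
      have "(\<lambda>k. \<Sum>i\<in>I. u i * (inverse (arrival \<zeta> k \<omega>) * \<xi>s k i \<omega>)) sums (\<Sum>i\<in>I. u i * X i \<omega>)"
        unfolding X_def using elim by (intro sums_sum sums_mult) (auto intro: summable_sums)
      moreover have "(\<Sum>i\<in>I. u i * (inverse (arrival \<zeta> k \<omega>) * \<xi>s k i \<omega>)) = inverse (arrival \<zeta> k \<omega>) * (\<Sum>i\<in>I. u i * \<xi>s k i \<omega>)" for k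
        by (simp add: sum_distrib_left mult_ac)
      ultimately have "(\<Sum>i\<in>I. u i * X i \<omega>) = (\<Sum>k. inverse (arrival \<zeta> k \<omega>) * (\<Sum>i\<in>I. u i * \<xi>s k i \<omega>))"
        by (simp add: sums_unique)
      then show ?case by simp
    qed
  qed measurable
  also have "\<dots> = of_real (exp (- cos_const * (\<integral>x. \<bar>x\<bar> \<partial>distr P borel (\<lambda>\<omega>. \<Sum>i\<in>I. u i * \<xi> i \<omega>))))"
    by (rule lepage_marks.char_series[OF L integrable_id_distr[OF lin_int] sym_lin])
  also have "(\<integral>x. \<bar>x\<bar> \<partial>distr P borel (\<lambda>\<omega>. \<Sum>i\<in>I. u i * \<xi> i \<omega>)) = (\<integral>\<omega>. \<bar>\<Sum>i\<in>I. u i * \<xi> i \<omega>\<bar> \<partial>P)"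
    by (rule integral_distr) measurable
  finally show ?thesis .
qed

end

text \<open>The exponential is injective and \<open>cos_const\<close> is positive, so equality of
  characteristic functions is equality of the first absolute moments in the exponents.\<close>

theorem sum_joint_distr_iff:
  assumes A: "symmetric_lepage_family P I M \<zeta> \<xi>s \<xi>" and B: "symmetric_lepage_family P' I M' \<zeta>' \<xi>s' \<xi>'"
  shows "joint_distr I M (lepage_family.X \<zeta> \<xi>s) = joint_distr I M' (lepage_family.X \<zeta>' \<xi>s') \<longleftrightarrow>
    (\<forall>u. (\<integral>\<omega>. \<bar>\<Sum>i\<in>I. u i * \<xi> i \<omega>\<bar> \<partial>P) = (\<integral>\<omega>. \<bar>\<Sum>i\<in>I. u i * \<xi>' i \<omega>\<bar> \<partial>P'))"
proof -
  interpret A: symmetric_lepage_family P I M \<zeta> \<xi>s \<xi> by fact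
  interpret B: symmetric_lepage_family P' I M' \<zeta>' \<xi>s' \<xi>' by fact
  have "joint_distr I M A.X = joint_distr I M' B.X \<longleftrightarrow>
    (\<forall>u. (\<integral>\<omega>. iexp (\<Sum>i\<in>I. u i * A.X i \<omega>) \<partial>M) = (\<integral>\<omega>. iexp (\<Sum>i\<in>I. u i * B.X i \<omega>) \<partial>M'))"
    by (rule joint_distr_eq_iff_char[OF A.fin A.finite_measure_axioms B.finite_measure_axioms]) auto
  then show ?thesis
    unfolding A.char_X B.char_X using cos_const_pos by simp
qed

section \<open>Distribution function of the positive maximum\<close>

locale positive_lepage_family = lepage_family P I M \<zeta> \<xi>s \<xi> + positive_family P I \<xi> i0
  for P :: "'p measure" and I :: "'i set" and M :: "'w measure" and \<zeta> \<xi>s \<xi> i0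
begin

lemma AE_bdd_components:
  "AE \<omega> in M. \<forall>i\<in>I. bdd_above (range (\<lambda>k. inverse (arrival \<zeta> k \<omega>) * \<xi>s k i \<omega>))"
  by (intro AE_finite_allI[OF fin] lepage_marks.AE_bdd_above[OF marks_component] integrable_id_distr int)

text \<open>The first term is already positive, and the supremum dominates it because the terms are
  almost surely bounded.\<close>

lemma AE_Y_pos: "AE \<omega> in M. \<forall>i\<in>I. 0 < Y i \<omega>"
proof -
  have "AE \<omega> in M. \<forall>i\<in>I. 0 < \<xi>s 0 i \<omega>"
  proof (rule AE_finite_allI[OF fin])
    fix i assume i: "i \<in> I"
    have "AE \<omega> in P. 0 < \<xi> i \<omega>" using pos i by (auto elim: eventually_mono)
    then have "AE x in distr P borel (\<xi> i). 0 < x" using i by (subst AE_distr_iff) auto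
    also have "distr P borel (\<xi> i) = distr M borel (\<xi>s 0 i)"
      by (rule lepage_marks.distr_\<psi>[OF marks_component[OF i], symmetric])
    finally show "AE \<omega> in M. 0 < \<xi>s 0 i \<omega>" using i by (subst (asm) AE_distr_iff) auto
  qed
  then show ?thesis using AE_bdd_components AE_arrival_pos
  proof eventually_elim
    case (elim \<omega>)
    show ?case
    proof
      fix i assume i: "i \<in> I"
      have "0 < inverse (arrival \<zeta> 0 \<omega>) * \<xi>s 0 i \<omega>" using elim i by simp
      also have "\<dots> \<le> Y i \<omega>" unfolding Y_def using elim(2) i by (intro cSUP_upper) auto
      finally show "0 < Y i \<omega>" .
    qed
  qed
qed

lemma measure_Y_le_nonpos:
  assumes j: "j \<in> I" "y j \<le> 0"
  shows "measure M {\<omega> \<in> space M. \<forall>i\<in>I. Y i \<omega> \<le> y i} = 0"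
proof -
  have "measure M {\<omega> \<in> space M. \<forall>i\<in>I. Y i \<omega> \<le> y i} = measure M {}"
  proof (intro measure_eq_AE sets.sets_Collect_finite_All fin)
    show "AE \<omega> in M. \<omega> \<in> {\<omega> \<in> space M. \<forall>i\<in>I. Y i \<omega> \<le> y i} \<longleftrightarrow> \<omega> \<in> {}"
      using AE_Y_pos by eventually_elim (use j in force)
  qed auto
  then show ?thesis by simp
qed

text \<open>All bounds \<open>Y i \<le> 1 / u i\<close> hold exactly when, for each
  \<open>k\<close>, the mark \<phi> given by the weighted maximum of the coordinates is at most the
  arrival \<open>k\<close>. This is the scalar event already evaluated.\<close>

lemma measure_Y_le:
  assumes u: "\<And>i. i \<in> I \<Longrightarrow> 0 < u i"
  shows "measure M {\<omega> \<in> space M. \<forall>i\<in>I. Y i \<omega> \<le> 1 / u i} = exp (- (\<integral>\<omega>. Max ((\<lambda>i. u i * \<xi> i \<omega>) ` I) \<partial>P))"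
proof -
  define \<phi> where "\<phi> v = Max ((\<lambda>i. u i * v i) ` I)" for v :: "'i \<Rightarrow> real"
  have \<phi>_meas [measurable]: "\<phi> \<in> borel_measurable (\<Pi>\<^sub>M i\<in>I. borel)"
    unfolding \<phi>_def[abs_def] using fin by (intro borel_measurable_Max borel_measurable_times measurable_component_singleton) auto
  interpret L: lepage_marks M \<zeta> "\<lambda>k \<omega>. \<phi> (\<lambda>i\<in>I. \<xi>s k i \<omega>)" "distr P borel (\<lambda>\<omega>. \<phi> (\<lambda>i\<in>I. \<xi> i \<omega>))"
    by (rule marks[OF \<phi>_meas])
  have \<phi>_le: "\<phi> (\<lambda>i\<in>I. w i) \<le> c \<longleftrightarrow> (\<forall>i\<in>I. u i * w i \<le> c)" for w c
    unfolding \<phi>_def using fin i0 by (subst Max_le_iff) auto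
  have \<phi>_eq: "\<phi> (\<lambda>i\<in>I. \<xi> i \<omega>) = Max ((\<lambda>i. u i * \<xi> i \<omega>) ` I)" for \<omega>
    unfolding \<phi>_def by (simp cong: image_cong_simp)
  have \<phi>_int: "integrable P (\<lambda>\<omega>. \<phi> (\<lambda>i\<in>I. \<xi> i \<omega>))"
    unfolding \<phi>_eq using fin i0 int by (intro integrable_Max) auto
  have "measure M {\<omega> \<in> space M. \<forall>i\<in>I. Y i \<omega> \<le> 1 / u i} = prob {\<omega> \<in> space M. \<forall>k. \<phi> (\<lambda>i\<in>I. \<xi>s k i \<omega>) \<le> arrival \<zeta> k \<omega>}"
  proof (rule measure_eq_AE)
    show "{\<omega> \<in> space M. \<forall>i\<in>I. Y i \<omega> \<le> 1 / u i} \<in> sets M"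
      using fin by (intro sets.sets_Collect_finite_All) auto
    show "{\<omega> \<in> space M. \<forall>k. \<phi> (\<lambda>i\<in>I. \<xi>s k i \<omega>) \<le> arrival \<zeta> k \<omega>} \<in> sets M" by measurable
    show "AE \<omega> in M. \<omega> \<in> {\<omega> \<in> space M. \<forall>i\<in>I. Y i \<omega> \<le> 1 / u i} \<longleftrightarrow>
        \<omega> \<in> {\<omega> \<in> space M. \<forall>k. \<phi> (\<lambda>i\<in>I. \<xi>s k i \<omega>) \<le> arrival \<zeta> k \<omega>}"
      using AE_bdd_components AE_arrival_pos
    proof eventually_elim
      case (elim \<omega>)
      have "Y i \<omega> \<le> 1 / u i \<longleftrightarrow> (\<forall>k. u i * \<xi>s k i \<omega> \<le> arrival \<zeta> k \<omega>)" if i: "i \<in> I" for i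
      proof -
        have "Y i \<omega> \<le> 1 / u i \<longleftrightarrow> (\<forall>k. inverse (arrival \<zeta> k \<omega>) * \<xi>s k i \<omega> \<le> 1 / u i)"
          unfolding Y_def using elim(1) i by (subst cSUP_le_iff) auto
        also have "\<dots> \<longleftrightarrow> (\<forall>k. u i * \<xi>s k i \<omega> \<le> arrival \<zeta> k \<omega>)"
        proof (intro all_cong1)
          fix k
          have "0 < arrival \<zeta> k \<omega>" "0 < u i" using elim(2) u[OF i] by auto
          then show "inverse (arrival \<zeta> k \<omega>) * \<xi>s k i \<omega> \<le> 1 / u i \<longleftrightarrow> u i * \<xi>s k i \<omega> \<le> arrival \<zeta> k \<omega>"
            by (simp add: field_simps)
        qed
        finally show ?thesis .
      qed
      then show ?case by (auto simp: \<phi>_le)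
    qed
  qed
  also have "\<dots> = exp (- (\<integral>x. max 0 x \<partial>distr P borel (\<lambda>\<omega>. \<phi> (\<lambda>i\<in>I. \<xi> i \<omega>))))"
    by (rule L.prob_marks_le_arrivals[OF integrable_id_distr[OF \<phi>_int]])
  also have "(\<integral>x. max 0 x \<partial>distr P borel (\<lambda>\<omega>. \<phi> (\<lambda>i\<in>I. \<xi> i \<omega>))) = (\<integral>\<omega>. max 0 (\<phi> (\<lambda>i\<in>I. \<xi> i \<omega>)) \<partial>P)"
    by (rule integral_distr) measurable
  \<comment> \<open>The weighted maximum dominates its entry at \<open>i0\<close>, which is almost
    surely positive, so the positive part changes nothing.\<close>
  also have "\<dots> = (\<integral>\<omega>. \<phi> (\<lambda>i\<in>I. \<xi> i \<omega>) \<partial>P)"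
  proof (rule Bochner_Integration.integral_cong_AE)
    show "AE \<omega> in P. max 0 (\<phi> (\<lambda>i\<in>I. \<xi> i \<omega>)) = \<phi> (\<lambda>i\<in>I. \<xi> i \<omega>)"
      using pos_i0
    proof eventually_elim
      case (elim \<omega>)
      have "u i0 * \<xi> i0 \<omega> \<le> \<phi> (\<lambda>i\<in>I. \<xi> i \<omega>)" using \<phi>_le[of "\<lambda>i. \<xi> i \<omega>" "\<phi> (\<lambda>i\<in>I. \<xi> i \<omega>)"] i0 by simp
      moreover have "0 < u i0 * \<xi> i0 \<omega>" using elim u[OF i0] by simp
      ultimately show ?case by simp
    qed
  qed measurable
  also have "\<dots> = (\<integral>\<omega>. Max ((\<lambda>i. u i * \<xi> i \<omega>) ` I) \<partial>P)"
    unfolding \<phi>_eq ..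
  finally show ?thesis .
qed

end

text \<open>On positive thresholds the distribution function of \<open>Y\<close> is the exponential
  of minus the expected weighted maximum, with weights the reciprocals; on the other thresholds it
  is 0. The laws thus agree exactly when all these expectations do.\<close>

theorem max_joint_distr_iff:
  assumes A: "positive_lepage_family P I M \<zeta> \<xi>s \<xi> i0" and B: "positive_lepage_family P' I M' \<zeta>' \<xi>s' \<xi>' i0"
  shows "joint_distr I M (lepage_family.Y \<zeta> \<xi>s) = joint_distr I M' (lepage_family.Y \<zeta>' \<xi>s') \<longleftrightarrow>
    (\<forall>u. (\<integral>\<omega>. \<bar>\<Sum>i\<in>I. u i * \<xi> i \<omega>\<bar> \<partial>P) = (\<integral>\<omega>. \<bar>\<Sum>i\<in>I. u i * \<xi>' i \<omega>\<bar> \<partial>P'))"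
proof -
  interpret A: positive_lepage_family P I M \<zeta> \<xi>s \<xi> i0 by fact
  interpret B: positive_lepage_family P' I M' \<zeta>' \<xi>s' \<xi>' i0 by fact
  interpret two_positive_families P P' I \<xi> \<xi>' i0 ..
  have box: "measure M {\<omega> \<in> space M. \<forall>i\<in>I. A.Y i \<omega> \<le> y i} = measure (joint_distr I M A.Y) (Pi\<^sub>E I (\<lambda>i. {..y i}))"
    "measure M' {\<omega> \<in> space M'. \<forall>i\<in>I. B.Y i \<omega> \<le> y i} = measure (joint_distr I M' B.Y) (Pi\<^sub>E I (\<lambda>i. {..y i}))" for y
  proof -
    have S: "Pi\<^sub>E I (\<lambda>i. {..y i}) \<in> sets (\<Pi>\<^sub>M i\<in>I. borel)" using A.fin by (intro sets_PiM_I_finite) auto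
    have m: "(\<lambda>\<omega>. \<lambda>i\<in>I. A.Y i \<omega>) \<in> measurable M (\<Pi>\<^sub>M i\<in>I. borel)" "(\<lambda>\<omega>. \<lambda>i\<in>I. B.Y i \<omega>) \<in> measurable M' (\<Pi>\<^sub>M i\<in>I. borel)"
      by (auto intro!: measurable_restrict)
    show "measure M {\<omega> \<in> space M. \<forall>i\<in>I. A.Y i \<omega> \<le> y i} = measure (joint_distr I M A.Y) (Pi\<^sub>E I (\<lambda>i. {..y i}))"
      "measure M' {\<omega> \<in> space M'. \<forall>i\<in>I. B.Y i \<omega> \<le> y i} = measure (joint_distr I M' B.Y) (Pi\<^sub>E I (\<lambda>i. {..y i}))"
      unfolding joint_distr_def measure_distr[OF m(1) S] measure_distr[OF m(2) S]
      by (auto intro!: arg_cong[of _ _ "measure M"] arg_cong[of _ _ "measure M'"] simp: PiE_iff)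
  qed
  have "joint_distr I M A.Y = joint_distr I M' B.Y \<longleftrightarrow>
    (\<forall>u. (\<forall>i\<in>I. 0 < u i) \<longrightarrow> (\<integral>\<omega>. Max ((\<lambda>i. u i * \<xi> i \<omega>) ` I) \<partial>P) = (\<integral>\<omega>. Max ((\<lambda>i. u i * \<xi>' i \<omega>) ` I) \<partial>P'))"
  proof
    assume eq: "joint_distr I M A.Y = joint_distr I M' B.Y"
    show "\<forall>u. (\<forall>i\<in>I. 0 < u i) \<longrightarrow> (\<integral>\<omega>. Max ((\<lambda>i. u i * \<xi> i \<omega>) ` I) \<partial>P) = (\<integral>\<omega>. Max ((\<lambda>i. u i * \<xi>' i \<omega>) ` I) \<partial>P')"
    proof (intro allI impI)
      fix u :: "_ \<Rightarrow> real" assume "\<forall>i\<in>I. 0 < u i"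
      then show "(\<integral>\<omega>. Max ((\<lambda>i. u i * \<xi> i \<omega>) ` I) \<partial>P) = (\<integral>\<omega>. Max ((\<lambda>i. u i * \<xi>' i \<omega>) ` I) \<partial>P')"
        using A.measure_Y_le[of u] B.measure_Y_le[of u] box[of "\<lambda>i. 1 / u i"] eq by simp
    qed
  next
    assume eq: "\<forall>u. (\<forall>i\<in>I. 0 < u i) \<longrightarrow> (\<integral>\<omega>. Max ((\<lambda>i. u i * \<xi> i \<omega>) ` I) \<partial>P) = (\<integral>\<omega>. Max ((\<lambda>i. u i * \<xi>' i \<omega>) ` I) \<partial>P')"
    show "joint_distr I M A.Y = joint_distr I M' B.Y"
    proof (rule joint_distr_eqI_cdf[OF A.fin A.finite_measure_axioms B.finite_measure_axioms])
      fix y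
      show "measure M {\<omega> \<in> space M. \<forall>i\<in>I. A.Y i \<omega> \<le> y i} = measure M' {\<omega> \<in> space M'. \<forall>i\<in>I. B.Y i \<omega> \<le> y i}"
      proof (cases "\<forall>i\<in>I. 0 < y i")
        case True
        have "(\<integral>\<omega>. Max ((\<lambda>i. 1 / y i * \<xi> i \<omega>) ` I) \<partial>P) = (\<integral>\<omega>. Max ((\<lambda>i. 1 / y i * \<xi>' i \<omega>) ` I) \<partial>P')"
          using True by (intro eq[rule_format]) auto
        then show ?thesis
          using A.measure_Y_le[of "\<lambda>i. 1 / y i"] B.measure_Y_le[of "\<lambda>i. 1 / y i"] True by simp
      next
        case False
        then obtain j where j: "j \<in> I" "y j \<le> 0" by force
        then show ?thesis using A.measure_Y_le_nonpos[of j y, OF j] B.measure_Y_le_nonpos[of j y, OF j] by simp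
      qed
    qed auto
  qed
  then show ?thesis unfolding zonoid_iff_max .
qed

section \<open>Vectors and processes\<close>

lemma borel_measurable_vec_lambda:
  "(\<lambda>v. \<chi> i. v i) \<in> measurable (\<Pi>\<^sub>M i\<in>(UNIV :: 'd :: finite set). borel) (borel :: (real ^ 'd) measure)"
  by (subst borel_measurable_euclidean_space) (auto simp: Basis_vec_def inner_axis)

lemma borel_measurable_vec_nth: "(\<lambda>x :: real ^ 'd. x $ i) \<in> borel_measurable borel"
  by (intro borel_measurable_continuous_onI continuous_intros)

lemma vec_to_fun_meas:
  "(\<lambda>x :: real ^ 'd. \<lambda>i\<in>UNIV. x $ i) \<in> measurable borel (\<Pi>\<^sub>M i\<in>UNIV. borel)"
  by (intro measurable_restrict borel_measurable_vec_nth)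

lemma distr_vec_eq_iff:
  fixes X :: "'w \<Rightarrow> real ^ 'd" and Y :: "'v \<Rightarrow> real ^ 'd"
  assumes X: "X \<in> borel_measurable M" and Y: "Y \<in> borel_measurable N"
  shows "distr M borel X = distr N borel Y \<longleftrightarrow>
    joint_distr UNIV M (\<lambda>i \<omega>. X \<omega> $ i) = joint_distr UNIV N (\<lambda>i \<omega>. Y \<omega> $ i)"
proof
  assume "distr M borel X = distr N borel Y"
  then have "distr (distr M borel X) (\<Pi>\<^sub>M i\<in>UNIV. borel) (\<lambda>x. \<lambda>i\<in>UNIV. x $ i)
    = distr (distr N borel Y) (\<Pi>\<^sub>M i\<in>UNIV. borel) (\<lambda>x. \<lambda>i\<in>UNIV. x $ i)" by simp
  then show "joint_distr UNIV M (\<lambda>i \<omega>. X \<omega> $ i) = joint_distr UNIV N (\<lambda>i \<omega>. Y \<omega> $ i)"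
    unfolding joint_distr_def distr_distr[OF vec_to_fun_meas X] distr_distr[OF vec_to_fun_meas Y] by (simp add: comp_def)
next
  have m: "(\<lambda>\<omega>. \<lambda>i\<in>UNIV. X \<omega> $ i) \<in> measurable M (\<Pi>\<^sub>M i\<in>UNIV. borel)"
    "(\<lambda>\<omega>. \<lambda>i\<in>UNIV. Y \<omega> $ i) \<in> measurable N (\<Pi>\<^sub>M i\<in>UNIV. borel)"
    using measurable_compose[OF X vec_to_fun_meas] measurable_compose[OF Y vec_to_fun_meas] by auto
  assume "joint_distr UNIV M (\<lambda>i \<omega>. X \<omega> $ i) = joint_distr UNIV N (\<lambda>i \<omega>. Y \<omega> $ i)"
  then have "distr (joint_distr UNIV M (\<lambda>i \<omega>. X \<omega> $ i)) borel (\<lambda>v. \<chi> i. v i) =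
     distr (joint_distr UNIV N (\<lambda>i \<omega>. Y \<omega> $ i)) borel (\<lambda>v. \<chi> i. v i)" by simp
  then show "distr M borel X = distr N borel Y"
    unfolding joint_distr_def distr_distr[OF borel_measurable_vec_lambda m(1)] distr_distr[OF borel_measurable_vec_lambda m(2)]
    by (simp add: comp_def restrict_UNIV)
qed

lemma zonoid_equivalent_vec_iff:
  "zonoid_equivalent_vec P \<xi> Q \<eta> \<longleftrightarrow>
    (\<forall>u :: 'd :: finite \<Rightarrow> real. (\<integral>\<omega>. \<bar>\<Sum>i\<in>UNIV. u i * \<xi> \<omega> $ i\<bar> \<partial>P) = (\<integral>\<omega>. \<bar>\<Sum>i\<in>UNIV. u i * \<eta> \<omega> $ i\<bar> \<partial>Q))"
  (is "?l \<longleftrightarrow> ?r")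
proof
  assume l: ?l
  show ?r
  proof
    fix u :: "'d \<Rightarrow> real"
    show "(\<integral>\<omega>. \<bar>\<Sum>i\<in>UNIV. u i * \<xi> \<omega> $ i\<bar> \<partial>P) = (\<integral>\<omega>. \<bar>\<Sum>i\<in>UNIV. u i * \<eta> \<omega> $ i\<bar> \<partial>Q)"
      using l[unfolded zonoid_equivalent_vec_def, rule_format, of "\<chi> i. u i"] by (simp add: inner_vec_def)
  qed
qed (auto simp: zonoid_equivalent_vec_def inner_vec_def)

lemma lepage_family_vec:
  fixes \<xi> :: "'p \<Rightarrow> real ^ 'd"
  assumes "prob_space P" and M: "prob_space M" and int: "integrable P \<xi>" and inp: "lepage_input_vec M \<zeta> \<xi>s P \<xi>"
  shows "lepage_family P UNIV M \<zeta> (\<lambda>k i \<omega>. \<xi>s k \<omega> $ i) (\<lambda>i \<omega>. \<xi> \<omega> $ i)"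
proof -
  interpret P: prob_space P by fact
  interpret M: prob_space M by fact
  have inp': "iid_std_exponential M \<zeta>" "M.indep_vars (\<lambda>_. borel) \<xi>s UNIV" "\<And>k. distr M borel (\<xi>s k) = distr P borel \<xi>"
    "indep_elements M (\<Pi>\<^sub>M k\<in>UNIV. borel) (\<lambda>\<omega> k. \<xi>s k \<omega>) (\<Pi>\<^sub>M k\<in>UNIV. borel) (\<lambda>\<omega> k. arrival \<zeta> k \<omega>)"
    using inp by (auto simp: lepage_input_vec_def iid_copies_vec_def)
  have \<xi>s: "\<xi>s k \<in> borel_measurable M" for k using inp'(2) by (auto simp: M.indep_vars_def)
  have \<xi>: "\<xi> \<in> borel_measurable P" using int by auto
  show ?thesis
  proof (intro lepage_family.intro lepage_family_axioms.intro)
    show "prob_space P" by fact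
    show "integrable P (\<lambda>\<omega>. \<xi> \<omega> $ i)" for i
      by (rule integrable_bounded_linear[OF bounded_linear_vec_nth int])
    fix \<phi> :: "('d \<Rightarrow> real) \<Rightarrow> real" assume \<phi>: "\<phi> \<in> borel_measurable (\<Pi>\<^sub>M i\<in>UNIV. borel)"
    define g where "g x = \<phi> (\<lambda>i\<in>UNIV. x $ i)" for x :: "real ^ 'd"
    have g: "g \<in> borel_measurable borel" unfolding g_def[abs_def] by (rule measurable_compose[OF vec_to_fun_meas \<phi>])
    have "lepage_marks M \<zeta> (\<lambda>k \<omega>. g (\<xi>s k \<omega>)) (distr P borel (\<lambda>\<omega>. g (\<xi> \<omega>)))"
    proof (rule lepage_marksI[OF M inp'(1,2) g _ inp'(4)])
      fix k
      have "distr (distr M borel (\<xi>s k)) borel g = distr (distr P borel \<xi>) borel g" by (simp only: inp'(3))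
      then show "distr M borel (\<lambda>\<omega>. g (\<xi>s k \<omega>)) = distr P borel (\<lambda>\<omega>. g (\<xi> \<omega>))"
        unfolding distr_distr[OF g \<xi>s] distr_distr[OF g \<xi>] by (simp add: comp_def)
    qed
    then show "lepage_marks M \<zeta> (\<lambda>k \<omega>. \<phi> (\<lambda>i\<in>UNIV. \<xi>s k \<omega> $ i)) (distr P borel (\<lambda>\<omega>. \<phi> (\<lambda>i\<in>UNIV. \<xi> \<omega> $ i)))"
      unfolding g_def .
  qed simp
qed

lemma symmetric_lepage_family_vec:
  fixes \<xi> :: "'p \<Rightarrow> real ^ 'd"
  assumes "prob_space P" "prob_space M" and int: "integrable P \<xi>" and "lepage_input_vec M \<zeta> \<xi>s P \<xi>"
    and sym: "symmetric_vec P \<xi>"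
  shows "symmetric_lepage_family P UNIV M \<zeta> (\<lambda>k i \<omega>. \<xi>s k \<omega> $ i) (\<lambda>i \<omega>. \<xi> \<omega> $ i)"
proof -
  have \<xi>: "\<xi> \<in> borel_measurable P" using int by auto
  interpret lepage_family P UNIV M \<zeta> "\<lambda>k i \<omega>. \<xi>s k \<omega> $ i" "\<lambda>i \<omega>. \<xi> \<omega> $ i"
    by (rule lepage_family_vec) fact+
  show ?thesis
  proof
    show "joint_distr UNIV P (\<lambda>i \<omega>. \<xi> \<omega> $ i) = joint_distr UNIV P (\<lambda>i \<omega>. - (\<xi> \<omega> $ i))"
      using distr_vec_eq_iff[of \<xi> P "\<lambda>\<omega>. - \<xi> \<omega>" P] \<xi> sym by (simp add: symmetric_vec_def)
  qed
qed

text \<open>Off convergence the sum in the vector space and the sums of the coordinates are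
  unrelated default values. They agree where every coordinate series converges, hence almost surely,
  which is enough for the laws.\<close>

lemma lepage_sum_vec_joint_distr:
  fixes \<xi> :: "'p \<Rightarrow> real ^ 'd"
  assumes "symmetric_lepage_family P UNIV M \<zeta> (\<lambda>k i \<omega>. \<xi>s k \<omega> $ i) (\<lambda>i \<omega>. \<xi> \<omega> $ i)"
    and \<xi>s [measurable]: "\<And>k. \<xi>s k \<in> borel_measurable M"
  shows "lepage_sum_vec \<zeta> \<xi>s \<in> borel_measurable M"
    and "joint_distr UNIV M (\<lambda>i \<omega>. lepage_sum_vec \<zeta> \<xi>s \<omega> $ i) = joint_distr UNIV M (lepage_family.X \<zeta> (\<lambda>k i \<omega>. \<xi>s k \<omega> $ i))"
proof -
  interpret symmetric_lepage_family P UNIV M \<zeta> "\<lambda>k i \<omega>. \<xi>s k \<omega> $ i" "\<lambda>i \<omega>. \<xi> \<omega> $ i" by fact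
  show m: "lepage_sum_vec \<zeta> \<xi>s \<in> borel_measurable M"
    unfolding lepage_sum_vec_def[abs_def] by measurable
  have "AE \<omega> in M. (\<lambda>i\<in>UNIV. lepage_sum_vec \<zeta> \<xi>s \<omega> $ i) = (\<lambda>i\<in>UNIV. X i \<omega>)"
    using AE_summable_components
  proof eventually_elim
    case (elim \<omega>)
    have "(\<lambda>k. inverse (arrival \<zeta> k \<omega>) *\<^sub>R \<xi>s k \<omega>) sums (\<chi> i. X i \<omega>)"
      unfolding sums_def
    proof (rule vec_tendstoI)
      fix i
      have "(\<lambda>n. \<Sum>k<n. inverse (arrival \<zeta> k \<omega>) * \<xi>s k \<omega> $ i) \<longlonglongrightarrow> X i \<omega>"
        unfolding X_def using elim by (intro summable_LIMSEQ) auto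
      then show "(\<lambda>n. (\<Sum>k<n. inverse (arrival \<zeta> k \<omega>) *\<^sub>R \<xi>s k \<omega>) $ i) \<longlonglongrightarrow> (\<chi> i. X i \<omega>) $ i"
        by simp
    qed
    then have "lepage_sum_vec \<zeta> \<xi>s \<omega> = (\<chi> i. X i \<omega>)" unfolding lepage_sum_vec_def by (rule sums_unique[symmetric])
    then show ?case by simp
  qed
  then show "joint_distr UNIV M (\<lambda>i \<omega>. lepage_sum_vec \<zeta> \<xi>s \<omega> $ i) = joint_distr UNIV M X"
    unfolding joint_distr_def
    by (intro distr_cong_AE refl measurable_compose[OF m vec_to_fun_meas] measurable_restrict X_meas) auto
qed

lemma positive_lepage_family_vec:
  fixes \<xi> :: "'p \<Rightarrow> real ^ 'd"
  assumes "prob_space P" "prob_space M" "integrable P \<xi>" "lepage_input_vec M \<zeta> \<xi>s P \<xi>" and pos: "positive_vec P \<xi>"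
  shows "positive_lepage_family P UNIV M \<zeta> (\<lambda>k i \<omega>. \<xi>s k \<omega> $ i) (\<lambda>i \<omega>. \<xi> \<omega> $ i) i0"
proof -
  interpret lepage_family P UNIV M \<zeta> "\<lambda>k i \<omega>. \<xi>s k \<omega> $ i" "\<lambda>i \<omega>. \<xi> \<omega> $ i"
    by (rule lepage_family_vec) fact+
  show ?thesis
    by unfold_locales (use int pos in \<open>auto simp: positive_vec_def\<close>)
qed

section \<open>Processes through their finite-dimensional marginals\<close>

lemma eq_fidi_iff:
  "eq_fidi T M X N Y \<longleftrightarrow> (\<forall>n\<ge>1. \<forall>t :: nat \<Rightarrow> 't. (\<forall>i<n. t i \<in> T) \<longrightarrow>
    joint_distr {..<n} M (\<lambda>i. X (t i)) = joint_distr {..<n} N (\<lambda>i. Y (t i)))"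
  by (simp add: eq_fidi_def joint_distr_def)

text \<open>A functional of the values at \<open>t 0\<close>, ..., \<open>t (n - 1)\<close> is a
  measurable function of the whole path, so independence of the copies passes to it. Its law depends
  only on the marginal at these indices, which \<open>eq_fidi\<close> provides.\<close>

lemma lepage_family_proc:
  fixes n :: nat and t :: "nat \<Rightarrow> 't"
  assumes "prob_space P" and M: "prob_space M" and int: "integrable_proc T P \<eta>" and inp: "lepage_input_proc T M \<zeta> \<eta>s P \<eta>"
    and n: "1 \<le> n" and t: "\<And>i. i < n \<Longrightarrow> t i \<in> T"
  shows "lepage_family P {..<n} M \<zeta> (\<lambda>k i. \<eta>s k (t i)) (\<lambda>i. \<eta> (t i))"
proof -
  interpret P: prob_space P by fact
  interpret M: prob_space M by fact
  have inp': "iid_std_exponential M \<zeta>" "M.indep_vars (\<lambda>_. \<Pi>\<^sub>M t\<in>T. borel) (\<lambda>k \<omega>. \<lambda>t\<in>T. \<eta>s k t \<omega>) UNIV"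
    "\<And>k. eq_fidi T M (\<eta>s k) P \<eta>"
    "indep_elements M (\<Pi>\<^sub>M k\<in>UNIV. \<Pi>\<^sub>M t\<in>T. borel) (\<lambda>\<omega> k. \<lambda>t\<in>T. \<eta>s k t \<omega>) (\<Pi>\<^sub>M k\<in>UNIV. borel) (\<lambda>\<omega> k. arrival \<zeta> k \<omega>)"
    using inp by (auto simp: lepage_input_proc_def iid_copies_proc_def)
  have \<eta>i: "integrable P (\<eta> (t i))" if "i < n" for i using int t[OF that] by (simp add: integrable_proc_def)
  have \<eta>m: "(\<lambda>\<omega>. \<lambda>i\<in>{..<n}. \<eta> (t i) \<omega>) \<in> measurable P (\<Pi>\<^sub>M i\<in>{..<n}. borel)"
    using \<eta>i by (intro measurable_restrict) auto
  have pick: "(\<lambda>f. \<lambda>i\<in>{..<n}. f (t i)) \<in> measurable (\<Pi>\<^sub>M t\<in>T. borel) (\<Pi>\<^sub>M i\<in>{..<n}. (borel :: real measure))"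
    using t by (intro measurable_restrict measurable_component_singleton) auto
  have restr: "(\<lambda>i\<in>{..<n}. (\<lambda>s\<in>T. \<eta>s k s \<omega>) (t i)) = (\<lambda>i\<in>{..<n}. \<eta>s k (t i) \<omega>)" for k \<omega>
    using t by (intro restrict_ext) auto
  have \<eta>sm: "(\<lambda>\<omega>. \<lambda>i\<in>{..<n}. \<eta>s k (t i) \<omega>) \<in> measurable M (\<Pi>\<^sub>M i\<in>{..<n}. borel)" for k
  proof -
    have "(\<lambda>\<omega>. \<lambda>s\<in>T. \<eta>s k s \<omega>) \<in> measurable M (\<Pi>\<^sub>M t\<in>T. borel)"
      using inp'(2) by (auto simp: M.indep_vars_def)
    from measurable_compose[OF this pick] show ?thesis unfolding restr .
  qed
  show ?thesis
  proof (intro lepage_family.intro lepage_family_axioms.intro)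
    show "prob_space P" by fact
    show "integrable P (\<eta> (t i))" if "i \<in> {..<n}" for i using \<eta>i that by simp
    fix \<phi> :: "(nat \<Rightarrow> real) \<Rightarrow> real" assume \<phi>: "\<phi> \<in> borel_measurable (\<Pi>\<^sub>M i\<in>{..<n}. borel)"
    define g where "g f = \<phi> (\<lambda>i\<in>{..<n}. f (t i))" for f :: "'t \<Rightarrow> real"
    have g: "g \<in> borel_measurable (\<Pi>\<^sub>M t\<in>T. borel)" unfolding g_def[abs_def] by (rule measurable_compose[OF pick \<phi>])
    have g_eq: "g (\<lambda>s\<in>T. \<eta>s k s \<omega>) = \<phi> (\<lambda>i\<in>{..<n}. \<eta>s k (t i) \<omega>)" for k \<omega>
      unfolding g_def restr ..
    have "lepage_marks M \<zeta> (\<lambda>k \<omega>. g (\<lambda>s\<in>T. \<eta>s k s \<omega>)) (distr P borel (\<lambda>\<omega>. \<phi> (\<lambda>i\<in>{..<n}. \<eta> (t i) \<omega>)))"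
    proof (rule lepage_marksI[OF M inp'(1,2) g _ inp'(4)])
      fix k
      have "joint_distr {..<n} M (\<lambda>i. \<eta>s k (t i)) = joint_distr {..<n} P (\<lambda>i. \<eta> (t i))"
        using inp'(3)[of k] n t unfolding eq_fidi_iff by blast
      then have "distr (joint_distr {..<n} M (\<lambda>i. \<eta>s k (t i))) borel \<phi> = distr (joint_distr {..<n} P (\<lambda>i. \<eta> (t i))) borel \<phi>" by simp
      then show "distr M borel (\<lambda>\<omega>. g (\<lambda>s\<in>T. \<eta>s k s \<omega>)) = distr P borel (\<lambda>\<omega>. \<phi> (\<lambda>i\<in>{..<n}. \<eta> (t i) \<omega>))"
        unfolding joint_distr_def distr_distr[OF \<phi> \<eta>sm] distr_distr[OF \<phi> \<eta>m] g_eq by (simp add: comp_def)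
    qed
    then show "lepage_marks M \<zeta> (\<lambda>k \<omega>. \<phi> (\<lambda>i\<in>{..<n}. \<eta>s k (t i) \<omega>)) (distr P borel (\<lambda>\<omega>. \<phi> (\<lambda>i\<in>{..<n}. \<eta> (t i) \<omega>)))"
      unfolding g_eq .
  qed simp
qed

lemma symmetric_lepage_family_proc:
  fixes n :: nat and t :: "nat \<Rightarrow> 't"
  assumes "prob_space P" "prob_space M" "integrable_proc T P \<eta>" "lepage_input_proc T M \<zeta> \<eta>s P \<eta>"
    and n: "1 \<le> n" and t: "\<And>i. i < n \<Longrightarrow> t i \<in> T" and sym: "symmetric_proc T P \<eta>"
  shows "symmetric_lepage_family P {..<n} M \<zeta> (\<lambda>k i. \<eta>s k (t i)) (\<lambda>i. \<eta> (t i))"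
proof -
  interpret lepage_family P "{..<n}" M \<zeta> "\<lambda>k i. \<eta>s k (t i)" "\<lambda>i. \<eta> (t i)"
    by (rule lepage_family_proc) fact+
  show ?thesis
  proof
    show "joint_distr {..<n} P (\<lambda>i. \<eta> (t i)) = joint_distr {..<n} P (\<lambda>i \<omega>. - \<eta> (t i) \<omega>)"
      using sym n t unfolding symmetric_proc_def eq_fidi_iff by blast
  qed
qed

text \<open>The index 0 belongs to \<open>{..<n}\<close> because \<open>1 \<le> n\<close>, and
  serves as reference coordinate of the ratios.\<close>

lemma positive_lepage_family_proc:
  fixes n :: nat and t :: "nat \<Rightarrow> 't"
  assumes "prob_space P" "prob_space M" "integrable_proc T P \<eta>" "lepage_input_proc T M \<zeta> \<eta>s P \<eta>"
    and n: "1 \<le> n" and t: "\<And>i. i < n \<Longrightarrow> t i \<in> T" and pos: "positive_proc T P \<eta>"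
  shows "positive_lepage_family P {..<n} M \<zeta> (\<lambda>k i. \<eta>s k (t i)) (\<lambda>i. \<eta> (t i)) 0"
proof -
  interpret lepage_family P "{..<n}" M \<zeta> "\<lambda>k i. \<eta>s k (t i)" "\<lambda>i. \<eta> (t i)"
    by (rule lepage_family_proc) fact+
  show ?thesis
  proof unfold_locales
    show "AE \<omega> in P. \<forall>i\<in>{..<n}. 0 < \<eta> (t i) \<omega>"
      using pos t by (intro AE_finite_allI) (auto simp: positive_proc_def)
  qed (use n int in auto)
qed

lemma lepage_proc_joint_distr:
  "joint_distr I M (\<lambda>i. lepage_sum_proc \<zeta> \<eta>s (t i)) = joint_distr I M (lepage_family.X \<zeta> (\<lambda>k i. \<eta>s k (t i)))"
  "joint_distr I M (\<lambda>i. lepage_max_proc \<zeta> \<eta>s (t i)) = joint_distr I M (lepage_family.Y \<zeta> (\<lambda>k i. \<eta>s k (t i)))"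
  if "lepage_family P I M \<zeta> (\<lambda>k i. \<eta>s k (t i)) \<eta>"
  unfolding joint_distr_def lepage_family.X_def[OF that] lepage_family.Y_def[OF that] lepage_sum_proc_def lepage_max_proc_def
  by simp_all

theorem theorem9:
  fixes P :: "'p measure" and P' :: "'q measure"
    and M :: "'w measure" and M' :: "'v measure"
    and \<zeta> :: "nat \<Rightarrow> 'w \<Rightarrow> real" and \<zeta>' :: "nat \<Rightarrow> 'v \<Rightarrow> real"
    and \<xi> :: "'p \<Rightarrow> real ^ 'd" and \<xi>' :: "'q \<Rightarrow> real ^ 'd"
    and \<xi>s :: "nat \<Rightarrow> 'w \<Rightarrow> real ^ 'd" and \<xi>s' :: "nat \<Rightarrow> 'v \<Rightarrow> real ^ 'd"
    and T :: "'t set"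
    and \<eta> :: "'t \<Rightarrow> 'p \<Rightarrow> real" and \<eta>' :: "'t \<Rightarrow> 'q \<Rightarrow> real"
    and \<eta>s :: "nat \<Rightarrow> 't \<Rightarrow> 'w \<Rightarrow> real" and \<eta>s' :: "nat \<Rightarrow> 't \<Rightarrow> 'v \<Rightarrow> real"
  assumes "prob_space P" and "prob_space P'" and "prob_space M" and "prob_space M'"
  shows
    "(integrable P \<xi> \<and> integrable P' \<xi>' \<and> symmetric_vec P \<xi> \<and> symmetric_vec P' \<xi>' \<and>
      lepage_input_vec M \<zeta> \<xi>s P \<xi> \<and> lepage_input_vec M' \<zeta>' \<xi>s' P' \<xi>'
      \<longrightarrow> (distr M borel (lepage_sum_vec \<zeta> \<xi>s) = distr M' borel (lepage_sum_vec \<zeta>' \<xi>s')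
           \<longleftrightarrow> zonoid_equivalent_vec P \<xi> P' \<xi>'))
     \<and>
     (integrable_proc T P \<eta> \<and> integrable_proc T P' \<eta>' \<and>
      symmetric_proc T P \<eta> \<and> symmetric_proc T P' \<eta>' \<and>
      lepage_input_proc T M \<zeta> \<eta>s P \<eta> \<and> lepage_input_proc T M' \<zeta>' \<eta>s' P' \<eta>'
      \<longrightarrow> (eq_fidi T M (lepage_sum_proc \<zeta> \<eta>s) M' (lepage_sum_proc \<zeta>' \<eta>s')
           \<longleftrightarrow> zonoid_equivalent_proc T P \<eta> P' \<eta>'))
     \<and>
     (integrable P \<xi> \<and> integrable P' \<xi>' \<and> positive_vec P \<xi> \<and> positive_vec P' \<xi>' \<and>
      lepage_input_vec M \<zeta> \<xi>s P \<xi> \<and> lepage_input_vec M' \<zeta>' \<xi>s' P' \<xi>'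
      \<longrightarrow> (distr M borel (lepage_max_vec \<zeta> \<xi>s) = distr M' borel (lepage_max_vec \<zeta>' \<xi>s')
           \<longleftrightarrow> zonoid_equivalent_vec P \<xi> P' \<xi>'))
     \<and>
     (integrable_proc T P \<eta> \<and> integrable_proc T P' \<eta>' \<and>
      positive_proc T P \<eta> \<and> positive_proc T P' \<eta>' \<and>
      lepage_input_proc T M \<zeta> \<eta>s P \<eta> \<and> lepage_input_proc T M' \<zeta>' \<eta>s' P' \<eta>'
      \<longrightarrow> (eq_fidi T M (lepage_max_proc \<zeta> \<eta>s) M' (lepage_max_proc \<zeta>' \<eta>s')
           \<longleftrightarrow> zonoid_equivalent_proc T P \<eta> P' \<eta>'))"
proof (intro conjI impI; elim conjE)
  assume P: "integrable P \<xi>" "symmetric_vec P \<xi>" "lepage_input_vec M \<zeta> \<xi>s P \<xi>"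
    and P': "integrable P' \<xi>'" "symmetric_vec P' \<xi>'" "lepage_input_vec M' \<zeta>' \<xi>s' P' \<xi>'"
  have A: "symmetric_lepage_family P UNIV M \<zeta> (\<lambda>k i \<omega>. \<xi>s k \<omega> $ i) (\<lambda>i \<omega>. \<xi> \<omega> $ i)"
    by (rule symmetric_lepage_family_vec[OF assms(1,3) P(1,3,2)])
  have B: "symmetric_lepage_family P' UNIV M' \<zeta>' (\<lambda>k i \<omega>. \<xi>s' k \<omega> $ i) (\<lambda>i \<omega>. \<xi>' \<omega> $ i)"
    by (rule symmetric_lepage_family_vec[OF assms(2,4) P'(1,3,2)])
  have m: "\<xi>s k \<in> borel_measurable M" "\<xi>s' k \<in> borel_measurable M'" for k
    using P(3) P'(3) assms(3,4)
    by (auto simp: lepage_input_vec_def iid_copies_vec_def prob_space.indep_vars_def)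
  note X = lepage_sum_vec_joint_distr[OF A m(1)] and X' = lepage_sum_vec_joint_distr[OF B m(2)]
  show "distr M borel (lepage_sum_vec \<zeta> \<xi>s) = distr M' borel (lepage_sum_vec \<zeta>' \<xi>s') \<longleftrightarrow> zonoid_equivalent_vec P \<xi> P' \<xi>'"
    unfolding distr_vec_eq_iff[OF X(1) X'(1)] X(2) X'(2) sum_joint_distr_iff[OF A B] zonoid_equivalent_vec_iff ..
next
  assume P: "integrable_proc T P \<eta>" "symmetric_proc T P \<eta>" "lepage_input_proc T M \<zeta> \<eta>s P \<eta>"
    and P': "integrable_proc T P' \<eta>'" "symmetric_proc T P' \<eta>'" "lepage_input_proc T M' \<zeta>' \<eta>s' P' \<eta>'"
  have "joint_distr {..<n} M (\<lambda>i. lepage_sum_proc \<zeta> \<eta>s (t i)) = joint_distr {..<n} M' (\<lambda>i. lepage_sum_proc \<zeta>' \<eta>s' (t i)) \<longleftrightarrow>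
    (\<forall>u. (\<integral>\<omega>. \<bar>\<Sum>i<n. u i * \<eta> (t i) \<omega>\<bar> \<partial>P) = (\<integral>\<omega>. \<bar>\<Sum>i<n. u i * \<eta>' (t i) \<omega>\<bar> \<partial>P'))"
    if n: "1 \<le> n" and t: "\<And>i. i < n \<Longrightarrow> t i \<in> T" for n and t :: "nat \<Rightarrow> 't"
  proof -
    have A: "symmetric_lepage_family P {..<n} M \<zeta> (\<lambda>k i. \<eta>s k (t i)) (\<lambda>i. \<eta> (t i))"
      by (rule symmetric_lepage_family_proc[OF assms(1,3) P(1,3) n t P(2)])
    have B: "symmetric_lepage_family P' {..<n} M' \<zeta>' (\<lambda>k i. \<eta>s' k (t i)) (\<lambda>i. \<eta>' (t i))"
      by (rule symmetric_lepage_family_proc[OF assms(2,4) P'(1,3) n t P'(2)])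
    show ?thesis
      unfolding lepage_proc_joint_distr(1)[where t=t and \<eta>s=\<eta>s, OF symmetric_lepage_family.axioms(1)[OF A]]
        lepage_proc_joint_distr(1)[where t=t and \<eta>s=\<eta>s', OF symmetric_lepage_family.axioms(1)[OF B]]
      by (rule sum_joint_distr_iff[OF A B])
  qed
  then show "eq_fidi T M (lepage_sum_proc \<zeta> \<eta>s) M' (lepage_sum_proc \<zeta>' \<eta>s') \<longleftrightarrow> zonoid_equivalent_proc T P \<eta> P' \<eta>'"
    unfolding eq_fidi_iff zonoid_equivalent_proc_def by blast
next
  assume P: "integrable P \<xi>" "positive_vec P \<xi>" "lepage_input_vec M \<zeta> \<xi>s P \<xi>"
    and P': "integrable P' \<xi>'" "positive_vec P' \<xi>'" "lepage_input_vec M' \<zeta>' \<xi>s' P' \<xi>'"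
  \<comment> \<open>Any coordinate can serve as reference for the ratios; \<open>undefined\<close>
    names one in the nonempty index type, the same for both vectors.\<close>
  have A: "positive_lepage_family P UNIV M \<zeta> (\<lambda>k i \<omega>. \<xi>s k \<omega> $ i) (\<lambda>i \<omega>. \<xi> \<omega> $ i) undefined"
    by (rule positive_lepage_family_vec[OF assms(1,3) P(1,3,2)])
  have B: "positive_lepage_family P' UNIV M' \<zeta>' (\<lambda>k i \<omega>. \<xi>s' k \<omega> $ i) (\<lambda>i \<omega>. \<xi>' \<omega> $ i) undefined"
    by (rule positive_lepage_family_vec[OF assms(2,4) P'(1,3,2)])
  interpret A: positive_lepage_family P UNIV M \<zeta> "\<lambda>k i \<omega>. \<xi>s k \<omega> $ i" "\<lambda>i \<omega>. \<xi> \<omega> $ i" undefined by (rule A)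
  interpret B: positive_lepage_family P' UNIV M' \<zeta>' "\<lambda>k i \<omega>. \<xi>s' k \<omega> $ i" "\<lambda>i \<omega>. \<xi>' \<omega> $ i" undefined by (rule B)
  have Y: "lepage_max_vec \<zeta> \<xi>s = (\<lambda>\<omega>. \<chi> i. A.Y i \<omega>)" "lepage_max_vec \<zeta>' \<xi>s' = (\<lambda>\<omega>. \<chi> i. B.Y i \<omega>)"
    unfolding lepage_max_vec_def[abs_def] A.Y_def B.Y_def by simp_all
  have m: "(\<lambda>\<omega>. \<chi> i. A.Y i \<omega>) \<in> borel_measurable M" "(\<lambda>\<omega>. \<chi> i. B.Y i \<omega>) \<in> borel_measurable M'"
    by (subst borel_measurable_euclidean_space, auto simp: Basis_vec_def inner_axis)+
  show "distr M borel (lepage_max_vec \<zeta> \<xi>s) = distr M' borel (lepage_max_vec \<zeta>' \<xi>s') \<longleftrightarrow> zonoid_equivalent_vec P \<xi> P' \<xi>'"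
    unfolding Y distr_vec_eq_iff[OF m] vec_lambda_beta max_joint_distr_iff[OF A B] zonoid_equivalent_vec_iff ..
next
  assume P: "integrable_proc T P \<eta>" "positive_proc T P \<eta>" "lepage_input_proc T M \<zeta> \<eta>s P \<eta>"
    and P': "integrable_proc T P' \<eta>'" "positive_proc T P' \<eta>'" "lepage_input_proc T M' \<zeta>' \<eta>s' P' \<eta>'"
  have "joint_distr {..<n} M (\<lambda>i. lepage_max_proc \<zeta> \<eta>s (t i)) = joint_distr {..<n} M' (\<lambda>i. lepage_max_proc \<zeta>' \<eta>s' (t i)) \<longleftrightarrow>
    (\<forall>u. (\<integral>\<omega>. \<bar>\<Sum>i<n. u i * \<eta> (t i) \<omega>\<bar> \<partial>P) = (\<integral>\<omega>. \<bar>\<Sum>i<n. u i * \<eta>' (t i) \<omega>\<bar> \<partial>P'))"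
    if n: "1 \<le> n" and t: "\<And>i. i < n \<Longrightarrow> t i \<in> T" for n and t :: "nat \<Rightarrow> 't"
  proof -
    have A: "positive_lepage_family P {..<n} M \<zeta> (\<lambda>k i. \<eta>s k (t i)) (\<lambda>i. \<eta> (t i)) 0"
      by (rule positive_lepage_family_proc[OF assms(1,3) P(1,3) n t P(2)])
    have B: "positive_lepage_family P' {..<n} M' \<zeta>' (\<lambda>k i. \<eta>s' k (t i)) (\<lambda>i. \<eta>' (t i)) 0"
      by (rule positive_lepage_family_proc[OF assms(2,4) P'(1,3) n t P'(2)])
    show ?thesis
      unfolding lepage_proc_joint_distr(2)[where t=t and \<eta>s=\<eta>s, OF positive_lepage_family.axioms(1)[OF A]]
        lepage_proc_joint_distr(2)[where t=t and \<eta>s=\<eta>s', OF positive_lepage_family.axioms(1)[OF B]]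
      by (rule max_joint_distr_iff[OF A B])
  qed
  then show "eq_fidi T M (lepage_max_proc \<zeta> \<eta>s) M' (lepage_max_proc \<zeta>' \<eta>s') \<longleftrightarrow> zonoid_equivalent_proc T P \<eta> P' \<eta>'"
    unfolding eq_fidi_iff zonoid_equivalent_proc_def by blast
qed

end
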